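(* Let $w$ be a weight in $\mathbb{R}^n$, $n\ge2$, and let $1\le p<n$, with $\frac1p-\frac1{p^*}=\frac1n$. Then there is a constant $C$ depending only on $n$ and $p$ such that for every Lipschitz function $f$ and every cube $Q$ with $w(Q)>0$ $$\left(\int_Q|f-f_{Q,w}|^{p^*}\,w\,dx\right)^{1/p^*}\le C\left(\int_Q|\nabla f|^p\,\frac{\left(M^c(w\chi_Q)\right)^{p/n'}}{w^{p-1}}\,dx\right)^{1/p}.$$
   Context: Cubes are cubes in $\mathbb{R}^n$ with sides parallel to the coordinate axes. A weight is a locally integrable non-negative function; $w(Q)=\int_Q w\,dx$; $f_{Q,w}=\frac{1}{w(Q)}\int_Q f\,w\,dx$; $n'=n/(n-1)$. $M^c$ is the centered maximal operator over Euclidean balls, $$M^c g(x)=\sup_{r>0}\frac{1}{|B(x,r)|}\int_{B(x,r)}|g(y)|\,dy.$$ For $p>1$ the integrand on the right is taken to be $0$ where $\nabla f=0$, and $+\infty$ where $w=0$ and $\nabla f\ne0$; for $p=1$, $w^{p-1}=1$. *)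

theory Defs
  imports "HOL-Analysis.Analysis"
begin

text \<open>Cubes are taken closed and non-degenerate; passing to the open or a half-open cube
  changes every quantity below only on a null set.\<close>

definition is_cube :: "(real ^ 'n) set \<Rightarrow> bool" where
  "is_cube Q \<longleftrightarrow> (\<exists>a l. 0 < l \<and> Q = cbox a (a + vec l))"

definition is_weight :: "(real ^ 'n \<Rightarrow> real) \<Rightarrow> bool" where
  "is_weight w \<longleftrightarrow>
     (\<forall>x. 0 \<le> w x) \<and> (\<forall>K. compact K \<longrightarrow> set_integrable lebesgue K w)"

definition weight_of :: "(real ^ 'n \<Rightarrow> real) \<Rightarrow> (real ^ 'n) set \<Rightarrow> real" where
  "weight_of w Q = (LINT x:Q|lebesgue. w x)"

definition weighted_avg :: "(real ^ 'n \<Rightarrow> real) \<Rightarrow> (real ^ 'n \<Rightarrow> real) \<Rightarrow> (real ^ 'n) set \<Rightarrow> real" where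
  "weighted_avg w f Q = (1 / weight_of w Q) * (LINT x:Q|lebesgue. f x * w x)"

text \<open>The vector of partial derivatives. For Lipschitz \<open>f\<close> all of them exist almost everywhere
  (and almost everywhere this vector is the total derivative, by Rademacher's theorem);
  on the exceptional null set the value of \<^const>\<open>deriv\<close> is unspecified and irrelevant.\<close>

definition gradient :: "(real ^ 'n \<Rightarrow> real) \<Rightarrow> real ^ 'n \<Rightarrow> real ^ 'n" where
  "gradient f x = (\<chi> i. deriv (\<lambda>t. f (x + t *\<^sub>R axis i 1)) 0)"

text \<open>The maximal function may take the value \<open>\<infinity>\<close>, hence the extended codomain.\<close>

definition centered_maximal :: "(real ^ 'n \<Rightarrow> real) \<Rightarrow> real ^ 'n \<Rightarrow> ennreal" where
  "centered_maximal g x =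
     (SUP r\<in>{0<..}. (\<integral>\<^sup>+y\<in>ball x r. ennreal \<bar>g y\<bar> \<partial>lebesgue) / emeasure lebesgue (ball x r))"

text \<open>Real powers on \<open>[0, \<infinity>]\<close>; used for exponents \<open>a > 0\<close> only.\<close>

definition epowr :: "ennreal \<Rightarrow> real \<Rightarrow> ennreal" where
  "epowr x a = (if x = \<infinity> then \<infinity> else ennreal (enn2real x powr a))"

definition conj_exponent :: "real \<Rightarrow> real" where
  "conj_exponent s = s / (s - 1)"

text \<open>The integrand \<open>|\<nabla>f|\<^sup>p (M\<^sup>c(w \<chi>\<^sub>Q))\<^bsup>p/n'\<^esup> / w\<^bsup>p-1\<^esup>\<close>. The case \<open>p = 1\<close> is separate because
  \<open>w\<^bsup>p-1\<^esup>\<close> is then \<open>1\<close> also where \<open>w = 0\<close>, whereas \<open>0 powr 0 = 0\<close> in HOL.\<close>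

definition rhs_integrand ::
  "real \<Rightarrow> (real ^ 'n \<Rightarrow> real) \<Rightarrow> (real ^ 'n) set \<Rightarrow> (real ^ 'n \<Rightarrow> real) \<Rightarrow> real ^ 'n \<Rightarrow> ennreal" where
  "rhs_integrand p w Q f x =
     (let M = epowr (centered_maximal (\<lambda>y. w y * indicator Q y) x)
                    (p / conj_exponent (real CARD('n)))
      in if p = 1 then ennreal (norm (gradient f x)) * M
         else if gradient f x = 0 then 0
         else if w x = 0 then \<infinity>
         else ennreal (norm (gradient f x) powr p) * M / ennreal (w x powr (p - 1)))"

end

theory Submission
  imports Defs
begin

text \<open>
For a Lipschitz function \<open>u\<close> on a cube \<open>Q\<close> of side \<open>l\<close>, compare the averages of \<open>u\<close> over the homothetic
copies \<open>x + 2\<^sup>-\<^sup>k (Q - x)\<close>, shrinking one coordinate at a time. Only difference quotients along coordinate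
lines enter (so Rademacher's theorem is avoided), and the oscillation \<open>\<bar>u x - u\<^sub>Q\<bar>\<close> is bounded by the dyadic
sum of \<open>r\<^sub>k\<^bsup>1-n\<^esup>\<close> times the integral of \<open>\<bar>\<nabla>u\<bar>\<close> over \<open>Q \<inter> B(x, c r\<^sub>k)\<close>, where \<open>r\<^sub>k = l / 2\<^bsup>k+1\<^esup>\<close>. Integrating this over a
set \<open>F\<close> against \<open>\<mu> = w dx\<close> on \<open>Q\<close> and exchanging integrals leads to the sum of
\<open>r\<^sub>k\<^bsup>1-n\<^esup> \<mu>(F \<inter> B(y, c r\<^sub>k))\<close>, which is at most
\<open>C \<mu>(F)\<^bsup>1/n\<^esup> M\<^sup>c(w \<chi>\<^sub>Q)(y)\<^bsup>1/n'\<^esup>\<close> because each mass is bounded both by \<open>\<mu>(F)\<close> and by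
\<open>C r\<^sub>k\<^sup>n M\<^sup>c(w \<chi>\<^sub>Q)(y)\<close>. This is a weak-type inequality for \<open>p = 1\<close>. Applied to the truncations of \<open>f\<close>
between the levels \<open>2\<^sup>-\<^sup>k\<^sup>-\<^sup>1 B\<close> and \<open>2\<^sup>-\<^sup>k B\<close> above (or below) a weighted median, and combined with Hoelder's
inequality, it becomes a recursive inequality between the masses of consecutive level sets, with
total exponent \<open>n' \<ge> 1\<close>; summing it gives the strong inequality around the median. Replacing the median
by \<open>f\<^bsub>Q,w\<^esub>\<close> costs a constant factor.
\<close>

section \<open>Differentiability of Lipschitz functions on the line\<close>

text \<open>The weight satisfies no doubling or Muckenhoupt condition, so the Lebesgue average of a
  truncation says nothing about its values where \<open>w\<close> is concentrated. The median
  supplies a set of at least the mass of the level set on which the truncation takes a different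
  constant value, and no average is close to both constants. For \<open>p > 1\<close> Hoelder's
  inequality on a band between two levels leaves a power of the mass of the lower level set, which
  belongs to the next term of the sum being estimated. The estimate closes by absorbing a power less
  than one of the unknown total. This needs the total to be finite; boundedness of \<open>f\<close>
  on the cube gives that, and neither this bound nor the Lipschitz constant enters the final
  constant. Measurability shapes the rest: \<open>w\<close> is only Lebesgue measurable,
  \<open>gradient\<close> is built from \<open>deriv\<close>, and \<open>centered_maximal\<close> is
  a supremum over uncountably many radii. Tonelli's theorem is applied to Borel substitutes: the
  first two are replaced almost everywhere on the cube, and the maximal function by a smaller
  countable supremum, so the right-hand side does not increase.\<close>

text \<open>On the line a closed interval is a closed ball about its midpoint, so the Vitali theorem
  for balls applies. \<open>P\<close> will carry a slope condition, and \<open>V\<close> keeps the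
  chosen intervals inside a set of controlled length. The point \<open>x\<close> may be an endpoint,
  as difference quotients at \<open>x\<close> require.\<close>

lemma Vitali_covering_intervals:
  fixes S V :: "real set"
  assumes "open V" "S \<subseteq> V"
    and fine: "\<And>x \<delta>. x \<in> S \<Longrightarrow> \<delta> > 0 \<Longrightarrow> \<exists>c d. c \<le> x \<and> x \<le> d \<and> c < d \<and> d - c < \<delta> \<and> P c d"
  obtains C where "countable C" "\<And>c d. (c, d) \<in> C \<Longrightarrow> c < d \<and> P c d \<and> {c..d} \<subseteq> V"
    "disjoint_family_on (\<lambda>(c, d). {c..d}) C"
    "negligible (S - (\<Union>(c, d)\<in>C. {c..d}))"
proof -
  define K where "K = {(c, d). c < d \<and> P c d \<and> {c..d} \<subseteq> V}"
  define a :: "real \<times> real \<Rightarrow> real" where "a = (\<lambda>(c, d). (c + d) / 2)"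
  define r :: "real \<times> real \<Rightarrow> real" where "r = (\<lambda>(c, d). (d - c) / 2)"
  have cb: "cball (a i) (r i) = {fst i..snd i}" for i
    by (auto simp: a_def r_def cball_eq_atLeastAtMost field_simps split: prod.splits)
  obtain C where C: "countable C" "C \<subseteq> K"
     "pairwise (\<lambda>i j. disjnt (cball (a i) (r i)) (cball (a j) (r j))) C"
     "negligible (S - (\<Union>i \<in> C. cball (a i) (r i)))"
  proof (rule Vitali_covering_theorem_cballs[of K r S a])
    show "0 < r i" if "i \<in> K" for i
      using that by (auto simp: K_def r_def)
    fix x e :: real assume x: "x \<in> S" "0 < e"
    then obtain e' where e': "e' > 0" "ball x e' \<subseteq> V"
      using assms(1,2) by (meson openE subsetD)
    obtain c d where cd: "c \<le> x" "x \<le> d" "c < d" "d - c < min e e'" "P c d"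
      using fine[OF x(1), of "min e e'"] x e' by auto
    have "{c..d} \<subseteq> ball x e'"
      using cd by (auto simp: ball_def dist_real_def)
    then have "(c, d) \<in> K" using cd e' by (auto simp: K_def)
    moreover have "r (c, d) < e" using cd by (auto simp: r_def)
    moreover have "x \<in> cball (a (c, d)) (r (c, d))" using cd unfolding cb by auto
    ultimately show "\<exists>i. i \<in> K \<and> x \<in> cball (a i) (r i) \<and> r i < e" by blast
  qed
  show ?thesis
  proof (rule that[OF C(1)])
    show "c < d \<and> P c d \<and> {c..d} \<subseteq> V" if "(c, d) \<in> C" for c d
      using C(2) that by (auto simp: K_def)
    show "disjoint_family_on (\<lambda>(c, d). {c..d}) C"
      using C(3) unfolding cb disjoint_family_on_def pairwise_def disjnt_def case_prod_beta by simp
    show "negligible (S - (\<Union>(c, d)\<in>C. {c..d}))"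
      using C(4) by (simp add: cb case_prod_beta)
  qed
qed

text \<open>Turns slope bounds on single intervals into a comparison of a Stieltjes measure with
  length on their union: both measures add up over the disjoint countable family.\<close>

lemma emeasure_UN_intervals_le:
  fixes C :: "(real \<times> real) set"
  assumes "countable C" "disjoint_family_on (\<lambda>(c, d). {c..d}) C"
    and "sets M = sets borel" "sets N = sets borel"
    and le: "\<And>c d. (c, d) \<in> C \<Longrightarrow> \<alpha> * emeasure M {c..d} \<le> \<beta> * emeasure N {c..d}"
  shows "\<alpha> * emeasure M (\<Union>(c, d)\<in>C. {c..d}) \<le> \<beta> * emeasure N (\<Union>(c, d)\<in>C. {c..d})"
proof -
  have "emeasure M (\<Union>(c, d)\<in>C. {c..d}) = (\<integral>\<^sup>+i. emeasure M (case i of (c, d) \<Rightarrow> {c..d}) \<partial>count_space C)"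
    using assms(1-3) by (intro emeasure_UN_countable) (auto split: prod.splits)
  moreover have "emeasure N (\<Union>(c, d)\<in>C. {c..d}) = (\<integral>\<^sup>+i. emeasure N (case i of (c, d) \<Rightarrow> {c..d}) \<partial>count_space C)"
    using assms by (intro emeasure_UN_countable) (auto split: prod.splits)
  ultimately show ?thesis
    by (auto simp: nn_integral_cmult[symmetric] intro!: nn_integral_mono le split: prod.splits)
qed

text \<open>Lebesgue's argument: intervals of slope below \<open>r\<close>, of total length close to
  the outer measure of \<open>E\<close>, cover almost all of \<open>E\<close>, and intervals of
  slope above \<open>R\<close> inside them cover it again. The increments of \<open>G\<close> over
  the second family are at most those over the first, which forces \<open>R\<close> times the outer
  measure below \<open>r\<close> times it.\<close>

lemma negligible_derivative_oscillation:
  fixes G :: "real \<Rightarrow> real"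
  assumes mono: "\<And>x y. x \<le> y \<Longrightarrow> G x \<le> G y" and cont: "continuous_on UNIV G"
    and "0 \<le> r" "r < R"
    and E: "\<And>x \<delta>. x \<in> E \<Longrightarrow> \<delta> > 0 \<Longrightarrow> \<exists>c d. c \<le> x \<and> x \<le> d \<and> c < d \<and> d - c < \<delta> \<and> G d - G c < r * (d - c)"
           "\<And>x \<delta>. x \<in> E \<Longrightarrow> \<delta> > 0 \<Longrightarrow> \<exists>c d. c \<le> x \<and> x \<le> d \<and> c < d \<and> d - c < \<delta> \<and> R * (d - c) < G d - G c"
    and "bounded E"
  shows "negligible E"
proof -
  let ?N = "interval_measure G"
  have em: "emeasure ?N {c..d} = ennreal (G d - G c)" if "c < d" for c d
    using emeasure_interval_measure_Icc[of c d G] that mono cont by auto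
  \<comment> \<open>\<open>E\<close> is not known to be measurable, so its size is taken from a
    Borel hull of the same outer measure.\<close>
  obtain B where B: "B \<in> sets lborel" "E \<subseteq> B" "outer_measure_of lborel E = emeasure lborel B"
    using outer_measure_of_attain[of E lborel] by auto
  define e where "e = emeasure lborel B"
  obtain m where m: "E \<subseteq> ball 0 m" "m > 0"
    using bounded_subset_ballD[OF assms(7)] by blast
  have "e \<le> emeasure lborel (ball (0::real) m)"
    unfolding e_def B(3)[symmetric] using outer_measure_of_mono[OF m(1), of lborel]
      outer_measure_of_eq[of "ball (0::real) m" lborel] by auto
  then have efin: "e < \<infinity>"
    using emeasure_lborel_ball_finite[of "0::real" m] by (auto simp: less_top[symmetric] top_unique)
  have key: "ennreal R * e \<le> ennreal r * (e + ennreal \<epsilon>)" if "\<epsilon> > 0" for \<epsilon>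
  proof -
    obtain V where V: "open V" "B \<subseteq> V" "emeasure lborel (V - B) < \<epsilon>"
      using outer_regular_lborel[OF _ \<open>\<epsilon> > 0\<close>, of B] B by auto
    have lamV: "emeasure lborel V \<le> e + ennreal \<epsilon>"
    proof -
      have "emeasure lborel V = emeasure lborel B + emeasure lborel (V - B)"
        using V(1,2) B(1) plus_emeasure[of B lborel "V - B"] by (simp add: Un_absorb1 Diff_disjoint)
      then show ?thesis using less_imp_le[OF V(3)] unfolding e_def by (simp add: add_left_mono)
    qed
    obtain C where C: "countable C" "\<And>c d. (c, d) \<in> C \<Longrightarrow> c < d \<and> G d - G c < r * (d - c) \<and> {c..d} \<subseteq> V"
      "disjoint_family_on (\<lambda>(c, d). {c..d}) C" "negligible (E - (\<Union>(c, d)\<in>C. {c..d}))"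
      by (rule Vitali_covering_intervals[OF V(1) subset_trans[OF B(2) V(2)], of "\<lambda>c d. G d - G c < r * (d - c)"])
        (use E(1) in auto)
    let ?U1 = "\<Union>(c, d)\<in>C. {c..d}"
    \<comment> \<open>The open interiors leave room for steep intervals inside the flat ones; only
      the countably many endpoints are lost.\<close>
    define W where "W = (\<Union>(c, d)\<in>C. {c<..<d})"
    have "open W" by (auto simp: W_def)
    obtain C' where C': "countable C'" "\<And>c d. (c, d) \<in> C' \<Longrightarrow> c < d \<and> R * (d - c) < G d - G c \<and> {c..d} \<subseteq> W"
      "disjoint_family_on (\<lambda>(c, d). {c..d}) C'" "negligible (E \<inter> W - (\<Union>(c, d)\<in>C'. {c..d}))"
      by (rule Vitali_covering_intervals[OF \<open>open W\<close>, of "E \<inter> W" "\<lambda>c d. R * (d - c) < G d - G c"])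
        (use E(2) in auto)
    let ?U2 = "\<Union>(c, d)\<in>C'. {c..d}"
    have mU1 [measurable]: "?U1 \<in> sets borel" and mU2 [measurable]: "?U2 \<in> sets borel"
      using sets.countable_UN''[OF C(1), of "\<lambda>(c, d). {c..d}" borel]
        sets.countable_UN''[OF C'(1), of "\<lambda>(c, d). {c..d}" borel] by (simp_all add: case_prod_beta)
    have "negligible (E - ?U2)"
    proof (rule negligible_subset)
      show "E - ?U2 \<subseteq> (E - ?U1) \<union> (E \<inter> W - ?U2) \<union> (fst ` C \<union> snd ` C)"
      proof
        fix x assume x: "x \<in> E - ?U2"
        show "x \<in> (E - ?U1) \<union> (E \<inter> W - ?U2) \<union> (fst ` C \<union> snd ` C)"
        proof (cases "x \<in> ?U1")
          case True
          then obtain c d where cd: "(c, d) \<in> C" "c \<le> x" "x \<le> d" by auto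
          show ?thesis
          proof (cases "x = c \<or> x = d")
            case True
            then show ?thesis using cd(1) by force
          next
            case False
            then have "x \<in> W" using cd by (auto simp: W_def intro!: bexI[of _ "(c, d)"])
            then show ?thesis using x by blast
          qed
        qed (use x in blast)
      qed
      have "negligible (fst ` C \<union> snd ` C)"
        using C(1) countable_imp_null_set_lborel[of "fst ` C \<union> snd ` C"]
        by (auto simp: negligible_iff_null_sets intro: null_sets_completionI)
      then show "negligible ((E - ?U1) \<union> (E \<inter> W - ?U2) \<union> (fst ` C \<union> snd ` C))"
        using C(4) C'(4) by (auto intro!: negligible_Un)
    qed
    then have "E - ?U2 \<in> null_sets lebesgue" by (simp add: negligible_iff_null_sets)
    then obtain Z where Z: "Z \<in> null_sets lborel" "E - ?U2 \<subseteq> Z"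
      by (auto simp: null_sets_completion_iff2)
    have "e \<le> outer_measure_of lborel (?U2 \<union> Z)"
      unfolding e_def B(3)[symmetric] using Z by (intro outer_measure_of_mono) auto
    also have "\<dots> = emeasure lborel (?U2 \<union> Z)"
      using Z mU2 by (intro outer_measure_of_eq) auto
    also have "\<dots> = emeasure lborel ?U2"
      using Z mU2 by (intro emeasure_Un_null_set) auto
    finally have e2: "e \<le> emeasure lborel ?U2" .
    have "ennreal R * e \<le> ennreal R * emeasure lborel ?U2"
      by (intro mult_left_mono e2) auto
    also have "\<dots> \<le> 1 * emeasure ?N ?U2"
    proof (rule emeasure_UN_intervals_le[OF C'(1,3)])
      fix c d assume "(c, d) \<in> C'"
      then show "ennreal R * emeasure lborel {c..d} \<le> 1 * emeasure ?N {c..d}"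
        using C'(2)[of c d] assms(3,4) by (auto simp: em ennreal_mult[symmetric] intro!: ennreal_leI)
    qed auto
    also have "\<dots> \<le> 1 * emeasure ?N ?U1"
    proof -
      have "?U2 \<subseteq> ?U1"
      proof clarify
        fix x c d assume "(c, d) \<in> C'" "x \<in> {c..d}"
        then have "x \<in> W" using C'(2) by blast
        then obtain p where "p \<in> C" "fst p < x" "x < snd p" by (auto simp: W_def)
        then show "x \<in> ?U1" by (intro UN_I[of p]) (auto simp: case_prod_beta)
      qed
      then show ?thesis by (intro mult_left_mono emeasure_mono) auto
    qed
    also have "1 * emeasure ?N ?U1 \<le> ennreal r * emeasure lborel ?U1"
    proof (rule emeasure_UN_intervals_le[OF C(1,3)])
      fix c d assume "(c, d) \<in> C"
      then show "1 * emeasure ?N {c..d} \<le> ennreal r * emeasure lborel {c..d}"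
        using C(2)[of c d] assms(3,4) by (auto simp: em ennreal_mult[symmetric] intro!: ennreal_leI)
    qed auto
    also have "\<dots> \<le> ennreal r * emeasure lborel V"
      using C(2) V(1) by (intro mult_left_mono emeasure_mono) fastforce+
    also have "\<dots> \<le> ennreal r * (e + ennreal \<epsilon>)"
      by (intro mult_left_mono lamV) auto
    finally show ?thesis .
  qed
  obtain e' where e': "e = ennreal e'" "e' \<ge> 0" using efin by (cases e) auto
  have real_key: "R * e' \<le> r * (e' + \<epsilon>)" if "\<epsilon> > 0" for \<epsilon>
  proof -
    have "ennreal (R * e') \<le> ennreal (r * (e' + \<epsilon>))"
      using key[OF that] e' assms(3,4) that by (simp add: ennreal_mult ennreal_plus)
    then show ?thesis using assms(3) e' that by (subst (asm) ennreal_le_iff) auto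
  qed
  have "e' = 0"
  proof (rule ccontr)
    assume "e' \<noteq> 0"
    then have "e' > 0" using e' by auto
    \<comment> \<open>Chosen so that \<open>(r + 1) * \<epsilon>\<close> is half of
      \<open>(R - r) * e'\<close>; using \<open>r + 1\<close> avoids a division by zero when
      \<open>r = 0\<close>.\<close>
    define \<epsilon> where "\<epsilon> = (R - r) * e' / (2 * (r + 1))"
    have "\<epsilon> > 0" using \<open>e' > 0\<close> assms(3,4) by (simp add: \<epsilon>_def)
    have "(R - r) * e' \<le> r * \<epsilon>" using real_key[OF \<open>\<epsilon> > 0\<close>] by (simp add: algebra_simps)
    also have "\<dots> \<le> (r + 1) * \<epsilon>" using \<open>\<epsilon> > 0\<close> by (simp add: algebra_simps)
    also have "\<dots> = (R - r) * e' / 2" using assms(3) by (simp add: \<epsilon>_def divide_simps del: mult_eq_0_iff)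
    finally show False using \<open>e' > 0\<close> assms(4) by (simp add: mult_le_0_iff)
  qed
  then have "B \<in> null_sets lborel" using B(1) e' by (auto simp: e_def)
  then have "E \<in> null_sets lebesgue"
    using B(2) null_sets_completion_iff2 by blast
  then show ?thesis by (simp add: negligible_iff_null_sets)
qed

text \<open>The limit is the upper limit, written as the supremum of the numbers exceeded
  frequently. If \<open>q\<close> fell frequently below it by a margin, two rationals would fit into
  the gap. Rational pairs are what later makes the exceptional set a countable union.\<close>

lemma tendsto_if_no_rational_gap:
  fixes q :: "'a \<Rightarrow> real"
  assumes "F \<noteq> bot" and bd: "eventually (\<lambda>t. \<bar>q t\<bar> \<le> B) F"
    and gap: "\<And>r R. r \<in> \<rat> \<Longrightarrow> R \<in> \<rat> \<Longrightarrow> r < R \<Longrightarrow>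
       \<not> (frequently (\<lambda>t. q t < r) F \<and> frequently (\<lambda>t. R < q t) F)"
  shows "\<exists>l. (q \<longlongrightarrow> l) F"
proof -
  define S where "S = {s. frequently (\<lambda>t. s < q t) F}"
  have ne: "-B - 1 \<in> S"
  proof -
    have "eventually (\<lambda>t. -B - 1 < q t) F" using bd by eventually_elim auto
    then show ?thesis using assms(1) eventually_frequently by (auto simp: S_def)
  qed
  have ub: "s \<le> B" if "s \<in> S" for s
  proof (rule ccontr)
    assume "\<not> s \<le> B"
    then have "eventually (\<lambda>t. \<not> s < q t) F" using bd by (auto elim!: eventually_mono)
    then show False using that by (auto simp: S_def frequently_def)
  qed
  then have bdd: "bdd_above S" by (auto simp: bdd_above_def)
  define l where "l = Sup S"
  have "(q \<longlongrightarrow> l) F"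
  proof (rule tendstoI)
    fix e :: real assume "e > 0"
    have "l + e / 2 \<notin> S"
    proof
      assume "l + e / 2 \<in> S"
      then have "l + e / 2 \<le> l" unfolding l_def by (rule cSup_upper[OF _ bdd])
      then show False using \<open>e > 0\<close> by auto
    qed
    then have 1: "eventually (\<lambda>t. q t \<le> l + e / 2) F" by (auto simp: S_def frequently_def not_less)
    obtain s where s: "s \<in> S" "l - e / 2 < s"
      using less_cSupE[of "l - e/2" S] ne \<open>e > 0\<close> unfolding l_def by auto
    obtain R where R: "R \<in> \<rat>" "l - e / 2 < R" "R < s" using Rats_dense_in_real[OF s(2)] by auto
    obtain r where r: "r \<in> \<rat>" "l - e / 2 < r" "r < R" using Rats_dense_in_real[OF R(2)] by auto
    have "frequently (\<lambda>t. R < q t) F"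
      using s(1) R(3) unfolding S_def by (auto elim: frequently_elim1)
    then have "\<not> frequently (\<lambda>t. q t < r) F" using gap[OF r(1) R(1) r(3)] by auto
    then have "eventually (\<lambda>t. r \<le> q t) F" by (auto simp: frequently_def not_less)
    with 1 show "eventually (\<lambda>t. dist (q t) l < e) F"
      by eventually_elim (use r \<open>e > 0\<close> in \<open>auto simp: dist_real_def\<close>)
  qed
  then show ?thesis by blast
qed

text \<open>Adding \<open>L * x\<close> makes the function nondecreasing without affecting
  differentiability, so the monotone oscillation lemma applies on countably many sets, indexed by
  pairs of rational slopes and by bounded windows.\<close>

lemma lipschitz_imp_AE_differentiable:
  fixes \<phi> :: "real \<Rightarrow> real"
  assumes lip: "L-lipschitz_on UNIV \<phi>"
  shows "AE x in lebesgue. \<phi> differentiable (at x)"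
proof -
  have L: "L \<ge> 0" using lip by (rule lipschitz_on_nonneg)
  have lipD: "\<bar>\<phi> x - \<phi> y\<bar> \<le> L * \<bar>x - y\<bar>" for x y
    using lipschitz_onD[OF lip, of x y] by (simp add: dist_real_def)
  define G where "G = (\<lambda>x. \<phi> x + L * x)"
  have mono: "G x \<le> G y" if "x \<le> y" for x y
    using lipD[of x y] that by (auto simp: G_def algebra_simps abs_if split: if_splits)
  have cont: "continuous_on UNIV G"
    unfolding G_def by (intro continuous_intros lipschitz_on_continuous_on[OF lip])
  define P where "P = (\<lambda>x \<delta> (X :: real \<Rightarrow> real \<Rightarrow> bool). \<exists>c d. c \<le> x \<and> x \<le> d \<and> c < d \<and> d - c < \<delta> \<and> X (d - c) (G d - G c))"
  define E where "E = (\<lambda>r R m. {x. \<bar>x\<bar> < real m \<and> (\<forall>\<delta>>0. P x \<delta> (\<lambda>h v. v < r * h)) \<and> (\<forall>\<delta>>0. P x \<delta> (\<lambda>h v. R * h < v))})"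
  have negE: "negligible (E r R m)" if "0 \<le> r" "r < R" for r R m
  proof (rule negligible_derivative_oscillation[OF mono cont that])
    show "bounded (E r R m)"
      by (rule bounded_subset[of "ball 0 (real m)"]) (auto simp: E_def)
  qed (auto simp: E_def P_def)
  define N where "N = (\<Union>r\<in>{r\<in>\<rat>. 0 \<le> r}. \<Union>R\<in>{R\<in>\<rat>. r < R}. \<Union>m. E r R m)"
  have "N \<in> null_sets lebesgue"
    unfolding N_def using negE
    by (intro null_sets_UN' countable_subset[OF _ countable_rat]) (auto simp: negligible_iff_null_sets)
  moreover have "\<phi> differentiable (at x)" if "x \<notin> N" for x
  proof -
    define q where "q = (\<lambda>t. (G (x + t) - G x) / t)"
    have q0: "0 \<le> q t" for t
      using mono[of x "x + t"] mono[of "x + t" x] by (cases "t \<ge> 0") (auto simp: q_def divide_nonpos_nonpos)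
    \<comment> \<open>A difference quotient with step \<open>t\<close> is the slope over the
      interval between \<open>x\<close> and \<open>x + t\<close>, on whichever side of
      \<open>x\<close> it lies.\<close>
    have int: "P x \<delta> X" if freq: "frequently (\<lambda>t. X \<bar>t\<bar> (q t * \<bar>t\<bar>)) (at 0)" and "\<delta> > 0" for X \<delta>
    proof -
      have "eventually (\<lambda>t::real. \<bar>t\<bar> < \<delta> \<and> t \<noteq> 0) (at 0)"
        using \<open>\<delta> > 0\<close> by (auto simp: eventually_at intro!: exI[of _ \<delta>])
      then obtain t where t: "X \<bar>t\<bar> (q t * \<bar>t\<bar>)" "\<bar>t\<bar> < \<delta>" "t \<noteq> 0"
        using frequently_ex[OF frequently_eventually_frequently[OF freq]] by blast
      show ?thesis
      proof (cases "t > 0")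
        case True
        then show ?thesis unfolding P_def using t
          by (intro exI[of _ x] exI[of _ "x + t"]) (auto simp: q_def)
      next
        case False
        then show ?thesis unfolding P_def using t
          by (intro exI[of _ "x + t"] exI[of _ x]) (auto simp: q_def abs_if)
      qed
    qed
    obtain m :: nat where m: "\<bar>x\<bar> < real m" using reals_Archimedean2 by blast
    have "\<exists>l. (q \<longlongrightarrow> l) (at 0)"
    proof (rule tendsto_if_no_rational_gap)
      show "\<forall>\<^sub>F t in at 0. \<bar>q t\<bar> \<le> 2 * L"
      proof (rule always_eventually, rule allI)
        fix t
        have "\<bar>G (x + t) - G x\<bar> \<le> 2 * L * \<bar>t\<bar>"
          using lipD[of "x + t" x] L by (auto simp: G_def algebra_simps abs_if split: if_splits)
        then show "\<bar>q t\<bar> \<le> 2 * L" using L by (cases "t = 0") (auto simp: q_def divide_simps)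
      qed
      fix r R :: real assume rR: "r \<in> \<rat>" "R \<in> \<rat>" "r < R"
      show "\<not> (frequently (\<lambda>t. q t < r) (at 0) \<and> frequently (\<lambda>t. R < q t) (at 0))"
      proof
        assume *: "frequently (\<lambda>t. q t < r) (at 0) \<and> frequently (\<lambda>t. R < q t) (at 0)"
        obtain t where "q t < r" using * frequently_ex by blast
        then have "0 \<le> r" using q0[of t] by auto
        have ne: "eventually (\<lambda>t::real. t \<noteq> 0) (at 0)" by (auto simp: eventually_at intro!: exI[of _ 1])
        have "frequently (\<lambda>t. q t * \<bar>t\<bar> < r * \<bar>t\<bar>) (at 0)"
          by (rule frequently_rev_mp[OF conjunct1[OF *]]) (use ne in eventually_elim, auto)
        moreover have "frequently (\<lambda>t. R * \<bar>t\<bar> < q t * \<bar>t\<bar>) (at 0)"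
          by (rule frequently_rev_mp[OF conjunct2[OF *]]) (use ne in eventually_elim, auto)
        ultimately have "x \<in> E r R m"
          using m int[of "\<lambda>h v. v < r * h"] int[of "\<lambda>h v. R * h < v"] by (auto simp: E_def)
        then show False using that rR \<open>0 \<le> r\<close> by (auto simp: N_def)
      qed
    qed auto
    then obtain l where "(q \<longlongrightarrow> l) (at 0)" by blast
    then have "(G has_real_derivative l) (at x)" by (simp add: DERIV_def q_def)
    then have "((\<lambda>x. G x - L * x) has_real_derivative (l - L * 1)) (at x)"
      by (auto intro!: derivative_eq_intros)
    then show ?thesis unfolding G_def by (auto simp: real_differentiable_def)
  qed
  ultimately show ?thesis by (intro AE_I'[of N]) auto
qed

section \<open>Derivatives along lines\<close>

text \<open>Unlike \<^const>\<open>gradient\<close>, this is visibly a Borel function of the point.\<close>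

definition seq_derivative :: "('a::real_normed_vector \<Rightarrow> real) \<Rightarrow> 'a \<Rightarrow> 'a \<Rightarrow> real" where
  "seq_derivative f e x = lim (\<lambda>k. real (Suc k) * (f (x + (1 / real (Suc k)) *\<^sub>R e) - f x))"

lemma borel_measurable_seq_derivative:
  fixes f :: "'a::euclidean_space \<Rightarrow> real"
  assumes "continuous_on UNIV f"
  shows "seq_derivative f e \<in> borel_measurable borel"
proof -
  have [measurable]: "f \<in> borel_measurable borel"
    using assms by (rule borel_measurable_continuous_onI)
  show ?thesis unfolding seq_derivative_def by measurable
qed

lemma seq_derivative_tendsto:
  fixes f :: "'a::real_normed_vector \<Rightarrow> real"
  assumes "((\<lambda>t. f (x + t *\<^sub>R e)) has_real_derivative D) (at 0)"
  shows "(\<lambda>k. real (Suc k) * (f (x + (1 / real (Suc k)) *\<^sub>R e) - f x)) \<longlonglongrightarrow> D"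
proof -
  have "((\<lambda>h. (f (x + (0 + h) *\<^sub>R e) - f (x + 0 *\<^sub>R e)) / h) \<longlongrightarrow> D) (at 0)"
    using assms by (simp add: DERIV_def)
  moreover have "filterlim (\<lambda>k. 1 / real (Suc k)) (at 0) sequentially"
    using LIMSEQ_Suc[OF lim_1_over_n[where 'a = real]] by (simp add: filterlim_at)
  ultimately have "(\<lambda>k. (f (x + (0 + 1 / real (Suc k)) *\<^sub>R e) - f (x + 0 *\<^sub>R e)) / (1 / real (Suc k))) \<longlonglongrightarrow> D"
    by (rule filterlim_compose)
  then show ?thesis by (simp add: mult.commute field_simps)
qed

lemma seq_derivative_eq:
  fixes f :: "'a::real_normed_vector \<Rightarrow> real"
  assumes "((\<lambda>t. f (x + t *\<^sub>R e)) has_real_derivative D) (at 0)"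
  shows "seq_derivative f e x = D"
  unfolding seq_derivative_def using seq_derivative_tendsto[OF assms] by (rule limI)

text \<open>The redundant \<open>s *\<^sub>R 1\<close> matches \<open>seq_derivative\<close> in
  direction \<open>1\<close>, so that one notion serves on the line and in space.\<close>

lemma has_real_derivative_shift_0:
  fixes \<phi> :: "real \<Rightarrow> real"
  shows "(\<phi> has_real_derivative D) (at t) \<longleftrightarrow> ((\<lambda>s. \<phi> (t + s *\<^sub>R 1)) has_real_derivative D) (at 0)"
  using DERIV_shift[of \<phi> D 0 t] by (simp add: add.commute)

lemma lipschitz_AE_has_seq_derivative:
  fixes \<phi> :: "real \<Rightarrow> real"
  assumes "L-lipschitz_on UNIV \<phi>"
  shows "AE t in lborel. (\<phi> has_real_derivative seq_derivative \<phi> 1 t) (at t)"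
proof -
  have "AE t in lborel. \<phi> differentiable (at t)"
    using lipschitz_imp_AE_differentiable[OF assms] by (simp add: AE_completion_iff)
  then show ?thesis
  proof eventually_elim
    case (elim t)
    then obtain D where D: "(\<phi> has_real_derivative D) (at t)" by (auto simp: real_differentiable_def)
    then have "seq_derivative \<phi> 1 t = D" by (intro seq_derivative_eq) (simp only: has_real_derivative_shift_0[symmetric])
    with D show ?case by simp
  qed
qed

text \<open>The integral of a difference quotient of \<open>\<phi>\<close> over
  \<open>{a..b}\<close> is exactly the difference quotient of an antiderivative at \<open>b\<close>
  minus the one at \<open>a\<close>, and tends to \<open>\<phi> b - \<phi> a\<close>. The quotients
  are bounded by \<open>L\<close> and converge almost everywhere, so dominated convergence
  applies.\<close>

lemma lipschitz_diff_le_nn_integral_derivative: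
  fixes \<phi> :: "real \<Rightarrow> real"
  assumes lip: "L-lipschitz_on UNIV \<phi>" and "a \<le> b"
  shows "ennreal \<bar>\<phi> b - \<phi> a\<bar> \<le> (\<integral>\<^sup>+t. ennreal \<bar>seq_derivative \<phi> 1 t\<bar> * indicator {a..b} t \<partial>lborel)"
proof -
  have L: "L \<ge> 0" using lip by (rule lipschitz_on_nonneg)
  have cont: "continuous_on UNIV \<phi>" by (rule lipschitz_on_continuous_on[OF lip])
  note [measurable] = borel_measurable_continuous_onI[OF cont] borel_measurable_seq_derivative[OF cont]
  \<comment> \<open>The margins make all of \<open>{a..b + 1}\<close> interior, which includes the
    shifted arguments \<open>x + 1 / real (Suc k)\<close>.\<close>
  obtain \<Phi> where \<Phi>': "\<And>x. x \<in> {a - 1..b + 2} \<Longrightarrow> (\<Phi> has_vector_derivative \<phi> x) (at x within {a - 1..b + 2})"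
    using antiderivative_continuous[of "a - 1" "b + 2" \<phi>] continuous_on_subset[OF cont] by auto
  have \<Phi>: "(\<Phi> has_real_derivative \<phi> x) (at x)" if "a \<le> x" "x \<le> b + 1" for x
  proof -
    have "at x within {a - 1..b + 2} = at x" using that by (intro at_within_interior) auto
    then show ?thesis
      using \<Phi>'[of x] that by (simp add: has_real_derivative_iff_has_vector_derivative)
  qed
  define g where "g = (\<lambda>k t. real (Suc k) * (\<phi> (t + 1 / real (Suc k)) - \<phi> t))"
  define \<Gamma> where "\<Gamma> = (\<lambda>k t. real (Suc k) * (\<Phi> (t + 1 / real (Suc k)) - \<Phi> t))"
  have int_g: "(\<integral>t. g k t * indicator {a..b} t \<partial>lborel) = \<Gamma> k b - \<Gamma> k a" for k
  proof (rule integral_FTC_Icc_real[OF \<open>a \<le> b\<close>])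
    fix x assume x: "a \<le> x" "x \<le> b"
    have "1 / real (Suc k) \<le> 1" by simp
    then have 1: "(\<Phi> has_real_derivative \<phi> (x + 1 / real (Suc k))) (at (x + 1 / real (Suc k)))"
      using x by (intro \<Phi>) (auto intro: add_mono add_increasing2)
    then have "((\<lambda>t. \<Phi> (t + 1 / real (Suc k))) has_real_derivative \<phi> (x + 1 / real (Suc k))) (at x)"
      by (simp only: DERIV_shift)
    moreover have "(\<Phi> has_real_derivative \<phi> x) (at x)" using x by (intro \<Phi>) auto
    ultimately show "(\<Gamma> k has_real_derivative g k x) (at x)"
      unfolding \<Gamma>_def g_def by (auto intro!: derivative_eq_intros)
    show "isCont (g k) x"
      unfolding g_def using cont by (intro continuous_intros continuous_at_compose[unfolded o_def, of _ "\<lambda>t. t + 1 / real (Suc k)" \<phi>])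
        (auto simp: continuous_on_eq_continuous_at)
  qed
  have lim\<Gamma>: "(\<lambda>k. \<Gamma> k x) \<longlonglongrightarrow> \<phi> x" if "a \<le> x" "x \<le> b" for x
  proof -
    have "((\<lambda>t. \<Phi> (x + t *\<^sub>R 1)) has_real_derivative \<phi> x) (at 0)"
      using \<Phi>[of x] that by (simp only: has_real_derivative_shift_0[symmetric])
    from seq_derivative_tendsto[OF this] show ?thesis by (simp add: \<Gamma>_def)
  qed
  have AE_lim: "AE t in lborel. (\<lambda>k. g k t * indicator {a..b} t) \<longlonglongrightarrow> seq_derivative \<phi> 1 t * indicator {a..b} t"
    using lipschitz_AE_has_seq_derivative[OF lip]
  proof eventually_elim
    case (elim t)
    then have "((\<lambda>s. \<phi> (t + s *\<^sub>R 1)) has_real_derivative seq_derivative \<phi> 1 t) (at 0)"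
      by (simp only: has_real_derivative_shift_0[symmetric])
    from seq_derivative_tendsto[OF this] show ?case unfolding g_def by (intro tendsto_intros) simp
  qed
  have bound: "AE t in lborel. norm (g k t * indicator {a..b} t) \<le> L * indicator {a..b} t" for k
  proof (rule AE_I2)
    fix t
    have "\<bar>\<phi> (t + 1 / real (Suc k)) - \<phi> t\<bar> \<le> L * (1 / real (Suc k))"
      using lipschitz_onD[OF lip, of "t + 1 / real (Suc k)" t] by (simp add: dist_real_def)
    then have "real (Suc k) * \<bar>\<phi> (t + 1 / real (Suc k)) - \<phi> t\<bar> \<le> L"
      by (simp add: field_simps)
    then show "norm (g k t * indicator {a..b} t) \<le> L * indicator {a..b} t"
      by (auto simp: g_def abs_mult indicator_def)
  qed
  have intb: "integrable lborel (\<lambda>t. L * indicator {a..b} t :: real)"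
    by (intro integrable_mult_right integrable_real_indicator) (auto simp: emeasure_lborel_Icc_eq)
  have m1: "(\<lambda>t. seq_derivative \<phi> 1 t * indicator {a..b} t) \<in> borel_measurable lborel"
    and m2: "\<And>k. (\<lambda>t. g k t * indicator {a..b} t) \<in> borel_measurable lborel"
    by (simp_all add: g_def)
  have int: "integrable lborel (\<lambda>t. seq_derivative \<phi> 1 t * indicator {a..b} t)"
    by (rule integrable_dominated_convergence[OF m1 m2 intb AE_lim bound])
  have "(\<lambda>k. \<integral>t. g k t * indicator {a..b} t \<partial>lborel) \<longlonglongrightarrow> (\<integral>t. seq_derivative \<phi> 1 t * indicator {a..b} t \<partial>lborel)"
    by (rule integral_dominated_convergence[OF m1 m2 intb AE_lim bound])
  moreover have "(\<lambda>k. \<integral>t. g k t * indicator {a..b} t \<partial>lborel) \<longlonglongrightarrow> \<phi> b - \<phi> a"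
    unfolding int_g using \<open>a \<le> b\<close> by (intro tendsto_diff lim\<Gamma>) auto
  ultimately have "\<phi> b - \<phi> a = (\<integral>t. seq_derivative \<phi> 1 t * indicator {a..b} t \<partial>lborel)"
    by (rule LIMSEQ_unique[symmetric])
  then have "\<bar>\<phi> b - \<phi> a\<bar> \<le> (\<integral>t. \<bar>seq_derivative \<phi> 1 t * indicator {a..b} t\<bar> \<partial>lborel)"
    by (simp add: integral_abs_bound)
  then have "ennreal \<bar>\<phi> b - \<phi> a\<bar> \<le> (\<integral>\<^sup>+t. ennreal \<bar>seq_derivative \<phi> 1 t * indicator {a..b} t\<bar> \<partial>lborel)"
    using int by (subst nn_integral_eq_integral) (auto intro: ennreal_leI)
  also have "\<dots> = (\<integral>\<^sup>+t. ennreal \<bar>seq_derivative \<phi> 1 t\<bar> * indicator {a..b} t \<partial>lborel)"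
    by (intro nn_integral_cong) (auto simp: indicator_def)
  finally show ?thesis .
qed

section \<open>Truncation between two levels and the derivative along axis-parallel lines\<close>

definition clip :: "real \<Rightarrow> real \<Rightarrow> real \<Rightarrow> real" where
  "clip c d y = min (max y c) d"

lemma clip_lipschitz: "c \<le> d \<Longrightarrow> \<bar>clip c d y - clip c d z\<bar> \<le> \<bar>y - z\<bar>"
  by (auto simp: clip_def)

text \<open>Where \<open>\<phi> t \<le> c\<close> or \<open>d \<le> \<phi> t\<close> the truncation
  attains an extremum, so its derivative vanishes. The indicator may therefore be that of the open
  interval, and truncations to adjacent ranges of levels have derivatives bounded on disjoint
  sets.\<close>

lemma clip_derivative_le:
  assumes "c \<le> d" "(\<phi> has_real_derivative D) (at t)" "((\<lambda>s. clip c d (\<phi> s)) has_real_derivative D') (at t)"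
  shows "\<bar>D'\<bar> \<le> indicator {c<..<d} (\<phi> t) * \<bar>D\<bar>"
proof -
  consider "\<phi> t \<le> c" | "d \<le> \<phi> t" | "c < \<phi> t" "\<phi> t < d" by linarith
  then show ?thesis
  proof cases
    case 1
    have "D' = 0"
      by (rule DERIV_local_min[OF assms(3), of 1]) (use 1 assms(1) in \<open>auto simp: clip_def\<close>)
    then show ?thesis by simp
  next
    case 2
    have "D' = 0"
      by (rule DERIV_local_max[OF assms(3), of 1]) (use 2 assms(1) in \<open>auto simp: clip_def\<close>)
    then show ?thesis by simp
  next
    case 3
    have "\<bar>D'\<bar> \<le> \<bar>D\<bar>"
    proof (rule tendsto_le)
      show "((\<lambda>h. \<bar>(\<phi> (t + h) - \<phi> t) / h\<bar>) \<longlongrightarrow> \<bar>D\<bar>) (at 0)"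
        using assms(2) unfolding DERIV_def by (rule tendsto_rabs)
      show "((\<lambda>h. \<bar>(clip c d (\<phi> (t + h)) - clip c d (\<phi> t)) / h\<bar>) \<longlongrightarrow> \<bar>D'\<bar>) (at 0)"
        using assms(3) unfolding DERIV_def by (rule tendsto_rabs)
      show "\<forall>\<^sub>F h in at 0. \<bar>(clip c d (\<phi> (t + h)) - clip c d (\<phi> t)) / h\<bar> \<le> \<bar>(\<phi> (t + h) - \<phi> t) / h\<bar>"
        using clip_lipschitz[OF assms(1)] by (intro always_eventually) (auto simp: divide_right_mono)
    qed auto
    with 3 show ?thesis by simp
  qed
qed

lemma clip_diff_le_nn_integral_derivative:
  fixes \<phi> :: "real \<Rightarrow> real"
  assumes lip: "L-lipschitz_on UNIV \<phi>" and "a \<le> b" "c \<le> d"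
  shows "ennreal \<bar>clip c d (\<phi> b) - clip c d (\<phi> a)\<bar>
     \<le> (\<integral>\<^sup>+t. indicator {c<..<d} (\<phi> t) * ennreal \<bar>seq_derivative \<phi> 1 t\<bar> * indicator {a..b} t \<partial>lborel)"
proof -
  have lip': "L-lipschitz_on UNIV (\<lambda>s. clip c d (\<phi> s))"
    using lip clip_lipschitz[OF \<open>c \<le> d\<close>] unfolding lipschitz_on_def dist_real_def by (meson order_trans)
  note lipschitz_diff_le_nn_integral_derivative[OF lip' \<open>a \<le> b\<close>]
  also have "(\<integral>\<^sup>+t. ennreal \<bar>seq_derivative (\<lambda>s. clip c d (\<phi> s)) 1 t\<bar> * indicator {a..b} t \<partial>lborel)
     \<le> (\<integral>\<^sup>+t. indicator {c<..<d} (\<phi> t) * ennreal \<bar>seq_derivative \<phi> 1 t\<bar> * indicator {a..b} t \<partial>lborel)"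
  proof (rule nn_integral_mono_AE)
    show "AE t in lborel. ennreal \<bar>seq_derivative (\<lambda>s. clip c d (\<phi> s)) 1 t\<bar> * indicator {a..b} t
       \<le> indicator {c<..<d} (\<phi> t) * ennreal \<bar>seq_derivative \<phi> 1 t\<bar> * indicator {a..b} t"
      using lipschitz_AE_has_seq_derivative[OF lip] lipschitz_AE_has_seq_derivative[OF lip']
    proof eventually_elim
      case (elim t)
      from clip_derivative_le[OF \<open>c \<le> d\<close> elim]
      show ?case by (intro mult_right_mono) (auto simp: indicator_def intro: ennreal_leI split: if_splits)
    qed
  qed
  finally show ?thesis .
qed

text \<open>An upper gradient in the sense of metric analysis, tested on axis-parallel segments
  only, but on all of them and not merely on almost all. The signed step \<open>h\<close> is there
  because the condition is applied with \<open>h = (z - x) \<bullet> e\<close>.\<close>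

definition axis_upper_gradient :: "('a::euclidean_space \<Rightarrow> real) \<Rightarrow> ('a \<Rightarrow> ennreal) \<Rightarrow> bool" where
  "axis_upper_gradient u g \<longleftrightarrow> (\<forall>x. \<forall>e\<in>Basis. \<forall>h s t. s \<le> t \<longrightarrow>
     ennreal \<bar>u (x + (t * h) *\<^sub>R e) - u (x + (s * h) *\<^sub>R e)\<bar>
       \<le> ennreal \<bar>h\<bar> * (\<integral>\<^sup>+\<sigma>. g (x + (\<sigma> * h) *\<^sub>R e) * indicator {s..t} \<sigma> \<partial>lborel))"

lemma seq_derivative_line:
  "seq_derivative (\<lambda>\<tau>. f (x + \<tau> *\<^sub>R e)) 1 \<tau> = seq_derivative f e (x + \<tau> *\<^sub>R e)"
  by (simp add: seq_derivative_def scaleR_add_left add.assoc)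

lemma lipschitz_on_line:
  assumes "L-lipschitz_on UNIV f"
  shows "(L * norm e)-lipschitz_on UNIV (\<lambda>\<tau>. f (x + \<tau> *\<^sub>R e))"
proof (rule lipschitz_onI)
  fix s t :: real
  have "dist (f (x + s *\<^sub>R e)) (f (x + t *\<^sub>R e)) \<le> L * dist (x + s *\<^sub>R e) (x + t *\<^sub>R e)"
    by (rule lipschitz_onD[OF assms]) auto
  also have "dist (x + s *\<^sub>R e) (x + t *\<^sub>R e) = norm e * dist s t"
    by (simp add: dist_norm scaleR_diff_left[symmetric])
  finally show "dist (f (x + s *\<^sub>R e)) (f (x + t *\<^sub>R e)) \<le> L * norm e * dist s t"
    by (simp add: mult.assoc)
qed (use lipschitz_on_nonneg[OF assms] in simp)

lemma axis_upper_gradient_clip: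
  fixes f :: "'a::euclidean_space \<Rightarrow> real"
  assumes lip: "L-lipschitz_on UNIV f" and "c \<le> d"
    and g: "\<And>x e. e \<in> Basis \<Longrightarrow> indicator {c<..<d} (f x) * ennreal \<bar>seq_derivative f e x\<bar> \<le> g x"
  shows "axis_upper_gradient (\<lambda>x. clip c d (f x)) g"
  unfolding axis_upper_gradient_def
proof (intro allI ballI impI)
  fix x e :: 'a and h s t :: real assume e: "e \<in> Basis" and "s \<le> t"
  have cont: "continuous_on UNIV f" by (rule lipschitz_on_continuous_on[OF lip])
  note [measurable] = borel_measurable_continuous_onI[OF cont] borel_measurable_seq_derivative[OF cont]
  \<comment> \<open>The change of variables needs a Borel integrand along the line; \<open>F\<close>
    is one, and \<open>g\<close> enters only through the bound \<open>Fg\<close>.\<close>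
  define F where "F = (\<lambda>\<tau>. indicator {c<..<d} (f (x + \<tau> *\<^sub>R e)) * ennreal \<bar>seq_derivative f e (x + \<tau> *\<^sub>R e)\<bar>)"
  have [measurable]: "F \<in> borel_measurable borel" unfolding F_def by measurable
  have diff: "ennreal \<bar>clip c d (f (x + b *\<^sub>R e)) - clip c d (f (x + a *\<^sub>R e))\<bar>
      \<le> (\<integral>\<^sup>+\<tau>. F \<tau> * indicator {a..b} \<tau> \<partial>lborel)" if "a \<le> b" for a b
    using clip_diff_le_nn_integral_derivative[OF lipschitz_on_line[OF lip, of e x] that \<open>c \<le> d\<close>]
    by (simp add: F_def seq_derivative_line)
  have Fg: "(\<integral>\<^sup>+\<sigma>. F (h * \<sigma>) * indicator {s..t} \<sigma> \<partial>lborel) \<le> (\<integral>\<^sup>+\<sigma>. g (x + (\<sigma> * h) *\<^sub>R e) * indicator {s..t} \<sigma> \<partial>lborel)"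
    using g[OF e] by (intro nn_integral_mono mult_right_mono) (auto simp: F_def mult.commute)
  consider "h = 0" | "h > 0" | "h < 0" by linarith
  then show "ennreal \<bar>clip c d (f (x + (t * h) *\<^sub>R e)) - clip c d (f (x + (s * h) *\<^sub>R e))\<bar>
       \<le> ennreal \<bar>h\<bar> * (\<integral>\<^sup>+\<sigma>. g (x + (\<sigma> * h) *\<^sub>R e) * indicator {s..t} \<sigma> \<partial>lborel)"
  proof cases
    case 2
    have "ennreal \<bar>clip c d (f (x + (t * h) *\<^sub>R e)) - clip c d (f (x + (s * h) *\<^sub>R e))\<bar>
      \<le> (\<integral>\<^sup>+\<tau>. F \<tau> * indicator {s * h..t * h} \<tau> \<partial>lborel)"
      using 2 \<open>s \<le> t\<close> by (intro diff mult_right_mono) auto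
    also have "\<dots> = ennreal \<bar>h\<bar> * (\<integral>\<^sup>+\<sigma>. F (0 + h * \<sigma>) * indicator {s * h..t * h} (0 + h * \<sigma>) \<partial>lborel)"
      using 2 by (subst nn_integral_real_affine[where c = h and t = 0]) auto
    also have "(\<lambda>\<sigma>. indicator {s * h..t * h} (0 + h * \<sigma>) :: ennreal) = indicator {s..t}"
      using 2 by (auto simp: indicator_def fun_eq_iff mult.commute)
    finally show ?thesis using mult_left_mono[OF Fg, of "ennreal \<bar>h\<bar>"] by (auto intro: order_trans)
  next
    case 3
    have "ennreal \<bar>clip c d (f (x + (s * h) *\<^sub>R e)) - clip c d (f (x + (t * h) *\<^sub>R e))\<bar>
      \<le> (\<integral>\<^sup>+\<tau>. F \<tau> * indicator {t * h..s * h} \<tau> \<partial>lborel)"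
      using 3 \<open>s \<le> t\<close> by (intro diff mult_right_mono_neg) auto
    also have "\<dots> = ennreal \<bar>h\<bar> * (\<integral>\<^sup>+\<sigma>. F (0 + h * \<sigma>) * indicator {t * h..s * h} (0 + h * \<sigma>) \<partial>lborel)"
      using 3 by (subst nn_integral_real_affine[where c = h and t = 0]) auto
    also have "(\<lambda>\<sigma>. indicator {t * h..s * h} (0 + h * \<sigma>) :: ennreal) = indicator {s..t}"
      using 3 by (auto simp: indicator_def fun_eq_iff mult.commute)
    finally show ?thesis using mult_left_mono[OF Fg, of "ennreal \<bar>h\<bar>"]
      by (subst abs_minus_commute) (auto intro: order_trans)
  qed simp
qed

section \<open>Partial derivatives almost everywhere in space\<close>

text \<open>A description by countably many conditions, needed to see that the set of
  non-differentiability is Borel. Multiplying out the quotient admits \<open>q = 0\<close> and makes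
  both sides continuous, so the estimate extends from rational to real increments by
  density.\<close>

lemma has_real_derivative_iff_rational_quotients:
  fixes \<psi> :: "real \<Rightarrow> real"
  assumes cont: "continuous_on UNIV \<psi>"
  shows "(\<psi> has_real_derivative D) (at 0) \<longleftrightarrow> (\<forall>j::nat. \<exists>m::nat. \<forall>q::rat.
     \<bar>of_rat q\<bar> < 1 / real (Suc m) \<longrightarrow> \<bar>\<psi> (of_rat q) - \<psi> 0 - D * of_rat q\<bar> \<le> \<bar>of_rat q\<bar> / real (Suc j))"
    (is "_ \<longleftrightarrow> ?R")
proof
  assume "(\<psi> has_real_derivative D) (at 0)"
  then have lim: "((\<lambda>h. (\<psi> h - \<psi> 0) / h) \<longlongrightarrow> D) (at 0)" by (simp add: DERIV_def)
  show ?R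
  proof
    fix j :: nat
    have "eventually (\<lambda>h. dist ((\<psi> h - \<psi> 0) / h) D < 1 / real (Suc j)) (at 0)"
      by (rule tendstoD[OF lim]) auto
    then obtain d where d: "d > 0" "\<And>h. h \<noteq> 0 \<Longrightarrow> \<bar>h\<bar> < d \<Longrightarrow> \<bar>(\<psi> h - \<psi> 0) / h - D\<bar> < 1 / real (Suc j)"
      by (auto simp: eventually_at dist_real_def)
    obtain m where m: "1 / real (Suc m) < d" using d(1) nat_approx_posE by blast
    show "\<exists>m::nat. \<forall>q::rat. \<bar>of_rat q\<bar> < 1 / real (Suc m) \<longrightarrow> \<bar>\<psi> (of_rat q) - \<psi> 0 - D * of_rat q\<bar> \<le> \<bar>of_rat q\<bar> / real (Suc j)"
    proof (intro exI allI impI)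
      fix q :: rat assume q: "\<bar>of_rat q\<bar> < 1 / real (Suc m)"
      show "\<bar>\<psi> (of_rat q) - \<psi> 0 - D * of_rat q\<bar> \<le> \<bar>of_rat q\<bar> / real (Suc j)"
      proof (cases "q = 0")
        case False
        define h where "h = (of_rat q :: real)"
        have h: "h \<noteq> 0" "\<bar>h\<bar> < d" using False q m by (auto simp: h_def)
        have "\<psi> h - \<psi> 0 - D * h = ((\<psi> h - \<psi> 0) / h - D) * h" using h by (simp add: field_simps)
        then have "\<bar>\<psi> h - \<psi> 0 - D * h\<bar> \<le> 1 / real (Suc j) * \<bar>h\<bar>"
          using d(2)[OF h] by (simp only: abs_mult) (intro mult_right_mono, auto)
        then show ?thesis by (simp add: h_def)
      qed simp
    qed
  qed
next
  assume R: ?R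
  have "((\<lambda>h. (\<psi> h - \<psi> 0) / h) \<longlongrightarrow> D) (at 0)"
  proof (rule tendstoI)
    fix \<epsilon> :: real assume "\<epsilon> > 0"
    then obtain j where j: "1 / real (Suc j) < \<epsilon>" using nat_approx_posE by blast
    obtain m where m: "\<And>q::rat. \<bar>of_rat q\<bar> < 1 / real (Suc m) \<Longrightarrow> \<bar>\<psi> (of_rat q) - \<psi> 0 - D * of_rat q\<bar> \<le> \<bar>of_rat q\<bar> / real (Suc j)"
      using R by blast
    have le: "\<bar>\<psi> h - \<psi> 0 - D * h\<bar> \<le> \<bar>h\<bar> / real (Suc j)" if "\<bar>h\<bar> < 1 / real (Suc m)" for h
    proof -
      let ?B = "ball (0::real) (1 / real (Suc m))"
      have "closure (?B \<inter> \<rat>) = closure ?B"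
        by (rule closure_open_Int_superset) (auto simp: Rats_closure_real)
      moreover have "h \<in> closure ?B" using that by (intro subsetD[OF closure_subset]) auto
      ultimately have "h \<in> closure (?B \<inter> \<rat>)" by simp
      moreover have "continuous_on (closure (?B \<inter> \<rat>)) (\<lambda>h. \<bar>h\<bar> / real (Suc j) - \<bar>\<psi> h - \<psi> 0 - D * h\<bar>)"
        by (intro continuous_intros continuous_on_subset[OF cont]) auto
      moreover have "0 \<le> \<bar>h\<bar> / real (Suc j) - \<bar>\<psi> h - \<psi> 0 - D * h\<bar>" if "h \<in> ?B \<inter> \<rat>" for h
        using that m by (auto elim!: Rats_cases)
      ultimately show ?thesis using continuous_ge_on_closure[of "?B \<inter> \<rat>" _ h 0] by force
    qed
    have "dist ((\<psi> h - \<psi> 0) / h) D < \<epsilon>" if "h \<noteq> 0" "dist h 0 < 1 / real (Suc m)" for h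
    proof -
      have "dist ((\<psi> h - \<psi> 0) / h) D = \<bar>\<psi> h - \<psi> 0 - D * h\<bar> / \<bar>h\<bar>"
        using that by (simp add: dist_real_def abs_divide[symmetric] diff_divide_distrib)
      also have "\<dots> \<le> 1 / real (Suc j)" using le[of h] that by (simp add: field_simps)
      finally show ?thesis using j by simp
    qed
    then show "\<forall>\<^sub>F h in at 0. dist ((\<psi> h - \<psi> 0) / h) D < \<epsilon>"
      unfolding eventually_at by (intro exI[of _ "1 / real (Suc m)"]) auto
  qed
  then show "(\<psi> has_real_derivative D) (at 0)" by (simp add: DERIV_def)
qed

text \<open>Tonelli in the translation parameter replaces Tonelli in the coordinate along \<open>e\<close>.\<close>

lemma null_set_of_null_lines:
  fixes N :: "'a::euclidean_space set"
  assumes N [measurable]: "N \<in> sets borel" and "\<And>x. AE s in lborel. x + s *\<^sub>R e \<notin> N"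
  shows "N \<in> null_sets lborel"
proof -
  have psf: "pair_sigma_finite (lborel :: real measure) (lborel :: 'a measure)" ..
  \<comment> \<open>Integrating in \<open>x\<close> first gives the measure of \<open>N\<close> for
    each \<open>s\<close>, by translation invariance; restricting \<open>s\<close> to an interval of
    length one makes the double integral exactly that measure.\<close>
  define F :: "real \<times> 'a \<Rightarrow> ennreal" where "F = (\<lambda>(s, x). indicator {0..1} s * indicator N (x + s *\<^sub>R e))"
  have [measurable]: "F \<in> borel_measurable (lborel \<Otimes>\<^sub>M lborel)"
    unfolding F_def by measurable
  have "(\<integral>\<^sup>+x. F (s, x) \<partial>lborel) = indicator {0..1} s * emeasure lborel N" for s
  proof -
    have "(\<integral>\<^sup>+x. indicator N (x + s *\<^sub>R e) \<partial>lborel) = (\<integral>\<^sup>+x. indicator N x \<partial>distr lborel borel ((+) (s *\<^sub>R e)))"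
      by (subst nn_integral_distr) (auto simp: add.commute)
    also have "\<dots> = emeasure lborel N" by (simp add: lborel_distr_plus)
    finally show ?thesis by (simp add: F_def nn_integral_cmult)
  qed
  then have "(\<integral>\<^sup>+s. (\<integral>\<^sup>+x. F (s, x) \<partial>lborel) \<partial>lborel) = emeasure lborel N"
    by (simp add: nn_integral_multc)
  moreover have "(\<integral>\<^sup>+s. F (s, x) \<partial>lborel) = 0" for x
  proof -
    have "AE s in lborel. F (s, x) = 0"
      using assms(2)[of x] by eventually_elim (auto simp: F_def)
    then show ?thesis by (subst nn_integral_0_iff_AE) auto
  qed
  ultimately have "emeasure lborel N = 0" using pair_sigma_finite.Fubini[OF psf, of F] by simp
  then show ?thesis by auto
qed

text \<open>The exceptional set is Borel by the rational description and meets every line of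
  direction \<open>e\<close> in a null set of parameters, by the one-dimensional theorem.\<close>

lemma lipschitz_AE_has_partial_derivative:
  fixes f :: "'a::euclidean_space \<Rightarrow> real"
  assumes lip: "L-lipschitz_on UNIV f"
  shows "AE x in lborel. ((\<lambda>t. f (x + t *\<^sub>R e)) has_real_derivative seq_derivative f e x) (at 0)"
proof -
  have cont: "continuous_on UNIV f" by (rule lipschitz_on_continuous_on[OF lip])
  define N where "N = {x. \<not> ((\<lambda>t. f (x + t *\<^sub>R e)) has_real_derivative seq_derivative f e x) (at 0)}"
  have N_eq: "N = {x\<in>space borel. \<not> (\<forall>j::nat. \<exists>m::nat. \<forall>q::rat.
     \<bar>of_rat q\<bar> < 1 / real (Suc m) \<longrightarrow>
       \<bar>f (x + of_rat q *\<^sub>R e) - f (x + 0 *\<^sub>R e) - seq_derivative f e x * of_rat q\<bar> \<le> \<bar>of_rat q\<bar> / real (Suc j))}"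
    unfolding N_def
    by (subst has_real_derivative_iff_rational_quotients)
       (auto intro!: continuous_intros continuous_on_compose2[OF cont])
  have [measurable]: "(\<lambda>x. \<bar>f (x + q *\<^sub>R e) - f (x + 0 *\<^sub>R e) - seq_derivative f e x * q\<bar>) \<in> borel_measurable borel" for q
    by (intro borel_measurable_abs borel_measurable_diff borel_measurable_times borel_measurable_const
        borel_measurable_seq_derivative[OF cont] borel_measurable_continuous_onI continuous_on_compose2[OF cont] continuous_intros) auto
  have "N \<in> sets borel"
    unfolding N_eq by measurable
  then have "N \<in> null_sets lborel"
  proof (rule null_set_of_null_lines)
    fix x
    have "AE s in lborel. ((\<lambda>\<tau>. f (x + \<tau> *\<^sub>R e)) has_real_derivative
        seq_derivative (\<lambda>\<tau>. f (x + \<tau> *\<^sub>R e)) 1 s) (at s)"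
      by (rule lipschitz_AE_has_seq_derivative[OF lipschitz_on_line[OF lip]])
    then show "AE s in lborel. x + s *\<^sub>R e \<notin> N"
    proof eventually_elim
      case (elim s)
      then have "((\<lambda>\<sigma>. f (x + (s + \<sigma> *\<^sub>R 1) *\<^sub>R e)) has_real_derivative seq_derivative f e (x + s *\<^sub>R e)) (at 0)"
        unfolding seq_derivative_line by (subst (asm) has_real_derivative_shift_0)
      then show ?case by (simp add: N_def scaleR_add_left add.assoc)
    qed
  qed
  then have "AE x in lborel. x \<notin> N" by (rule AE_not_in)
  then show ?thesis by eventually_elim (simp add: N_def)
qed

text \<open>Allows the gradient to be exchanged for a Borel vector field under the integral.\<close>

lemma AE_gradient_eq:
  fixes f :: "real ^ 'n \<Rightarrow> real"
  assumes lip: "L-lipschitz_on UNIV f"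
  shows "AE x in lborel. gradient f x = (\<chi> i. seq_derivative f (axis i 1) x)"
proof -
  have "AE x in lborel. \<forall>i\<in>UNIV. ((\<lambda>t. f (x + t *\<^sub>R axis i 1)) has_real_derivative seq_derivative f (axis i 1) x) (at 0)"
    using lipschitz_AE_has_partial_derivative[OF lip] by (intro AE_ball_countable[THEN iffD2]) auto
  then show ?thesis
    by eventually_elim (auto simp: gradient_def vec_eq_iff intro: DERIV_imp_deriv)
qed

section \<open>Averages over dilated cubes\<close>

definition cube :: "'a::euclidean_space \<Rightarrow> real \<Rightarrow> 'a set" where
  "cube a l = cbox a (a + l *\<^sub>R One)"

lemma mem_cube: "x \<in> cube a l \<longleftrightarrow> (\<forall>e\<in>Basis. a \<bullet> e \<le> x \<bullet> e \<and> x \<bullet> e \<le> a \<bullet> e + l)"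
  by (simp add: cube_def mem_box inner_add_left)

lemma cube_sets [measurable]: "cube a l \<in> sets borel"
  by (simp add: cube_def)

lemma emeasure_cube: "0 < l \<Longrightarrow> emeasure lborel (cube (a::'a::euclidean_space) l) = ennreal (l ^ DIM('a))"
  unfolding cube_def by (subst emeasure_lborel_cbox) (auto simp: inner_add_left)

text \<open>Different dilation factors in different coordinates interpolate between \<open>x + t (z - x)\<close> and
  \<open>x + (t / 2) (z - x)\<close> along axis-parallel segments.\<close>

definition dil :: "('a::euclidean_space \<Rightarrow> real) \<Rightarrow> 'a \<Rightarrow> 'a \<Rightarrow> 'a" where
  "dil c x z = x + (\<Sum>b\<in>Basis. (c b * ((z - x) \<bullet> b)) *\<^sub>R b)"

lemma dil_inner: "e \<in> Basis \<Longrightarrow> dil c x z \<bullet> e = x \<bullet> e + c e * ((z - x) \<bullet> e)"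
  by (simp add: dil_def inner_add_left inner_sum_left inner_Basis if_distrib cong: if_cong)

lemma dil_const: "dil (\<lambda>_. t) x z = x + t *\<^sub>R (z - x)"
  by (rule euclidean_eqI) (simp add: dil_inner inner_add_left)

lemma dil_cong: "(\<And>b. b \<in> Basis \<Longrightarrow> c b = c' b) \<Longrightarrow> dil c x z = dil c' x z"
  unfolding dil_def by (intro arg_cong2[where f = "(+)"] sum.cong) auto

text \<open>Varying one dilation factor moves the point along an axis-parallel segment with step
  \<open>(z - x) \<bullet> e\<close>, in the form that \<open>axis_upper_gradient\<close>
  expects.\<close>

lemma dil_upd:
  assumes "e \<in> Basis"
  shows "dil (c(e := \<sigma>)) x z = dil (\<lambda>b. if b = e then 0 else c b) x z + (\<sigma> * ((z - x) \<bullet> e)) *\<^sub>R e"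
  by (rule euclidean_eqI) (use assms in \<open>auto simp: dil_inner inner_add_left inner_Basis\<close>)

lemma dil_measurable [measurable]:
  "(\<lambda>z. dil c x z) \<in> borel \<rightarrow>\<^sub>M borel"
  unfolding dil_def by measurable

lemma dil_in_cube:
  assumes "x \<in> cube a l" "z \<in> cube a l" "\<And>b. b \<in> Basis \<Longrightarrow> 0 \<le> c b \<and> c b \<le> 1"
  shows "dil c x z \<in> cube a l"
  unfolding mem_cube
proof
  fix e :: 'a assume e: "e \<in> Basis"
  have c: "0 \<le> c e" "0 \<le> 1 - c e" using assms(3)[OF e] by auto
  have "a \<bullet> e \<le> x \<bullet> e" "x \<bullet> e \<le> a \<bullet> e + l" "a \<bullet> e \<le> z \<bullet> e" "z \<bullet> e \<le> a \<bullet> e + l"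
    using assms(1,2) e by (auto simp: mem_cube)
  then have "0 \<le> (1 - c e) * (x \<bullet> e - a \<bullet> e)" "0 \<le> c e * (z \<bullet> e - a \<bullet> e)"
    "0 \<le> (1 - c e) * (a \<bullet> e + l - x \<bullet> e)" "0 \<le> c e * (a \<bullet> e + l - z \<bullet> e)"
    using c by (auto intro!: mult_nonneg_nonneg)
  then show "a \<bullet> e \<le> dil c x z \<bullet> e \<and> dil c x z \<bullet> e \<le> a \<bullet> e + l"
    using e by (auto simp: dil_inner inner_diff_left algebra_simps)
qed

lemma dist_dil_le:
  fixes x z :: "'a::euclidean_space"
  assumes "x \<in> cube a l" "z \<in> cube a l" "\<And>b. b \<in> Basis \<Longrightarrow> 0 \<le> c b \<and> c b \<le> t"
  shows "dist x (dil c x z) \<le> t * (real DIM('a) * l)"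
proof -
  have "dist x (dil c x z) = norm (dil c x z - x)" by (simp add: dist_norm norm_minus_commute)
  also have "\<dots> \<le> (\<Sum>b\<in>Basis. \<bar>(dil c x z - x) \<bullet> b\<bar>)" by (rule norm_le_l1)
  also have "\<dots> \<le> (\<Sum>b\<in>(Basis::'a set). t * l)"
  proof (rule sum_mono)
    fix b :: 'a assume b: "b \<in> Basis"
    have "\<bar>(z - x) \<bullet> b\<bar> \<le> l" using assms(1,2) b by (force simp: mem_cube inner_diff_left abs_le_iff)
    then have "c b * \<bar>(z - x) \<bullet> b\<bar> \<le> t * l"
      using assms(3)[OF b] by (intro mult_mono) auto
    then show "\<bar>(dil c x z - x) \<bullet> b\<bar> \<le> t * l"
      using b assms(3)[OF b] by (simp add: inner_diff_left dil_inner abs_mult)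
  qed
  finally show ?thesis by (simp add: algebra_simps)
qed

lemma nn_integral_dil:
  fixes x :: "'a::euclidean_space"
  assumes [measurable]: "G \<in> borel_measurable borel" and c: "\<And>b. b \<in> Basis \<Longrightarrow> 0 < c b"
  shows "(\<integral>\<^sup>+z. G z \<partial>lborel) = ennreal (\<Prod>b\<in>Basis. c b) * (\<integral>\<^sup>+z. G (dil c x z) \<partial>lborel)"
proof -
  let ?t = "x - (\<Sum>b\<in>Basis. (c b * (x \<bullet> b)) *\<^sub>R b)"
  have T: "?t + (\<Sum>j\<in>Basis. (c j * (z \<bullet> j)) *\<^sub>R j) = dil c x z" for z
    by (simp add: dil_def inner_diff_left algebra_simps sum.distrib sum_subtractf)
  have "lborel = density (distr lborel borel (\<lambda>z. dil c x z)) (\<lambda>_. ennreal (\<Prod>j\<in>Basis. \<bar>c j\<bar>))"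
    using lborel_affine_euclidean[of c ?t] c unfolding T by force
  then have "(\<integral>\<^sup>+z. G z \<partial>lborel) = (\<integral>\<^sup>+z. G z \<partial>density (distr lborel borel (\<lambda>z. dil c x z)) (\<lambda>_. ennreal (\<Prod>j\<in>Basis. \<bar>c j\<bar>)))"
    by simp
  also have "\<dots> = ennreal (\<Prod>b\<in>Basis. \<bar>c b\<bar>) * (\<integral>\<^sup>+z. G (dil c x z) \<partial>lborel)"
    by (simp add: nn_integral_density nn_integral_distr nn_integral_cmult)
  also have "(\<Prod>b\<in>Basis. \<bar>c b\<bar>) = (\<Prod>b\<in>Basis. c b)"
    using c by (intro prod.cong) (auto simp: less_imp_le)
  finally show ?thesis .
qed

text \<open>The Jacobian is the product of the factors, hence at least \<open>s ^ DIM('a)\<close>.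
  By convexity the image of the cube stays in the cube, and it stays near \<open>x\<close> since
  every factor is at most \<open>t\<close>.\<close>

lemma nn_integral_dil_le:
  fixes x :: "'a::euclidean_space"
  assumes [measurable]: "g \<in> borel_measurable borel"
    and "x \<in> cube a l" "0 < s" "s \<le> t" "t \<le> 1"
    and c: "\<And>b. b \<in> Basis \<Longrightarrow> s \<le> c b \<and> c b \<le> t"
  shows "ennreal (s ^ DIM('a)) * (\<integral>\<^sup>+z\<in>cube a l. g (dil c x z) \<partial>lborel)
     \<le> (\<integral>\<^sup>+y\<in>cube a l \<inter> cball x (t * (real DIM('a) * l)). g y \<partial>lborel)"
proof -
  define W where "W = cube a l \<inter> cball x (t * (real DIM('a) * l))"
  have [measurable]: "W \<in> sets borel" by (auto simp: W_def)
  have c0: "0 < c b" if "b \<in> Basis" for b using c[OF that] \<open>0 < s\<close> by auto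
  have "s ^ DIM('a) \<le> (\<Prod>b\<in>Basis. c b)"
    using prod_mono[of Basis "\<lambda>_. s" c] c \<open>0 < s\<close> by simp
  then have "ennreal (s ^ DIM('a)) * (\<integral>\<^sup>+z\<in>cube a l. g (dil c x z) \<partial>lborel)
     \<le> ennreal (\<Prod>b\<in>Basis. c b) * (\<integral>\<^sup>+z. g (dil c x z) * indicator W (dil c x z) \<partial>lborel)"
  proof (intro mult_mono)
    show "(\<integral>\<^sup>+z\<in>cube a l. g (dil c x z) \<partial>lborel) \<le> (\<integral>\<^sup>+z. g (dil c x z) * indicator W (dil c x z) \<partial>lborel)"
    proof (rule nn_integral_mono)
    fix z
    show "g (dil c x z) * indicator (cube a l) z \<le> g (dil c x z) * indicator W (dil c x z)"
    proof (cases "z \<in> cube a l")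
      case True
      have "dil c x z \<in> W"
        using dil_in_cube[OF \<open>x \<in> cube a l\<close> True, of c] dist_dil_le[OF \<open>x \<in> cube a l\<close> True, of c t]
          c c0 \<open>t \<le> 1\<close> by (force simp: less_imp_le W_def)
      then show ?thesis using True by simp
    qed simp
    qed
  qed (auto intro: ennreal_leI)
  also have "\<dots> = (\<integral>\<^sup>+y. g y * indicator W y \<partial>lborel)"
    by (rule nn_integral_dil[symmetric, of "\<lambda>y. g y * indicator W y"]) (use c0 in auto)
  finally show ?thesis by (simp add: W_def)
qed

text \<open>The difference is at most \<open>l\<close> times the integral of \<open>g\<close> over
  factors \<open>\<sigma>\<close> between \<open>t / 2\<close> and \<open>t\<close>. After Tonelli
  each \<open>\<sigma>\<close> contributes a dilation whose factors all lie in that range, so one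
  Jacobian bound serves for all; the range of \<open>\<sigma>\<close> has length
  \<open>t / 2\<close>.\<close>

lemma halving_one_coordinate:
  fixes x :: "'a::euclidean_space"
  assumes u: "continuous_on UNIV u" and g [measurable]: "g \<in> borel_measurable borel"
    and ug: "axis_upper_gradient u g"
    and x: "x \<in> cube a l" and "0 < l" "0 < t" "t \<le> 1" and e: "e \<in> Basis"
    and c: "\<And>b. b \<in> Basis \<Longrightarrow> t / 2 \<le> c b \<and> c b \<le> t"
  shows "ennreal ((t / 2) ^ DIM('a)) *
      (\<integral>\<^sup>+z\<in>cube a l. ennreal \<bar>u (dil (c(e := t)) x z) - u (dil (c(e := t / 2)) x z)\<bar> \<partial>lborel)
    \<le> ennreal (l * (t / 2)) * (\<integral>\<^sup>+y\<in>cube a l \<inter> cball x (t * (real DIM('a) * l)). g y \<partial>lborel)"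
proof -
  let ?n = "DIM('a)" and ?I = "\<integral>\<^sup>+y\<in>cube a l \<inter> cball x (t * (real DIM('a) * l)). g y \<partial>lborel"
  have [measurable]: "u \<in> borel_measurable borel" using u by (rule borel_measurable_continuous_onI)
  have [measurable]: "(\<lambda>(\<sigma>, z). dil (c(e := \<sigma>)) x z) \<in> borel \<Otimes>\<^sub>M borel \<rightarrow>\<^sub>M borel"
    unfolding dil_upd[OF e] by measurable
  define H where "H = (\<lambda>\<sigma> z. g (dil (c(e := \<sigma>)) x z) * indicator {t / 2..t} \<sigma> * indicator (cube a l) z)"
  have Hm [measurable]: "(\<lambda>(\<sigma>, z). H \<sigma> z) \<in> borel_measurable (lborel \<Otimes>\<^sub>M lborel)"
  proof -
    have "(\<lambda>p. g (case p of (\<sigma>, z) \<Rightarrow> dil (c(e := \<sigma>)) x z) * indicator {t / 2..t} (fst p) * indicator (cube a l) (snd p))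
      \<in> borel_measurable (lborel \<Otimes>\<^sub>M lborel)" by measurable
    then show ?thesis by (simp add: H_def case_prod_beta)
  qed
  have pt: "ennreal \<bar>u (dil (c(e := t)) x z) - u (dil (c(e := t / 2)) x z)\<bar> * indicator (cube a l) z
      \<le> ennreal l * (\<integral>\<^sup>+\<sigma>. H \<sigma> z \<partial>lborel)" for z
  proof (cases "z \<in> cube a l")
    case True
    define h where "h = (z - x) \<bullet> e"
    have h: "\<bar>h\<bar> \<le> l" using x True e by (force simp: h_def mem_cube inner_diff_left abs_le_iff)
    have "ennreal \<bar>u (dil (c(e := t)) x z) - u (dil (c(e := t / 2)) x z)\<bar>
      \<le> ennreal \<bar>h\<bar> * (\<integral>\<^sup>+\<sigma>. g (dil (\<lambda>b. if b = e then 0 else c b) x z + (\<sigma> * h) *\<^sub>R e) * indicator {t / 2..t} \<sigma> \<partial>lborel)"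
      unfolding dil_upd[OF e, of c t] dil_upd[OF e, of c "t / 2"] h_def[symmetric]
      using \<open>0 < t\<close> by (intro ug[unfolded axis_upper_gradient_def, rule_format] e) auto
    also have "\<dots> \<le> ennreal l * (\<integral>\<^sup>+\<sigma>. H \<sigma> z \<partial>lborel)"
      using h True unfolding H_def dil_upd[OF e, of c] h_def[symmetric]
      by (intro mult_mono ennreal_leI) auto
    finally show ?thesis using True by simp
  qed simp
  have psf: "pair_sigma_finite (lborel :: real measure) (lborel :: 'a measure)" ..
  have "ennreal ((t / 2) ^ ?n) * (\<integral>\<^sup>+z\<in>cube a l. ennreal \<bar>u (dil (c(e := t)) x z) - u (dil (c(e := t / 2)) x z)\<bar> \<partial>lborel)
    \<le> ennreal ((t / 2) ^ ?n) * (\<integral>\<^sup>+z. ennreal l * (\<integral>\<^sup>+\<sigma>. H \<sigma> z \<partial>lborel) \<partial>lborel)"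
    by (intro mult_left_mono nn_integral_mono pt) auto
  also have "\<dots> = ennreal l * (ennreal ((t / 2) ^ ?n) * (\<integral>\<^sup>+z. (\<integral>\<^sup>+\<sigma>. H \<sigma> z \<partial>lborel) \<partial>lborel))"
    by (subst nn_integral_cmult) (auto simp: mult.left_commute)
  also have "(\<integral>\<^sup>+z. (\<integral>\<^sup>+\<sigma>. H \<sigma> z \<partial>lborel) \<partial>lborel) = (\<integral>\<^sup>+\<sigma>. (\<integral>\<^sup>+z. H \<sigma> z \<partial>lborel) \<partial>lborel)"
    by (rule pair_sigma_finite.Fubini'[OF psf Hm])
  also have "ennreal ((t / 2) ^ ?n) * \<dots> = (\<integral>\<^sup>+\<sigma>. ennreal ((t / 2) ^ ?n) * (\<integral>\<^sup>+z. H \<sigma> z \<partial>lborel) \<partial>lborel)"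
    by (subst nn_integral_cmult) auto
  also have "ennreal l * (\<integral>\<^sup>+\<sigma>. ennreal ((t / 2) ^ ?n) * (\<integral>\<^sup>+z. H \<sigma> z \<partial>lborel) \<partial>lborel)
      \<le> ennreal l * (\<integral>\<^sup>+\<sigma>. ?I * indicator {t / 2..t} \<sigma> \<partial>lborel)"
  proof (rule mult_left_mono[OF nn_integral_mono])
    fix \<sigma>
    show "ennreal ((t / 2) ^ ?n) * (\<integral>\<^sup>+z. H \<sigma> z \<partial>lborel) \<le> ?I * indicator {t / 2..t} \<sigma>"
    proof (cases "\<sigma> \<in> {t / 2..t}")
      case True
      have "ennreal ((t / 2) ^ ?n) * (\<integral>\<^sup>+z\<in>cube a l. g (dil (c(e := \<sigma>)) x z) \<partial>lborel) \<le> ?I"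
        by (rule nn_integral_dil_le) (use True x c \<open>0 < t\<close> \<open>t \<le> 1\<close> in auto)
      then show ?thesis using True by (simp add: H_def)
    qed (simp add: H_def)
  qed simp
  also have "(\<integral>\<^sup>+\<sigma>. ?I * indicator {t / 2..t} \<sigma> \<partial>lborel) = ?I * ennreal (t / 2)"
    using \<open>0 < t\<close> by (subst nn_integral_cmult_indicator) (auto simp: field_simps)
  finally show ?thesis
    using \<open>0 < t\<close> \<open>0 < l\<close> by (simp only: ennreal_mult[of l "t / 2"] less_imp_le mult_ac half_gt_zero)
qed

lemma halving_all_coordinates:
  fixes x :: "'a::euclidean_space"
  assumes u: "continuous_on UNIV u" and g [measurable]: "g \<in> borel_measurable borel"
    and ug: "axis_upper_gradient u g"
    and x: "x \<in> cube a l" and "0 < l" "0 < t" "t \<le> 1"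
  shows "ennreal ((t / 2) ^ DIM('a)) *
      (\<integral>\<^sup>+z\<in>cube a l. ennreal \<bar>u (x + t *\<^sub>R (z - x)) - u (x + (t / 2) *\<^sub>R (z - x))\<bar> \<partial>lborel)
    \<le> ennreal (real DIM('a) * (l * (t / 2))) * (\<integral>\<^sup>+y\<in>cube a l \<inter> cball x (t * (real DIM('a) * l)). g y \<partial>lborel)"
proof -
  let ?I = "\<integral>\<^sup>+y\<in>cube a l \<inter> cball x (t * (real DIM('a) * l)). g y \<partial>lborel"
  have [measurable]: "u \<in> borel_measurable borel" using u by (rule borel_measurable_continuous_onI)
  \<comment> \<open>\<open>S\<close> collects the coordinates already halved; the induction adds
    them one at a time by the triangle inequality.\<close>
  define \<tau> :: "'a set \<Rightarrow> 'a \<Rightarrow> real" where "\<tau> = (\<lambda>S b. if b \<in> S then t / 2 else t :: real)"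
  have "ennreal ((t / 2) ^ DIM('a)) *
      (\<integral>\<^sup>+z\<in>cube a l. ennreal \<bar>u (dil (\<tau> {}) x z) - u (dil (\<tau> S) x z)\<bar> \<partial>lborel)
    \<le> ennreal (real (card S) * (l * (t / 2))) * ?I" if "finite S" "S \<subseteq> Basis" for S
    using that
  proof (induction S)
    case empty
    then show ?case by simp
  next
    case (insert e S)
    have 1: "(\<tau> S)(e := t) = \<tau> S" "(\<tau> S)(e := t / 2) = \<tau> (insert e S)"
      using insert(2) by (auto simp: \<tau>_def fun_eq_iff)
    let ?D = "\<lambda>S T. \<integral>\<^sup>+z\<in>cube a l. ennreal \<bar>u (dil (\<tau> S) x z) - u (dil (\<tau> T) x z)\<bar> \<partial>lborel"
    have "?D {} (insert e S) \<le> (\<integral>\<^sup>+z. ennreal \<bar>u (dil (\<tau> {}) x z) - u (dil (\<tau> S) x z)\<bar> * indicator (cube a l) z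
        + ennreal \<bar>u (dil (\<tau> S) x z) - u (dil (\<tau> (insert e S)) x z)\<bar> * indicator (cube a l) z \<partial>lborel)"
      by (intro nn_integral_mono) (auto simp: indicator_def ennreal_plus[symmetric] simp del: ennreal_plus intro!: ennreal_leI)
    also have "\<dots> = ?D {} S + ?D S (insert e S)"
      by (intro nn_integral_add) auto
    finally have "ennreal ((t / 2) ^ DIM('a)) * ?D {} (insert e S)
      \<le> ennreal ((t / 2) ^ DIM('a)) * ?D {} S + ennreal ((t / 2) ^ DIM('a)) * ?D S (insert e S)"
      by (simp add: distrib_left[symmetric] mult_left_mono)
    also have "\<dots> \<le> ennreal (real (card S) * (l * (t / 2))) * ?I + ennreal (l * (t / 2)) * ?I"
    proof (rule add_mono)
      show "ennreal ((t / 2) ^ DIM('a)) * ?D {} S \<le> ennreal (real (card S) * (l * (t / 2))) * ?I"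
        using insert by auto
      show "ennreal ((t / 2) ^ DIM('a)) * ?D S (insert e S) \<le> ennreal (l * (t / 2)) * ?I"
        using halving_one_coordinate[OF u g ug x \<open>0 < l\<close> \<open>0 < t\<close> \<open>t \<le> 1\<close>, of e "\<tau> S"] insert \<open>0 < t\<close>
        unfolding 1 by (auto simp: \<tau>_def)
    qed
    also have "\<dots> = ennreal (real (card (insert e S)) * (l * (t / 2))) * ?I"
      using insert \<open>0 < l\<close> \<open>0 < t\<close>
      by (simp add: distrib_right[symmetric] ennreal_plus[symmetric] del: ennreal_plus) (simp add: algebra_simps add_divide_distrib)
    finally show ?case .
  qed
  from this[of Basis] show ?thesis
    using dil_cong[of "\<tau> {}" "\<lambda>_. t" x] dil_cong[of "\<tau> Basis" "\<lambda>_. t / 2" x]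
    by (simp add: \<tau>_def dil_const)
qed

section \<open>Telescoping averages over shrinking homothetic cubes\<close>

text \<open>The average over the homothetic copy with centre \<open>x\<close> and ratio
  \<open>t\<close>, pulled back to the fixed cube. For \<open>t = 1\<close> it is the plain average,
  whatever \<open>x\<close> is.\<close>

definition avg_dil :: "('a::euclidean_space \<Rightarrow> real) \<Rightarrow> 'a \<Rightarrow> real \<Rightarrow> real \<Rightarrow> 'a \<Rightarrow> real" where
  "avg_dil u a l t x = (\<integral>z. indicator (cube a l) z *\<^sub>R u (x + t *\<^sub>R (z - x)) \<partial>lborel) / l ^ DIM('a)"

lemma avg_dil_mult:
  fixes x :: "'a::euclidean_space"
  shows "0 < l \<Longrightarrow> l ^ DIM('a) * avg_dil u a l t x = (\<integral>z. indicator (cube a l) z *\<^sub>R u (x + t *\<^sub>R (z - x)) \<partial>lborel)"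
  by (simp add: avg_dil_def)

lemma integrable_on_cube:
  fixes v :: "'a::euclidean_space \<Rightarrow> real"
  assumes "continuous_on UNIV v"
  shows "integrable lborel (\<lambda>z. indicator (cube a l) z *\<^sub>R v z)"
  by (rule borel_integrable_compact) (use assms continuous_on_subset in \<open>auto simp: cube_def\<close>)

lemma integral_cube_diff:
  fixes v w :: "'a::euclidean_space \<Rightarrow> real"
  assumes "continuous_on UNIV v" "continuous_on UNIV w"
  shows "(\<integral>z. indicator (cube a l) z *\<^sub>R (v z - w z) \<partial>lborel) =
    (\<integral>z. indicator (cube a l) z *\<^sub>R v z \<partial>lborel) - (\<integral>z. indicator (cube a l) z *\<^sub>R w z \<partial>lborel)"
  unfolding scaleR_diff_right
  by (intro Bochner_Integration.integral_diff integrable_on_cube assms)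

lemma abs_integral_cube_le:
  fixes v :: "'a::euclidean_space \<Rightarrow> real"
  assumes "continuous_on UNIV v"
  shows "ennreal \<bar>\<integral>z. indicator (cube a l) z *\<^sub>R v z \<partial>lborel\<bar> \<le> (\<integral>\<^sup>+z\<in>cube a l. ennreal \<bar>v z\<bar> \<partial>lborel)"
proof -
  note int = integrable_on_cube[OF assms, of a l]
  have "ennreal \<bar>\<integral>z. indicator (cube a l) z *\<^sub>R v z \<partial>lborel\<bar> \<le> ennreal (\<integral>z. \<bar>indicator (cube a l) z *\<^sub>R v z\<bar> \<partial>lborel)"
    by (intro ennreal_leI integral_abs_bound)
  also have "\<dots> = (\<integral>\<^sup>+z. ennreal \<bar>indicator (cube a l) z *\<^sub>R v z\<bar> \<partial>lborel)"
    using int by (subst nn_integral_eq_integral) auto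
  also have "\<dots> = (\<integral>\<^sup>+z\<in>cube a l. ennreal \<bar>v z\<bar> \<partial>lborel)"
    by (intro nn_integral_cong) (auto simp: indicator_def)
  finally show ?thesis .
qed

text \<open>\<open>r\<close> is the side of the smaller cube: the Jacobian factor
  \<open>t / 2\<close> and the side \<open>l\<close>, each to the power of the dimension, combine to
  that power of \<open>r\<close>. The ball radius is the earlier one expressed through
  \<open>r\<close>.\<close>

lemma avg_dil_halving:
  fixes x :: "'a::euclidean_space"
  assumes u: "continuous_on UNIV u" and g: "g \<in> borel_measurable borel"
    and ug: "axis_upper_gradient u g"
    and x: "x \<in> cube a l" and "0 < l" "0 < t" "t \<le> 1" and r: "r = l * (t / 2)"
  shows "ennreal \<bar>avg_dil u a l t x - avg_dil u a l (t / 2) x\<bar>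
    \<le> ennreal (real DIM('a) * r / r ^ DIM('a)) * (\<integral>\<^sup>+y\<in>cube a l \<inter> cball x (2 * real DIM('a) * r). g y \<partial>lborel)"
proof -
  let ?n = "DIM('a)" and ?I = "\<integral>\<^sup>+y\<in>cube a l \<inter> cball x (2 * real DIM('a) * r). g y \<partial>lborel"
  let ?\<Delta> = "avg_dil u a l t x - avg_dil u a l (t / 2) x"
  have "0 < r" using \<open>0 < l\<close> \<open>0 < t\<close> by (simp add: r)
  have cont: "continuous_on UNIV (\<lambda>z. u (x + s *\<^sub>R (z - x)))" for s
    by (intro continuous_on_compose2[OF u] continuous_intros) auto
  have cont': "continuous_on UNIV (\<lambda>z. u (x + t *\<^sub>R (z - x)) - u (x + (t / 2) *\<^sub>R (z - x)))"
    by (intro continuous_on_diff cont)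
  let ?D = "\<integral>\<^sup>+z\<in>cube a l. ennreal \<bar>u (x + t *\<^sub>R (z - x)) - u (x + (t / 2) *\<^sub>R (z - x))\<bar> \<partial>lborel"
  have "l ^ ?n * ?\<Delta> = (\<integral>z. indicator (cube a l) z *\<^sub>R (u (x + t *\<^sub>R (z - x)) - u (x + (t / 2) *\<^sub>R (z - x))) \<partial>lborel)"
    unfolding integral_cube_diff[OF cont cont] right_diff_distrib avg_dil_mult[OF \<open>0 < l\<close>] ..
  then have "ennreal (l ^ ?n * \<bar>?\<Delta>\<bar>) \<le> ?D"
    using abs_integral_cube_le[OF cont', of a l] abs_mult[of "l ^ ?n" ?\<Delta>] \<open>0 < l\<close> by simp
  then have "ennreal ((t / 2) ^ ?n) * ennreal (l ^ ?n * \<bar>?\<Delta>\<bar>) \<le> ennreal ((t / 2) ^ ?n) * ?D"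
    by (rule mult_left_mono) simp
  also have "\<dots> \<le> ennreal (real ?n * r) * ?I"
    using halving_all_coordinates[OF u g ug x \<open>0 < l\<close> \<open>0 < t\<close> \<open>t \<le> 1\<close>] by (simp add: r mult_ac)
  also have "ennreal ((t / 2) ^ ?n) * ennreal (l ^ ?n * \<bar>?\<Delta>\<bar>) = ennreal (r ^ ?n) * ennreal \<bar>?\<Delta>\<bar>"
  proof -
    have "(t / 2) ^ ?n * (l ^ ?n * \<bar>?\<Delta>\<bar>) = r ^ ?n * \<bar>?\<Delta>\<bar>" by (simp only: r power_mult_distrib mult_ac)
    then show ?thesis using \<open>0 < t\<close> \<open>0 < l\<close> \<open>0 < r\<close> by (simp only: ennreal_mult[symmetric] abs_ge_zero zero_le_power less_imp_le half_gt_zero mult_nonneg_nonneg)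
  qed
  finally have le: "ennreal (r ^ ?n) * ennreal \<bar>?\<Delta>\<bar> \<le> ennreal (real ?n * r) * ?I" .
  have "ennreal \<bar>?\<Delta>\<bar> = ennreal (1 / r ^ ?n) * (ennreal (r ^ ?n) * ennreal \<bar>?\<Delta>\<bar>)"
    using \<open>0 < r\<close> by (simp add: ennreal_mult[symmetric])
  also have "\<dots> \<le> ennreal (1 / r ^ ?n) * (ennreal (real ?n * r) * ?I)"
    by (intro mult_left_mono le) auto
  also have "\<dots> = ennreal (real ?n * r / r ^ ?n) * ?I"
    using \<open>0 < r\<close> by (simp add: mult.assoc[symmetric] ennreal_mult[symmetric])
  finally show ?thesis .
qed

text \<open>Needed only to identify the limit of the averages at each point: \<open>L\<close> comes
  multiplied by \<open>t\<close>, which tends to zero, so it disappears from the final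
  bound.\<close>

lemma avg_dil_near:
  fixes x :: "'a::euclidean_space"
  assumes lip: "L-lipschitz_on UNIV u" and x: "x \<in> cube a l" and "0 < l" "0 < t" "t \<le> 1"
  shows "\<bar>avg_dil u a l t x - u x\<bar> \<le> L * (t * (real DIM('a) * l))"
proof -
  let ?n = "DIM('a)" and ?B = "L * (t * (real DIM('a) * l))"
  have L: "0 \<le> L" using lip by (rule lipschitz_on_nonneg)
  have u: "continuous_on UNIV u" by (rule lipschitz_on_continuous_on[OF lip])
  have cont: "continuous_on UNIV (\<lambda>z. u (x + t *\<^sub>R (z - x)))"
    by (intro continuous_on_compose2[OF u] continuous_intros) auto
  have "measure lborel (cube a l) = l ^ ?n"
    unfolding measure_def using \<open>0 < l\<close> emeasure_cube[OF \<open>0 < l\<close>, of a] by simp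
  then have "(\<integral>z. indicator (cube a l) z *\<^sub>R u x \<partial>lborel) = l ^ ?n * u x"
    by simp
  then have eq: "l ^ ?n * (avg_dil u a l t x - u x) = (\<integral>z. indicator (cube a l) z *\<^sub>R (u (x + t *\<^sub>R (z - x)) - u x) \<partial>lborel)"
    unfolding integral_cube_diff[OF cont continuous_on_const] right_diff_distrib avg_dil_mult[OF \<open>0 < l\<close>]
    by simp metis
  have "l ^ ?n * \<bar>avg_dil u a l t x - u x\<bar> = \<bar>\<integral>z. indicator (cube a l) z *\<^sub>R (u (x + t *\<^sub>R (z - x)) - u x) \<partial>lborel\<bar>"
    unfolding eq[symmetric] abs_mult using \<open>0 < l\<close> by simp
  then have "ennreal (l ^ ?n * \<bar>avg_dil u a l t x - u x\<bar>) \<le> (\<integral>\<^sup>+z\<in>cube a l. ennreal \<bar>u (x + t *\<^sub>R (z - x)) - u x\<bar> \<partial>lborel)"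
    using abs_integral_cube_le[OF continuous_on_diff[OF cont continuous_on_const[of _ "u x"]], of a l]
    by (simp only:)
  also have "\<dots> \<le> (\<integral>\<^sup>+z. ennreal ?B * indicator (cube a l) z \<partial>lborel)"
  proof (intro nn_integral_mono)
    fix z
    show "ennreal \<bar>u (x + t *\<^sub>R (z - x)) - u x\<bar> * indicator (cube a l) z \<le> ennreal ?B * indicator (cube a l) z"
    proof (cases "z \<in> cube a l")
      case True
      have "\<bar>u (x + t *\<^sub>R (z - x)) - u x\<bar> \<le> L * dist x (x + t *\<^sub>R (z - x))"
        using lipschitz_onD[OF lip, of x "x + t *\<^sub>R (z - x)"] by (simp add: dist_real_def abs_minus_commute)
      also have "\<dots> \<le> ?B"
        using dist_dil_le[OF x True, of "\<lambda>_. t" t] \<open>0 < t\<close> L by (intro mult_left_mono) (auto simp: dil_const)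
      finally show ?thesis using True by (simp add: ennreal_leI)
    qed simp
  qed
  also have "\<dots> = ennreal (?B * l ^ ?n)"
    using \<open>0 < l\<close> \<open>0 < t\<close> L by (subst nn_integral_cmult_indicator) (auto simp: emeasure_cube ennreal_mult[symmetric])
  finally have "l ^ ?n * \<bar>avg_dil u a l t x - u x\<bar> \<le> ?B * l ^ ?n"
    using \<open>0 < l\<close> \<open>0 < t\<close> L by (subst (asm) ennreal_le_iff) auto
  then show ?thesis using \<open>0 < l\<close> by (simp add: mult.commute)
qed

lemma oscillation_le_dyadic_sum:
  fixes x :: "'a::euclidean_space"
  assumes lip: "L-lipschitz_on UNIV u" and g: "g \<in> borel_measurable borel"
    and ug: "axis_upper_gradient u g" and x: "x \<in> cube a l" and "0 < l"
  shows "ennreal \<bar>u x - avg_dil u a l 1 x\<bar> \<le> (\<Sum>k. ennreal (real DIM('a) * (l / 2 ^ Suc k) / (l / 2 ^ Suc k) ^ DIM('a)) *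
     (\<integral>\<^sup>+y\<in>cube a l \<inter> cball x (2 * real DIM('a) * (l / 2 ^ Suc k)). g y \<partial>lborel))"
    (is "_ \<le> (\<Sum>k. ?X k)")
proof -
  have u: "continuous_on UNIV u" by (rule lipschitz_on_continuous_on[OF lip])
  have L: "0 \<le> L" using lip by (rule lipschitz_on_nonneg)
  define A where "A = (\<lambda>k. avg_dil u a l (1 / 2 ^ k) x)"
  have step: "ennreal \<bar>A k - A (Suc k)\<bar> \<le> ?X k" for k
    using avg_dil_halving[OF u g ug x \<open>0 < l\<close>, of "1 / 2 ^ k" "l / 2 ^ Suc k"] by (simp add: A_def mult.commute)
  have partial: "ennreal \<bar>A 0 - A K\<bar> \<le> (\<Sum>k<K. ?X k)" for K
  proof (induction K)
    case (Suc K)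
    have "ennreal \<bar>A 0 - A (Suc K)\<bar> \<le> ennreal \<bar>A 0 - A K\<bar> + ennreal \<bar>A K - A (Suc K)\<bar>"
      by (simp add: ennreal_plus[symmetric] del: ennreal_plus; intro ennreal_leI; simp)
    also have "\<dots> \<le> (\<Sum>k<K. ?X k) + ?X K" by (intro add_mono Suc step)
    finally show ?case by simp
  qed simp
  show ?thesis
  proof (rule ennreal_le_epsilon)
    fix \<epsilon> :: real assume "0 < \<epsilon>"
    have "(\<lambda>K. L * ((1 / 2) ^ K * (real DIM('a) * l))) \<longlonglongrightarrow> L * (0 * (real DIM('a) * l))"
      by (intro tendsto_intros LIMSEQ_power_zero) auto
    then have "\<forall>\<^sub>F K in sequentially. L * ((1 / 2) ^ K * (real DIM('a) * l)) < \<epsilon>"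
      using \<open>0 < \<epsilon>\<close> by (auto intro: order_tendstoD)
    then obtain K where K: "L * ((1 / 2) ^ K * (real DIM('a) * l)) < \<epsilon>"
      using eventually_happens trivial_limit_sequentially by blast
    have "\<bar>A K - u x\<bar> \<le> \<epsilon>"
      using avg_dil_near[OF lip x \<open>0 < l\<close>, of "1 / 2 ^ K"] K by (simp add: A_def power_one_over)
    then have "ennreal \<bar>u x - A 0\<bar> \<le> ennreal \<bar>A 0 - A K\<bar> + ennreal \<epsilon>"
      using \<open>0 < \<epsilon>\<close> by (simp add: ennreal_plus[symmetric] del: ennreal_plus; intro ennreal_leI; simp)
    also have "\<dots> \<le> (\<Sum>k. ?X k) + ennreal \<epsilon>"
      by (intro add_right_mono order_trans[OF partial] sum_le_suminf) auto
    finally show "ennreal \<bar>u x - avg_dil u a l 1 x\<bar> \<le> (\<Sum>k. ?X k) + ennreal \<epsilon>"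
      by (simp add: A_def)
  qed
qed

text \<open>With \<open>\<phi> s = s / (1 + s)\<close> one has \<open>min s (1 / s) \<le> 6 (\<phi> s - \<phi> (s / 2))\<close>, so the dyadic sum
  telescopes.\<close>

lemma dyadic_min_sum_le:
  fixes A B l :: real
  assumes "2 \<le> n" "0 < A" "0 < B" "0 < l"
  shows "(\<Sum>k<K. min (A * (l / 2 ^ Suc k) / (l / 2 ^ Suc k) ^ n) (B * (l / 2 ^ Suc k)))
    \<le> 6 * (A powr (1 / real n) * B powr (1 - 1 / real n))"
proof -
  \<comment> \<open>The crossover scale: \<open>A * T / T ^ n = B * T\<close>. Below it the second
    entry of the minimum is the smaller one, above it the first; the common value
    \<open>B * T\<close> is the bound up to a constant, and \<open>s k\<close> measures the radius
    in units of \<open>T\<close>.\<close>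
  define T where "T = (A / B) powr (1 / real n)"
  have T: "0 < T" using assms by (simp add: T_def)
  have "T ^ n = A / B"
    using assms by (simp add: T_def powr_realpow[symmetric] powr_powr)
  then have A: "A = B * T ^ n" using assms by (simp add: field_simps)
  have BT: "B * T = A powr (1 / real n) * B powr (1 - 1 / real n)"
    using assms by (simp add: T_def powr_divide powr_diff)
  define \<phi> where "\<phi> = (\<lambda>s :: real. s / (1 + s))"
  define s where "s = (\<lambda>k. (l / T) / 2 ^ Suc k)"
  have s: "0 < s k" for k using assms T by (simp add: s_def)
  have s2: "s (Suc k) = s k / 2" for k by (simp add: s_def)
  have bd: "min (A * (l / 2 ^ Suc k) / (l / 2 ^ Suc k) ^ n) (B * (l / 2 ^ Suc k))
      \<le> 6 * (B * T) * (\<phi> (s k) - \<phi> (s (Suc k)))" for k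
  proof -
    have r: "l / 2 ^ Suc k = T * s k" using T by (simp add: s_def)
    have phi: "\<phi> (s k) - \<phi> (s (Suc k)) = s k / ((1 + s k) * (2 + s k))"
      using s[of k] unfolding s2 \<phi>_def by (simp add: divide_simps) (simp add: algebra_simps)
    have "min (A * (T * s k) / (T * s k) ^ n) (B * (T * s k)) \<le> (B * T) * (6 * (s k / ((1 + s k) * (2 + s k))))"
    proof (cases "s k \<le> 1")
      case True
      have "(1 + s k) * (2 + s k) \<le> 2 * 3" using True s[of k] by (intro mult_mono) auto
      then have "s k \<le> 6 * (s k / ((1 + s k) * (2 + s k)))"
        using s[of k] by (simp add: pos_le_divide_eq mult.commute)
      then have "B * T * s k \<le> B * T * (6 * (s k / ((1 + s k) * (2 + s k))))"
        using T assms by (intro mult_left_mono) auto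
      then show ?thesis by (simp add: mult.assoc min.coboundedI2)
    next
      case False
      have "A * (T * s k) / (T * s k) ^ n = B * T * (s k / s k ^ n)"
        using T s[of k] by (simp add: A power_mult_distrib)
      also have "s k / s k ^ n \<le> 1 / s k"
      proof -
        \<comment> \<open>Dimension at least two enters here: for \<open>n = 1\<close> the terms
          above the crossover scale would not decay.\<close>
        have "s k ^ 2 \<le> s k ^ n" using False assms by (intro power_increasing) auto
        then show ?thesis using s[of k] by (simp add: divide_simps power2_eq_square)
      qed
      also have "1 / s k \<le> 6 * (s k / ((1 + s k) * (2 + s k)))"
      proof -
        have "(1 + s k) * (2 + s k) \<le> (2 * s k) * (3 * s k)" using False by (intro mult_mono) auto
        then show ?thesis using s[of k] by (simp add: divide_simps)
      qed
      finally have "A * (T * s k) / (T * s k) ^ n \<le> B * T * (6 * (s k / ((1 + s k) * (2 + s k))))"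
        using T assms by (simp add: mult_left_mono)
      then show ?thesis by (simp add: min.coboundedI1)
    qed
    then show ?thesis unfolding r phi by (simp add: mult_ac)
  qed
  have "(\<Sum>k<K. min (A * (l / 2 ^ Suc k) / (l / 2 ^ Suc k) ^ n) (B * (l / 2 ^ Suc k)))
    \<le> (\<Sum>k<K. 6 * (B * T) * (\<phi> (s k) - \<phi> (s (Suc k))))"
    by (intro sum_mono bd)
  also have "\<dots> = 6 * (B * T) * (\<phi> (s 0) - \<phi> (s K))"
    by (subst sum_distrib_left[symmetric], subst sum_lessThan_telescope', rule refl)
  also have "\<dots> \<le> 6 * (B * T) * 1"
  proof (intro mult_left_mono)
    have "\<phi> (s 0) \<le> 1" "0 \<le> \<phi> (s K)" using s[of 0] s[of K] by (auto simp: \<phi>_def)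
    then show "\<phi> (s 0) - \<phi> (s K) \<le> 1" by simp
  qed (use T assms in auto)
  finally show ?thesis by (simp add: BT)
qed

section \<open>The capacitary estimate\<close>

lemma epowr_ennreal: "0 \<le> b \<Longrightarrow> epowr (ennreal b) a = ennreal (b powr a)"
  by (simp add: epowr_def)

lemma epowr_mono: "0 \<le> a \<Longrightarrow> x \<le> y \<Longrightarrow> epowr x a \<le> epowr y a"
  by (cases x; cases y) (auto simp: epowr_def top_unique intro!: ennreal_leI powr_mono2)

lemma epowr_measurable [measurable]:
  assumes [measurable]: "h \<in> borel_measurable M"
  shows "(\<lambda>x. epowr (h x) a) \<in> borel_measurable M"
  unfolding epowr_def by measurable

text \<open>For one dyadic radius both bounds on \<open>\<mu> (F \<inter> cball y R)\<close> are used: the total mass of \<open>F\<close> for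
  small radii, the maximal function for large ones.\<close>

lemma dyadic_mass_sum_le:
  fixes y :: "'a::euclidean_space" and Mt :: ennreal
  assumes "2 \<le> DIM('a)" "0 < l" "0 < \<kappa>" and "finite_measure \<mu>" and [simp]: "sets \<mu> = sets borel"
    and F: "F \<in> sets borel" "0 < measure \<mu> F"
    and M: "\<And>k. emeasure \<mu> (cball y (2 * real DIM('a) * (l / 2 ^ Suc k))) \<le> ennreal (\<kappa> * (l / 2 ^ Suc k) ^ DIM('a)) * Mt"
  shows "(\<Sum>k. ennreal (real DIM('a) * (l / 2 ^ Suc k) / (l / 2 ^ Suc k) ^ DIM('a)) *
      emeasure \<mu> (F \<inter> cball y (2 * real DIM('a) * (l / 2 ^ Suc k))))
    \<le> ennreal (6 * real DIM('a) * \<kappa> powr (1 - 1 / real DIM('a)) * measure \<mu> F powr (1 / real DIM('a)))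
      * epowr Mt (1 - 1 / real DIM('a))"
    (is "_ \<le> ?R")
proof -
  interpret finite_measure \<mu> by fact
  let ?n = "DIM('a)"
  define r where "r = (\<lambda>k. l / 2 ^ Suc k)"
  have r: "0 < r k" for k using \<open>0 < l\<close> by (simp add: r_def)
  define m where "m = measure \<mu> F"
  have m: "0 < m" using F by (simp add: m_def)
  define X where "X = (\<lambda>k. measure \<mu> (F \<inter> cball y (2 * real ?n * r k)))"
  have X: "emeasure \<mu> (F \<inter> cball y (2 * real ?n * r k)) = ennreal (X k)" for k
    by (simp add: X_def emeasure_eq_measure)
  have Xm: "X k \<le> m" for k using F by (auto simp: X_def m_def intro!: finite_measure_mono)
  have X0: "0 \<le> X k" for k by (simp add: X_def)
  have coef: "0 < 6 * real ?n * \<kappa> powr (1 - 1 / real ?n) * m powr (1 / real ?n)"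
    using assms(1,3) m by simp
  show ?thesis
  proof (cases "Mt = \<infinity>")
    case True
    \<comment> \<open>The coefficient is positive because \<open>F\<close> has positive
      mass.\<close>
    then have "?R = \<infinity>" using coef m \<open>0 < \<kappa>\<close> by (simp add: epowr_def m_def ennreal_mult_top)
    then show ?thesis by simp
  next
    case False
    then obtain b where b: "Mt = ennreal b" "0 \<le> b" by (cases Mt) auto
    have XB: "X k \<le> \<kappa> * b * r k ^ ?n" for k
    proof -
      have "ennreal (X k) \<le> emeasure \<mu> (cball y (2 * real ?n * r k))"
        unfolding X[symmetric] by (intro emeasure_mono) auto
      also have "\<dots> \<le> ennreal (\<kappa> * r k ^ ?n) * Mt" unfolding r_def by (rule M)
      also have "\<dots> = ennreal (\<kappa> * b * r k ^ ?n)"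
        using b r[of k] \<open>0 < \<kappa>\<close> by (simp add: ennreal_mult[symmetric] mult_ac)
      finally show ?thesis using b r[of k] \<open>0 < \<kappa>\<close> by (subst (asm) ennreal_le_iff) auto
    qed
    have "(\<Sum>k. ennreal (real ?n * r k / r k ^ ?n) * ennreal (X k)) \<le> ?R"
    proof (rule suminf_le_const)
      fix K
      have "(\<Sum>k<K. ennreal (real ?n * r k / r k ^ ?n) * ennreal (X k)) = ennreal (\<Sum>k<K. real ?n * r k / r k ^ ?n * X k)"
        using r X0 by (simp add: ennreal_mult[symmetric] less_imp_le sum_nonneg)
      also have "\<dots> \<le> ennreal (real ?n * (6 * (m powr (1 / real ?n) * (\<kappa> * b) powr (1 - 1 / real ?n))))"
      proof (rule ennreal_leI, cases "b = 0")
        case True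
        then have "X k = 0" for k using XB[of k] X0[of k] by simp
        then show "(\<Sum>k<K. real ?n * r k / r k ^ ?n * X k) \<le> real ?n * (6 * (m powr (1 / real ?n) * (\<kappa> * b) powr (1 - 1 / real ?n)))"
          by simp
      next
        case False
        then have B: "0 < \<kappa> * b" using b \<open>0 < \<kappa>\<close> by simp
        have "(\<Sum>k<K. real ?n * r k / r k ^ ?n * X k) \<le> (\<Sum>k<K. real ?n * min (m * r k / r k ^ ?n) (\<kappa> * b * r k))"
        proof (rule sum_mono)
          fix k
          have "r k / r k ^ ?n * X k \<le> r k / r k ^ ?n * m"
            using Xm[of k] r[of k] by (intro mult_left_mono) auto
          moreover have "r k / r k ^ ?n * X k \<le> r k / r k ^ ?n * (\<kappa> * b * r k ^ ?n)"
            using XB[of k] r[of k] by (intro mult_left_mono) auto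
          ultimately have "r k / r k ^ ?n * X k \<le> min (m * r k / r k ^ ?n) (\<kappa> * b * r k)"
            using r[of k] by (simp add: mult_ac)
          then have "real ?n * (r k / r k ^ ?n * X k) \<le> real ?n * min (m * r k / r k ^ ?n) (\<kappa> * b * r k)"
            by (rule mult_left_mono) simp
          then show "real ?n * r k / r k ^ ?n * X k \<le> real ?n * min (m * r k / r k ^ ?n) (\<kappa> * b * r k)"
            by simp
        qed
        also have "\<dots> \<le> real ?n * (6 * (m powr (1 / real ?n) * (\<kappa> * b) powr (1 - 1 / real ?n)))"
          unfolding sum_distrib_left[symmetric] r_def
          by (intro mult_left_mono dyadic_min_sum_le assms(1,2) m B) auto
        finally show "(\<Sum>k<K. real ?n * r k / r k ^ ?n * X k) \<le> real ?n * (6 * (m powr (1 / real ?n) * (\<kappa> * b) powr (1 - 1 / real ?n)))" .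
      qed
      also have "\<dots> = ?R"
        using b \<open>0 < \<kappa>\<close> by (simp add: epowr_ennreal ennreal_mult[symmetric] powr_mult m_def mult_ac)
      finally show "(\<Sum>k<K. ennreal (real ?n * r k / r k ^ ?n) * ennreal (X k)) \<le> ?R" .
    qed simp
    then show ?thesis unfolding X[symmetric] by (simp only: r_def)
  qed
qed

text \<open>Integrating the oscillation bound over \<open>F\<close> gives
  \<open>\<delta> * m\<close> on the left and \<open>m powr (1 / n)\<close> times the integral on
  the right, with \<open>m\<close> the mass of \<open>F\<close> and \<open>n\<close> the dimension;
  dividing by that power of \<open>m\<close> leaves the exponent \<open>1 - 1 / n\<close>.\<close>

lemma weak_estimate_average:
  fixes u :: "'a::euclidean_space \<Rightarrow> real"
  assumes dim: "2 \<le> DIM('a)" and "0 < l" "0 < \<kappa>" and "finite_measure \<mu>" and sets_\<mu>: "sets \<mu> = sets borel"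
    and lip: "L-lipschitz_on UNIV u" and g: "g \<in> borel_measurable borel"
    and ug: "axis_upper_gradient u g"
    and Mt: "Mt \<in> borel_measurable borel"
    and M: "\<And>k y. emeasure \<mu> (cball y (2 * real DIM('a) * (l / 2 ^ Suc k))) \<le> ennreal (\<kappa> * (l / 2 ^ Suc k) ^ DIM('a)) * Mt y"
    and F: "F \<in> sets borel" "F \<subseteq> cube a l" "\<And>x. x \<in> F \<Longrightarrow> \<delta> \<le> \<bar>u x - avg_dil u a l 1 a\<bar>" and "0 \<le> \<delta>"
  shows "ennreal (\<delta> * measure \<mu> F powr (1 - 1 / real DIM('a)))
    \<le> ennreal (6 * real DIM('a) * \<kappa> powr (1 - 1 / real DIM('a))) *
      (\<integral>\<^sup>+y\<in>cube a l. g y * epowr (Mt y) (1 - 1 / real DIM('a)) \<partial>lborel)"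
proof (cases "measure \<mu> F = 0")
  case False
  interpret finite_measure \<mu> by fact
  let ?n = "DIM('a)" and ?I = "\<integral>\<^sup>+y\<in>cube a l. g y * epowr (Mt y) (1 - 1 / real DIM('a)) \<partial>lborel"
  note [measurable] = g Mt F(1)
  note [measurable_cong, simp] = sets_\<mu>
  define m where "m = measure \<mu> F"
  have m: "0 < m" using False by (simp add: m_def zero_less_measure_iff)
  define C where "C = 6 * real ?n * \<kappa> powr (1 - 1 / real ?n)"
  have C: "0 < C" using dim \<open>0 < \<kappa>\<close> by (simp add: C_def)
  define R where "R = (\<lambda>k. 2 * real ?n * (l / 2 ^ Suc k))"
  define c where "c = (\<lambda>k. ennreal (real ?n * (l / 2 ^ Suc k) / (l / 2 ^ Suc k) ^ ?n))"
  have avg: "avg_dil u a l 1 x = avg_dil u a l 1 a" for x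
    by (simp add: avg_dil_def)
  \<comment> \<open>The kernel is symmetric in the distance, so after Tonelli the ball about
    \<open>x\<close> becomes a ball about \<open>y\<close>, whose mass inside \<open>F\<close> the
    dyadic sum controls.\<close>
  define J where "J = (\<lambda>k (x, y). indicator F x * (g y * indicator (cube a l) y) * indicator {(x, y). dist x y \<le> R k} (x, y) :: ennreal)"
  have "closed {(x :: 'a, y). dist x y \<le> R k}" for k
    unfolding case_prod_beta by (intro closed_Collect_le continuous_intros)
  then have cl: "{(x :: 'a, y). dist x y \<le> R k} \<in> sets (borel \<Otimes>\<^sub>M borel)" for k
    unfolding borel_prod by (rule borel_closed)
  have sp: "sets (\<mu> \<Otimes>\<^sub>M lborel) = sets (borel \<Otimes>\<^sub>M borel)" by (intro sets_pair_measure_cong) auto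
  have J [measurable]: "J k \<in> borel_measurable (\<mu> \<Otimes>\<^sub>M lborel)" for k
  proof -
    have [measurable]: "{(x :: 'a, y). dist x y \<le> R k} \<in> sets (\<mu> \<Otimes>\<^sub>M lborel)" using cl sp by simp
    show ?thesis unfolding J_def by measurable
  qed
  have psf: "pair_sigma_finite \<mu> (lborel :: 'a measure)" ..
  have "ennreal \<delta> * ennreal m = (\<integral>\<^sup>+x. ennreal \<delta> * indicator F x \<partial>\<mu>)"
    by (subst nn_integral_cmult_indicator) (auto simp: m_def emeasure_eq_measure)
  also have "\<dots> \<le> (\<integral>\<^sup>+x. (\<Sum>k. c k * (\<integral>\<^sup>+y. J k (x, y) \<partial>lborel)) \<partial>\<mu>)"
  proof (rule nn_integral_mono)
    fix x
    show "ennreal \<delta> * indicator F x \<le> (\<Sum>k. c k * (\<integral>\<^sup>+y. J k (x, y) \<partial>lborel))"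
    proof (cases "x \<in> F")
      case True
      then have x: "x \<in> cube a l" using F by auto
      have "ennreal \<delta> \<le> ennreal \<bar>u x - avg_dil u a l 1 x\<bar>"
        unfolding avg[of x] using F(3)[OF True] by (rule ennreal_leI)
      also have "\<dots> \<le> (\<Sum>k. c k * (\<integral>\<^sup>+y\<in>cube a l \<inter> cball x (R k). g y \<partial>lborel))"
        using oscillation_le_dyadic_sum[OF lip g ug x \<open>0 < l\<close>] unfolding c_def R_def .
      also have "(\<lambda>k. \<integral>\<^sup>+y\<in>cube a l \<inter> cball x (R k). g y \<partial>lborel) = (\<lambda>k. \<integral>\<^sup>+y. J k (x, y) \<partial>lborel)"
        using True by (intro ext nn_integral_cong) (auto simp: J_def indicator_def)
      finally show ?thesis using True by simp
    qed simp
  qed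
  also have "\<dots> = (\<Sum>k. c k * (\<integral>\<^sup>+x. (\<integral>\<^sup>+y. J k (x, y) \<partial>lborel) \<partial>\<mu>))"
    by (subst nn_integral_suminf) (auto simp: nn_integral_cmult)
  also have "\<dots> = (\<Sum>k. c k * (\<integral>\<^sup>+y. (\<integral>\<^sup>+x. J k (x, y) \<partial>\<mu>) \<partial>lborel))"
    by (subst pair_sigma_finite.Fubini[OF psf J]) simp
  also have "\<dots> = (\<integral>\<^sup>+y. (\<Sum>k. c k * (\<integral>\<^sup>+x. J k (x, y) \<partial>\<mu>)) \<partial>lborel)"
    by (subst nn_integral_suminf) (auto simp: nn_integral_cmult)
  also have "\<dots> \<le> (\<integral>\<^sup>+y. ennreal (C * m powr (1 / real ?n)) * (g y * epowr (Mt y) (1 - 1 / real ?n) * indicator (cube a l) y) \<partial>lborel)"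
  proof (rule nn_integral_mono)
    fix y
    have "(\<integral>\<^sup>+x. J k (x, y) \<partial>\<mu>) = g y * indicator (cube a l) y * emeasure \<mu> (F \<inter> cball y (R k))" for k
    proof -
      have "(\<integral>\<^sup>+x. J k (x, y) \<partial>\<mu>) = (\<integral>\<^sup>+x. g y * indicator (cube a l) y * indicator (F \<inter> cball y (R k)) x \<partial>\<mu>)"
        by (intro nn_integral_cong) (auto simp: J_def indicator_def dist_commute)
      also have "\<dots> = g y * indicator (cube a l) y * emeasure \<mu> (F \<inter> cball y (R k))"
        by (rule nn_integral_cmult_indicator) auto
      finally show ?thesis .
    qed
    then have "(\<Sum>k. c k * (\<integral>\<^sup>+x. J k (x, y) \<partial>\<mu>)) = (\<Sum>k. g y * indicator (cube a l) y * (c k * emeasure \<mu> (F \<inter> cball y (R k))))"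
      by (simp only: mult_ac)
    also have "\<dots> = g y * indicator (cube a l) y * (\<Sum>k. c k * emeasure \<mu> (F \<inter> cball y (R k)))"
      by (rule ennreal_suminf_cmult)
    also have "\<dots> \<le> g y * indicator (cube a l) y * (ennreal (C * m powr (1 / real ?n)) * epowr (Mt y) (1 - 1 / real ?n))"
      unfolding c_def R_def C_def m_def
      by (intro mult_left_mono dyadic_mass_sum_le dim \<open>0 < l\<close> \<open>0 < \<kappa>\<close> \<open>finite_measure \<mu>\<close> sets_\<mu> F(1) M m[unfolded m_def]) auto
    finally show "(\<Sum>k. c k * (\<integral>\<^sup>+x. J k (x, y) \<partial>\<mu>))
      \<le> ennreal (C * m powr (1 / real ?n)) * (g y * epowr (Mt y) (1 - 1 / real ?n) * indicator (cube a l) y)"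
      by (simp only: mult_ac)
  qed
  also have "\<dots> = ennreal (C * m powr (1 / real ?n)) * ?I"
    by (rule nn_integral_cmult) auto
  finally have le: "ennreal \<delta> * ennreal m \<le> ennreal (C * m powr (1 / real ?n)) * ?I" .
  have mp: "m powr (1 - 1 / real ?n) = m * (1 / m powr (1 / real ?n))" using m by (simp add: powr_diff)
  have "ennreal (\<delta> * m powr (1 - 1 / real ?n)) = ennreal (1 / m powr (1 / real ?n)) * (ennreal \<delta> * ennreal m)"
    using m \<open>0 \<le> \<delta>\<close> unfolding mp by (simp add: ennreal_mult[symmetric] mult_ac)
  also have "\<dots> \<le> ennreal (1 / m powr (1 / real ?n)) * (ennreal (C * m powr (1 / real ?n)) * ?I)"
    by (intro mult_left_mono le) auto
  also have "\<dots> = ennreal C * ?I"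
    using m C by (simp add: mult.assoc[symmetric] ennreal_mult[symmetric])
  finally show ?thesis by (simp add: C_def m_def)
qed simp

text \<open>Whatever the average of \<open>u\<close> is, \<open>u\<close> stays \<open>\<bar>\<gamma> - \<beta>\<bar> / 2\<close> away from it on \<open>F\<close> or on \<open>Z\<close>.\<close>

lemma capacitary_estimate:
  fixes u :: "'a::euclidean_space \<Rightarrow> real"
  assumes dim: "2 \<le> DIM('a)" and "0 < l" "0 < \<kappa>" and "finite_measure \<mu>" and sets_\<mu>: "sets \<mu> = sets borel"
    and lip: "L-lipschitz_on UNIV u" and g: "g \<in> borel_measurable borel"
    and ug: "axis_upper_gradient u g"
    and Mt: "Mt \<in> borel_measurable borel"
    and M: "\<And>k y. emeasure \<mu> (cball y (2 * real DIM('a) * (l / 2 ^ Suc k))) \<le> ennreal (\<kappa> * (l / 2 ^ Suc k) ^ DIM('a)) * Mt y"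
    and F: "F \<in> sets borel" "F \<subseteq> cube a l" "\<And>x. x \<in> F \<Longrightarrow> u x = \<gamma>"
    and Z: "Z \<in> sets borel" "Z \<subseteq> cube a l" "\<And>x. x \<in> Z \<Longrightarrow> u x = \<beta>"
    and le: "measure \<mu> F \<le> measure \<mu> Z"
  shows "ennreal (\<bar>\<gamma> - \<beta>\<bar> * measure \<mu> F powr (1 - 1 / real DIM('a)))
    \<le> ennreal (12 * real DIM('a) * \<kappa> powr (1 - 1 / real DIM('a))) *
      (\<integral>\<^sup>+y\<in>cube a l. g y * epowr (Mt y) (1 - 1 / real DIM('a)) \<partial>lborel)"
proof -
  let ?n = "DIM('a)" and ?I = "\<integral>\<^sup>+y\<in>cube a l. g y * epowr (Mt y) (1 - 1 / real DIM('a)) \<partial>lborel"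
  define \<delta> where "\<delta> = \<bar>\<gamma> - \<beta>\<bar>"
  have \<delta>: "0 \<le> \<delta>" by (simp add: \<delta>_def)
  define C where "C = 6 * real ?n * \<kappa> powr (1 - 1 / real ?n)"
  have C: "0 \<le> C" by (simp add: C_def)
  define A where "A = avg_dil u a l 1 a"
  \<comment> \<open>If \<open>F\<close> fails to be far from the average, \<open>Z\<close> takes its
    place, at no loss since its mass is at least that of \<open>F\<close>. The distance is only half
    of \<open>\<delta>\<close>, which doubles the constant \<open>6\<close> to
    \<open>12\<close>.\<close>
  have "\<exists>F'. F' \<in> sets borel \<and> F' \<subseteq> cube a l \<and> (\<forall>x\<in>F'. \<delta> / 2 \<le> \<bar>u x - A\<bar>) \<and> measure \<mu> F \<le> measure \<mu> F'"
  proof (cases "\<delta> / 2 \<le> \<bar>\<gamma> - A\<bar>")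
    case True
    then show ?thesis using F by (intro exI[of _ F]) auto
  next
    case False
    moreover have "\<delta> \<le> \<bar>\<gamma> - A\<bar> + \<bar>\<beta> - A\<bar>" unfolding \<delta>_def by arith
    ultimately have "\<delta> / 2 \<le> \<bar>\<beta> - A\<bar>" by linarith
    then show ?thesis using Z le by (intro exI[of _ Z]) auto
  qed
  then obtain F' where F': "F' \<in> sets borel" "F' \<subseteq> cube a l" "\<And>x. x \<in> F' \<Longrightarrow> \<delta> / 2 \<le> \<bar>u x - A\<bar>" "measure \<mu> F \<le> measure \<mu> F'"
    by auto
  have "ennreal (\<delta> / 2 * measure \<mu> F powr (1 - 1 / real ?n)) \<le> ennreal (\<delta> / 2 * measure \<mu> F' powr (1 - 1 / real ?n))"
    using F'(4) dim \<delta> by (intro ennreal_leI mult_left_mono powr_mono2) auto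
  also have "\<dots> \<le> ennreal C * ?I"
    unfolding C_def
    by (rule weak_estimate_average[OF dim \<open>0 < l\<close> \<open>0 < \<kappa>\<close> \<open>finite_measure \<mu>\<close> sets_\<mu> lip g ug Mt M])
      (use F' \<delta> in \<open>auto simp: A_def\<close>)
  finally have "ennreal 2 * ennreal (\<delta> / 2 * measure \<mu> F powr (1 - 1 / real ?n)) \<le> ennreal 2 * (ennreal C * ?I)"
    by (rule mult_left_mono) simp
  moreover have "ennreal 2 * ennreal (\<delta> / 2 * measure \<mu> F powr (1 - 1 / real ?n)) = ennreal (\<delta> * measure \<mu> F powr (1 - 1 / real ?n))"
    using \<delta> by (subst ennreal_mult[symmetric]) auto
  moreover have "ennreal 2 * (ennreal C * ?I) = ennreal (2 * C) * ?I"
    using C by (subst ennreal_mult) (auto simp: mult.assoc)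
  ultimately show ?thesis by (simp add: C_def \<delta>_def mult.assoc)
qed

section \<open>Summation over level sets\<close>

text \<open>Both factors are at most powers of the larger number \<open>m\<close>, and
  \<open>m powr (\<alpha> + \<beta>) \<le> m\<close> because \<open>m \<le> 1\<close>. This replaces
  a product of powers by something that can be summed.\<close>

lemma powr_mult_le_add:
  fixes x y :: real
  assumes "0 \<le> x" "x \<le> 1" "0 \<le> y" "y \<le> 1" "0 \<le> \<alpha>" "0 \<le> \<beta>" "1 \<le> \<alpha> + \<beta>"
  shows "x powr \<alpha> * y powr \<beta> \<le> x + y"
proof (cases "x = 0 \<or> y = 0")
  case False
  define m where "m = max x y"
  have m: "0 < m" "m \<le> 1" "x \<le> m" "y \<le> m" using False assms by (auto simp: m_def)
  have "x powr \<alpha> * y powr \<beta> \<le> m powr \<alpha> * m powr \<beta>"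
    using assms m by (intro mult_mono powr_mono2) auto
  also have "\<dots> = m powr (\<alpha> + \<beta>)" by (simp add: powr_add)
  also have "\<dots> \<le> m powr 1" using m assms by (intro powr_mono') auto
  also have "\<dots> \<le> x + y" using m assms by (auto simp: m_def)
  finally show ?thesis .
qed (use assms in auto)

text \<open>Dividing \<open>G k\<close> by \<open>g\<close> and \<open>a (Suc k)\<close> by the
  total \<open>S\<close> brings both below one, where the product of powers is at most the sum.
  Summation gives \<open>S \<le> 2 * K\<close> with \<open>K\<close> containing
  \<open>S powr \<beta>\<close>, and \<open>\<beta> < 1\<close> allows that power to be divided out
  since \<open>S\<close> is finite and positive.\<close>

lemma superlinear_recursion_sum_le:
  fixes a G :: "nat \<Rightarrow> real"
  assumes a: "\<And>k. 0 \<le> a k" "summable a" and G: "\<And>k. 0 \<le> G k" "summable G" "suminf G \<le> g"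
    and exps: "0 \<le> \<alpha>" "0 \<le> \<beta>" "\<beta> < 1" "1 \<le> \<alpha> + \<beta>" and "0 \<le> C"
    and rec: "\<And>k. a k \<le> C * G k powr \<alpha> * a (Suc k) powr \<beta>"
  shows "suminf a powr (1 - \<beta>) \<le> 2 * C * g powr \<alpha>"
proof (cases "suminf a = 0")
  case False
  define S where "S = suminf a"
  have S: "0 < S" using False suminf_nonneg[OF a(2,1)] by (simp add: S_def)
  have aS: "a k \<le> S" for k
    using sum_le_suminf[OF a(2), of "{k}"] a(1) by (simp add: S_def)
  have Gg: "G k \<le> g" for k
    using sum_le_suminf[OF G(2), of "{k}"] G by auto
  have g: "0 < g"
  proof (rule ccontr)
    assume "\<not> 0 < g"
    then have "G k = 0" for k using G(1)[of k] Gg[of k] by linarith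
    then have "a k = 0" for k using rec[of k] a(1)[of k] by simp
    then have "a = (\<lambda>_. 0)" by auto
    then show False using False by simp
  qed
  define K where "K = C * g powr \<alpha> * S powr \<beta>"
  have K: "0 \<le> K" using \<open>0 \<le> C\<close> by (simp add: K_def)
  have tail: "summable (\<lambda>k. a (Suc k))" using a(2) by (subst summable_Suc_iff)
  have tail_le: "(\<Sum>k. a (Suc k)) \<le> S"
    using suminf_split_head[OF a(2)] a(1)[of 0] by (simp add: S_def)
  have "S \<le> (\<Sum>k. K * (G k / g + a (Suc k) / S))"
    unfolding S_def
  proof (rule suminf_le[OF _ a(2)])
    fix k
    have "(G k / g) powr \<alpha> * (a (Suc k) / S) powr \<beta> \<le> G k / g + a (Suc k) / S"
      using G(1)[of k] Gg[of k] g a(1)[of "Suc k"] aS[of "Suc k"] S exps by (intro powr_mult_le_add) auto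
    then have "K * ((G k / g) powr \<alpha> * (a (Suc k) / S) powr \<beta>) \<le> K * (G k / g + a (Suc k) / S)"
      using K by (rule mult_left_mono)
    moreover have "K * ((G k / g) powr \<alpha> * (a (Suc k) / S) powr \<beta>) = C * G k powr \<alpha> * a (Suc k) powr \<beta>"
      using g S G(1)[of k] a(1)[of "Suc k"] by (simp add: K_def powr_divide)
    ultimately show "a k \<le> K * (G k / g + a (Suc k) / suminf a)" using rec[of k] by (simp add: S_def)
    show "summable (\<lambda>k. K * (G k / g + a (Suc k) / suminf a))"
      by (intro summable_mult summable_add summable_divide G(2) tail)
  qed
  also have "\<dots> = K * ((\<Sum>k. G k) / g + (\<Sum>k. a (Suc k)) / S)"
    using G(2) tail
    by (subst suminf_mult) (auto intro!: summable_add summable_divide simp: suminf_add[symmetric] suminf_divide)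
  also have "\<dots> \<le> K * (1 + 1)"
    using G(3) g tail_le S K by (intro mult_left_mono add_mono) auto
  finally have "S \<le> 2 * C * g powr \<alpha> * S powr \<beta>" by (simp add: K_def)
  then show ?thesis using S by (simp add: powr_diff divide_simps S_def[symmetric] mult_ac)
qed (use assms in auto)

lemma nn_integral_powr_le_level_sum:
  fixes v :: "'a \<Rightarrow> real"
  assumes [measurable]: "v \<in> borel_measurable M" "Q \<in> sets M"
    and v: "\<And>x. x \<in> Q \<Longrightarrow> 0 \<le> v x \<and> v x \<le> B" and "0 < B" "0 < q"
  shows "(\<integral>\<^sup>+x\<in>Q. ennreal (v x powr q) \<partial>M)
    \<le> ennreal (2 powr q) * (\<Sum>k. ennreal ((B / 2 ^ k) powr q) * emeasure M {x \<in> Q. B / 2 ^ k \<le> v x})"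
proof -
  define E where "E = (\<lambda>k. {x \<in> Q. B / 2 ^ k \<le> v x})"
  have E [measurable]: "E k \<in> sets M" for k
  proof -
    have "E k = Q \<inter> {x \<in> space M. B / 2 ^ k \<le> v x}" using sets.sets_into_space[OF assms(2)] by (auto simp: E_def)
    then show ?thesis by simp
  qed
  have "(\<integral>\<^sup>+x\<in>Q. ennreal (v x powr q) \<partial>M) \<le> (\<integral>\<^sup>+x. ennreal (2 powr q) * (\<Sum>k. ennreal ((B / 2 ^ k) powr q) * indicator (E k) x) \<partial>M)"
  proof (rule nn_integral_mono)
    fix x
    show "ennreal (v x powr q) * indicator Q x \<le> ennreal (2 powr q) * (\<Sum>k. ennreal ((B / 2 ^ k) powr q) * indicator (E k) x)"
    proof (cases "x \<in> Q \<and> v x \<noteq> 0")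
      case True
      then have vx: "0 < v x" "v x \<le> B" "x \<in> Q" using v[of x] by (auto simp: order_less_le)
      obtain k0 :: nat where "B / v x < 2 ^ k0" using real_arch_pow[of 2 "B / v x"] by auto
      then have ex: "B / 2 ^ k0 < v x" using vx by (simp add: field_simps)
      \<comment> \<open>The least \<open>k\<close> with strict inequality is not \<open>0\<close>,
        since \<open>v x \<le> B\<close>; its predecessor fails the inequality, so
        \<open>v x\<close> is at most twice \<open>B / 2 ^ k\<close>.\<close>
      define k where "k = (LEAST k. B / 2 ^ k < v x)"
      have k: "B / 2 ^ k < v x" unfolding k_def using ex by (rule LeastI)
      then obtain j where j: "k = Suc j" using vx by (cases k) auto
      have "\<not> B / 2 ^ j < v x" using not_less_Least[of j "\<lambda>k. B / 2 ^ k < v x"] j by (simp add: k_def)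
      then have "v x \<le> 2 * (B / 2 ^ k)" by (simp add: j)
      then have "v x powr q \<le> (2 * (B / 2 ^ k)) powr q" using vx \<open>0 < q\<close> by (intro powr_mono2) auto
      also have "\<dots> = 2 powr q * (B / 2 ^ k) powr q" by (rule powr_mult)
      finally have "ennreal (v x powr q) \<le> ennreal (2 powr q) * (ennreal ((B / 2 ^ k) powr q) * indicator (E k) x)"
        using k vx by (simp add: E_def ennreal_mult[symmetric] ennreal_leI)
      also have "\<dots> \<le> ennreal (2 powr q) * (\<Sum>k. ennreal ((B / 2 ^ k) powr q) * indicator (E k) x)"
      proof -
        define h :: "nat \<Rightarrow> ennreal" where "h = (\<lambda>k. ennreal ((B / 2 ^ k) powr q) * indicator (E k) x)"
        have "h k \<le> suminf h" using sum_le_suminf[of h "{k}"] by simp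
        then show ?thesis by (simp add: h_def mult_left_mono)
      qed
      finally show ?thesis using vx by simp
    qed auto
  qed
  also have "\<dots> = ennreal (2 powr q) * (\<Sum>k. ennreal ((B / 2 ^ k) powr q) * emeasure M (E k))"
    by (simp add: nn_integral_cmult nn_integral_suminf nn_integral_cmult_indicator)
  finally show ?thesis by (simp add: E_def)
qed

text \<open>The hypothesis \<open>cap\<close> is used for consecutive dyadic levels and raised to
  the power \<open>N / (N - 1)\<close>. The open bands between levels are disjoint, so their
  \<open>\<nu>\<close>-masses sum to at most that of \<open>Q\<close>, and the recursion lemma
  yields the strong bound.\<close>

lemma level_set_iteration:
  fixes v :: "'a \<Rightarrow> real" and N p q :: real
  assumes "2 \<le> N" "1 \<le> p" "p < N" and pq: "1 / p - 1 / q = 1 / N"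
    and "finite_measure \<mu>" "finite_measure \<nu>" and sets_eq: "sets \<nu> = sets \<mu>"
    and vm [measurable]: "v \<in> borel_measurable \<mu>" and Qm [measurable]: "Q \<in> sets \<mu>"
    and v: "\<And>x. x \<in> Q \<Longrightarrow> 0 \<le> v x \<and> v x \<le> B" and "0 < B" and "0 \<le> C"
    and cap: "\<And>s t. 0 < s \<Longrightarrow> s < t \<Longrightarrow> (t - s) * measure \<mu> {x \<in> Q. t \<le> v x} powr (1 - 1 / N)
      \<le> C * measure \<nu> {x \<in> Q. s < v x \<and> v x < t} powr (1 / p) * measure \<mu> {x \<in> Q. s \<le> v x} powr (1 - 1 / p)"
  shows "(\<integral>\<^sup>+x\<in>Q. ennreal (v x powr q) \<partial>\<mu>)
    \<le> ennreal (2 powr q * (2 * (2 powr q * C powr (N / (N - 1)))) powr (q * (1 - 1 / N)) * measure \<nu> Q powr (q / p))"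
proof -
  interpret \<mu>: finite_measure \<mu> by fact
  interpret \<nu>: finite_measure \<nu> by fact
  have spQ: "Q \<subseteq> space \<mu>" by (rule sets.sets_into_space[OF Qm])
  define N' where "N' = N / (N - 1)"
  have N': "1 < N'" "1 - 1 / N = 1 / N'" using \<open>2 \<le> N\<close> by (auto simp: N'_def field_simps)
  have "1 / q = 1 / p - 1 / N" using pq by simp
  also have "\<dots> > 0" using assms(2,3) by (simp add: field_simps)
  finally have q: "0 < q" by simp
  define \<alpha> where "\<alpha> = N' / p"
  define \<beta> where "\<beta> = N' * (1 - 1 / p)"
  have \<alpha>: "0 \<le> \<alpha>" using N' assms(2) by (simp add: \<alpha>_def)
  have \<beta>0: "0 \<le> \<beta>" using N' assms(2) by (simp add: \<beta>_def)
  have ab: "\<alpha> + \<beta> = N'" by (simp add: \<alpha>_def \<beta>_def algebra_simps)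
  \<comment> \<open>The Sobolev relation in the form in which the recursion uses it.\<close>
  have \<beta>: "1 - \<beta> = N' / q"
  proof -
    have "1 / q = 1 / p - (1 - 1 / N')" using pq N'(2) by simp
    then have "N' * (1 / q) = N' * (1 / p - (1 - 1 / N'))" by simp
    then show ?thesis using N' by (simp add: \<beta>_def algebra_simps)
  qed
  have \<beta>1: "\<beta> < 1" using \<beta> N' q by (simp add: field_simps) (metis add.commute diff_gt_0_iff_gt divide_pos_pos less_trans zero_less_one \<beta>)
  define b where "b = (\<lambda>k. B / 2 ^ k)"
  have b: "0 < b k" "b (Suc k) < b k" "b k = 2 * b (Suc k)" for k using \<open>0 < B\<close> by (auto simp: b_def field_simps)
  define E where "E = (\<lambda>k. {x \<in> Q. b k \<le> v x})"
  have Eeq: "E k = Q \<inter> {x \<in> space \<mu>. b k \<le> v x}" for k using spQ by (auto simp: E_def)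
  have E [measurable]: "E k \<in> sets \<mu>" for k unfolding Eeq by simp
  define D where "D = (\<lambda>k. {x \<in> Q. b (Suc k) < v x \<and> v x < b k})"
  have Deq: "D k = Q \<inter> {x \<in> space \<mu>. b (Suc k) < v x \<and> v x < b k}" for k using spQ by (auto simp: D_def)
  have D: "D k \<in> sets \<nu>" for k unfolding Deq sets_eq by simp
  define a where "a = (\<lambda>k. b k powr q * measure \<mu> (E k))"
  define G where "G = (\<lambda>k. measure \<nu> (D k))"
  have a0: "0 \<le> a k" for k by (simp add: a_def)
  \<comment> \<open>Boundedness of \<open>v\<close> is used qualitatively: it gives a geometric
    majorant, but \<open>B\<close> does not appear in the conclusion.\<close>
  have sum_a: "summable a"
  proof (rule summable_comparison_test')
    have "norm (1 / 2 powr q) < 1" using q by (simp add: divide_less_eq)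
    then show "summable (\<lambda>k. B powr q * measure \<mu> Q * (1 / 2 powr q) ^ k)"
      by (intro summable_mult summable_geometric)
    fix k :: nat
    have "b k powr q = B powr q * (1 / 2 powr q) ^ k"
    proof -
      have "(2 ^ k) powr q = (2 powr q) ^ k"
        by (simp add: powr_realpow[symmetric] powr_powr mult.commute)
      then show ?thesis using \<open>0 < B\<close> by (simp add: b_def powr_divide power_one_over)
    qed
    moreover have "measure \<mu> (E k) \<le> measure \<mu> Q" by (intro \<mu>.finite_measure_mono) (auto simp: E_def)
    ultimately show "norm (a k) \<le> B powr q * measure \<mu> Q * (1 / 2 powr q) ^ k"
      using \<open>0 < B\<close> by (simp add: a_def mult_mono mult_ac mult_left_mono)
  qed
  have disj: "disjoint_family D"
  proof -
    have "D j \<inter> D k = {}" if "j < k" for j k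
    proof -
      have "(2::real) ^ Suc j \<le> 2 ^ k" using that by (intro power_increasing) auto
      then have "b k \<le> b (Suc j)" using \<open>0 < B\<close> unfolding b_def by (intro divide_left_mono) auto
      then show ?thesis by (auto simp: D_def)
    qed
    then show ?thesis unfolding disjoint_family_on_def by (metis Int_commute linorder_neqE_nat)
  qed
  have "range D \<subseteq> sets \<nu>" using D by auto
  then have Gs: "G sums measure \<nu> (\<Union>k. D k)"
    unfolding G_def using disj by (rule \<nu>.finite_measure_UNION)
  have Gle: "suminf G \<le> measure \<nu> Q"
    unfolding sums_unique[OF Gs, symmetric]
    using Qm sets_eq by (intro \<nu>.finite_measure_mono) (auto simp: D_def)
  define C2 where "C2 = 2 powr q * C powr N'"
  have rec: "a k \<le> C2 * G k powr \<alpha> * a (Suc k) powr \<beta>" for k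
  proof -
    let ?e = "measure \<mu> (E k)" and ?e' = "measure \<mu> (E (Suc k))"
    have "b (Suc k) * ?e powr (1 / N') \<le> C * G k powr (1 / p) * ?e' powr (1 - 1 / p)"
      using cap[OF b(1)[of "Suc k"] b(2)[of k]] b(3)[of k] by (simp add: E_def G_def D_def N'(2))
    then have "(b (Suc k) * ?e powr (1 / N')) powr N' \<le> (C * G k powr (1 / p) * ?e' powr (1 - 1 / p)) powr N'"
      using b(1)[of "Suc k"] N' by (intro powr_mono2) auto
    then have le: "b (Suc k) powr N' * ?e \<le> C powr N' * G k powr \<alpha> * ?e' powr \<beta>"
      using b(1)[of "Suc k"] N' \<open>0 \<le> C\<close> by (simp add: powr_mult powr_powr \<alpha>_def \<beta>_def G_def mult_ac)
    \<comment> \<open>This splitting balances the powers of the level: the part \<open>N'\<close> is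
      consumed by the raised inequality, and \<open>q * \<beta>\<close> is exactly what turns the
      mass of the next level set into \<open>a (Suc k) powr \<beta>\<close>.\<close>
    have qN: "q = N' + q * \<beta>" using \<beta> q by (simp add: field_simps)
    have "a k = 2 powr q * (b (Suc k) powr q * ?e)"
      using b(1)[of "Suc k"] by (simp add: a_def b(3)[of k] powr_mult)
    also have "b (Suc k) powr q = b (Suc k) powr (q * \<beta>) * b (Suc k) powr N'"
      by (subst qN) (simp add: powr_add)
    also have "2 powr q * (b (Suc k) powr (q * \<beta>) * b (Suc k) powr N' * ?e)
      = 2 powr q * b (Suc k) powr (q * \<beta>) * (b (Suc k) powr N' * ?e)" by simp
    also have "\<dots> \<le> 2 powr q * b (Suc k) powr (q * \<beta>) * (C powr N' * G k powr \<alpha> * ?e' powr \<beta>)"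
      by (intro mult_left_mono le) auto
    also have "\<dots> = C2 * G k powr \<alpha> * a (Suc k) powr \<beta>"
      by (simp add: C2_def a_def powr_mult powr_powr mult_ac)
    finally show ?thesis .
  qed
  define S where "S = suminf a"
  have S0: "0 \<le> S" unfolding S_def by (rule suminf_nonneg[OF sum_a a0])
  have "S powr (1 - \<beta>) \<le> 2 * C2 * measure \<nu> Q powr \<alpha>"
    unfolding S_def
    by (rule superlinear_recursion_sum_le[OF a0 sum_a _ sums_summable[OF Gs] Gle \<alpha> \<beta>0 \<beta>1 _ _ rec])
       (use ab N' in \<open>auto simp: G_def C2_def\<close>)
  then have "(S powr (1 - \<beta>)) powr (q / N') \<le> (2 * C2 * measure \<nu> Q powr \<alpha>) powr (q / N')"
    using q N' by (intro powr_mono2) auto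
  then have S: "S \<le> (2 * C2) powr (q / N') * measure \<nu> Q powr (q / p)"
    using q N' S0 by (simp add: \<beta> powr_powr powr_mult \<alpha>_def C2_def)
  have "(\<integral>\<^sup>+x\<in>Q. ennreal (v x powr q) \<partial>\<mu>) \<le> ennreal (2 powr q) * (\<Sum>k. ennreal (b k powr q) * emeasure \<mu> (E k))"
    unfolding b_def E_def by (rule nn_integral_powr_le_level_sum[OF vm Qm v \<open>0 < B\<close> q])
  also have "(\<Sum>k. ennreal (b k powr q) * emeasure \<mu> (E k)) = (\<Sum>k. ennreal (a k))"
    by (simp add: a_def \<mu>.emeasure_eq_measure ennreal_mult)
  also have "\<dots> = ennreal S" unfolding S_def by (rule suminf_ennreal2[OF a0 sum_a])
  also have "ennreal (2 powr q) * ennreal S \<le> ennreal (2 powr q * ((2 * C2) powr (q / N') * measure \<nu> Q powr (q / p)))"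
    using S S0 by (simp add: ennreal_mult[symmetric] ennreal_leI mult_left_mono)
  finally show ?thesis using N'(2) by (simp add: C2_def N'_def mult.assoc divide_inverse)
qed

section \<open>Hoelder's inequality, estimates on one side of a median\<close>

text \<open>Young's inequality for the two functions divided by \<open>g\<close> and
  \<open>m\<close>. The number \<open>m\<close> may exceed the integral of \<open>w\<close>, so that
  the mass of a larger set can be inserted.\<close>

lemma Hoelder_weighted:
  fixes r w :: "'a \<Rightarrow> real"
  assumes [measurable]: "r \<in> borel_measurable M" "w \<in> borel_measurable M"
    and r: "\<And>x. 0 \<le> r x" and w: "\<And>x. 0 \<le> w x" and "1 < p"
    and ir: "(\<integral>\<^sup>+x. ennreal (r x) \<partial>M) = ennreal g" and iw: "(\<integral>\<^sup>+x. ennreal (w x) \<partial>M) \<le> ennreal m"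
    and "0 \<le> g" "0 < m"
  shows "(\<integral>\<^sup>+x. ennreal (r x powr (1 / p) * w x powr (1 - 1 / p)) \<partial>M) \<le> ennreal (g powr (1 / p) * m powr (1 - 1 / p))"
proof (cases "g = 0")
  case True
  then have "AE x in M. ennreal (r x) = 0" using ir by (simp add: nn_integral_0_iff_AE)
  then have "AE x in M. ennreal (r x powr (1 / p) * w x powr (1 - 1 / p)) = 0"
  proof eventually_elim
    case (elim x)
    then have "r x = 0" using r[of x] by (simp add: ennreal_eq_0_iff)
    then show ?case by simp
  qed
  then have "(\<integral>\<^sup>+x. ennreal (r x powr (1 / p) * w x powr (1 - 1 / p)) \<partial>M) = 0"
    by (subst nn_integral_0_iff_AE) auto
  then show ?thesis by simp
next
  case False
  then have g: "0 < g" using \<open>0 \<le> g\<close> by simp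
  define K where "K = g powr (1 / p) * m powr (1 - 1 / p)"
  have pt: "r x powr (1 / p) * w x powr (1 - 1 / p) \<le> K * ((1 / p) / g * r x + (1 - 1 / p) / m * w x)" for x
  proof (cases "r x = 0 \<or> w x = 0")
    case True
    have "0 \<le> K * ((1 / p) / g * r x + (1 - 1 / p) / m * w x)"
      using r[of x] w[of x] g \<open>0 < m\<close> \<open>1 < p\<close> unfolding K_def by (intro mult_nonneg_nonneg add_nonneg_nonneg) auto
    then show ?thesis using True by auto
  next
    case False
    then have pos: "0 < r x" "0 < w x" using r[of x] w[of x] by auto
    have "(r x / g) powr (1 / p) * (w x / m) powr (1 - 1 / p) \<le> (1 / p) * (r x / g) + (1 - 1 / p) * (w x / m)"
      using pos g \<open>0 < m\<close> \<open>1 < p\<close> by (intro Youngs_inequality_0) auto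
    then have "K * ((r x / g) powr (1 / p) * (w x / m) powr (1 - 1 / p)) \<le> K * ((1 / p) * (r x / g) + (1 - 1 / p) * (w x / m))"
      by (rule mult_left_mono) (simp add: K_def)
    then show ?thesis using pos g \<open>0 < m\<close> by (simp add: K_def powr_divide)
  qed
  have "(\<integral>\<^sup>+x. ennreal (r x powr (1 / p) * w x powr (1 - 1 / p)) \<partial>M)
    \<le> (\<integral>\<^sup>+x. ennreal K * (ennreal ((1 / p) / g) * ennreal (r x) + ennreal ((1 - 1 / p) / m) * ennreal (w x)) \<partial>M)"
  proof (rule nn_integral_mono)
    fix x
    have "ennreal K * (ennreal ((1 / p) / g) * ennreal (r x) + ennreal ((1 - 1 / p) / m) * ennreal (w x))
      = ennreal (K * ((1 / p) / g * r x + (1 - 1 / p) / m * w x))"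
      using r[of x] w[of x] g \<open>0 < m\<close> \<open>1 < p\<close> unfolding K_def
      by (subst ennreal_mult[symmetric], simp, simp, subst ennreal_mult[symmetric], simp, simp, subst ennreal_plus[symmetric],
          simp, simp, subst ennreal_mult[symmetric], simp_all)
    then show "ennreal (r x powr (1 / p) * w x powr (1 - 1 / p)) \<le> ennreal K * (ennreal ((1 / p) / g) * ennreal (r x) + ennreal ((1 - 1 / p) / m) * ennreal (w x))"
      using pt[of x] by (simp only: ennreal_leI)
  qed
  also have "\<dots> = ennreal K * (ennreal ((1 / p) / g) * (\<integral>\<^sup>+x. ennreal (r x) \<partial>M) + ennreal ((1 - 1 / p) / m) * (\<integral>\<^sup>+x. ennreal (w x) \<partial>M))"
    by (simp add: nn_integral_cmult nn_integral_add)
  also have "\<dots> \<le> ennreal K * (ennreal ((1 / p) / g) * ennreal g + ennreal ((1 - 1 / p) / m) * ennreal m)"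
    unfolding ir by (intro mult_left_mono add_left_mono iw) auto
  also have "\<dots> = ennreal K * ennreal (1 / p + (1 - 1 / p))"
    using g \<open>0 < m\<close> \<open>1 < p\<close> by (simp add: ennreal_mult[symmetric] ennreal_plus[symmetric] del: ennreal_plus)
  finally show ?thesis by (simp add: K_def)
qed

text \<open>The sign \<open>\<sigma>\<close> treats the parts above and below \<open>c\<close>
  together. By \<open>half\<close> each level set of \<open>v\<close> has at most the mass of the
  set where \<open>v\<close> vanishes; on both sets the truncation of \<open>f\<close> is constant,
  so the capacitary estimate followed by \<open>hoelder\<close> gives the hypothesis
  \<open>cap\<close> of the iteration.\<close>

lemma one_sided_estimate:
  fixes f :: "'a::euclidean_space \<Rightarrow> real" and p q c l \<kappa> \<sigma> :: real
  defines "N \<equiv> real DIM('a)"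
  defines "v \<equiv> \<lambda>x. max (\<sigma> * (f x - c)) 0"
  defines "C \<equiv> 12 * N * \<kappa> powr (1 - 1 / N)"
  assumes dim: "2 \<le> DIM('a)" and "0 < l" "0 < \<kappa>" and fin: "finite_measure \<mu>" "finite_measure \<nu>"
    and sets_\<mu>: "sets \<mu> = sets borel" and sets_\<nu>: "sets \<nu> = sets borel"
    and p: "1 \<le> p" "p < N" and pq: "1 / p - 1 / q = 1 / N"
    and lip: "L-lipschitz_on UNIV f" and g: "g \<in> borel_measurable borel"
    and grad: "\<And>x e. e \<in> Basis \<Longrightarrow> ennreal \<bar>seq_derivative f e x\<bar> \<le> g x"
    and Mt: "Mt \<in> borel_measurable borel"
    and M: "\<And>k y. emeasure \<mu> (cball y (2 * real DIM('a) * (l / 2 ^ Suc k))) \<le> ennreal (\<kappa> * (l / 2 ^ Suc k) ^ DIM('a)) * Mt y"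
    and hoelder: "\<And>D E. D \<in> sets borel \<Longrightarrow> E \<in> sets borel \<Longrightarrow> D \<subseteq> E \<Longrightarrow> E \<subseteq> cube a l \<Longrightarrow> 0 < measure \<mu> E \<Longrightarrow>
      (\<integral>\<^sup>+y\<in>D. g y * epowr (Mt y) (1 - 1 / N) \<partial>lborel) \<le> ennreal (measure \<nu> D powr (1 / p) * measure \<mu> E powr (1 - 1 / p))"
    and \<sigma>: "\<sigma> = 1 \<or> \<sigma> = -1"
    and half: "measure \<mu> {x \<in> cube a l. 0 < v x} \<le> measure \<mu> {x \<in> cube a l. v x \<le> 0}"
  shows "(\<integral>\<^sup>+x\<in>cube a l. ennreal (v x powr q) \<partial>\<mu>)
    \<le> ennreal (2 powr q * (2 * (2 powr q * C powr (N / (N - 1)))) powr (q * (1 - 1 / N)) * measure \<nu> (cube a l) powr (q / p))"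
proof -
  interpret \<mu>: finite_measure \<mu> by fact
  have cont: "continuous_on UNIV f" by (rule lipschitz_on_continuous_on[OF lip])
  have fm [measurable]: "f \<in> borel_measurable borel" by (rule borel_measurable_continuous_onI[OF cont])
  note [measurable_cong, simp] = sets_\<mu> sets_\<nu>
  note [measurable] = g Mt
  have vm [measurable]: "v \<in> borel_measurable borel" unfolding v_def by measurable
  let ?Q = "cube a l"
  have Cpos: "0 < C" using dim \<open>0 < \<kappa>\<close> by (simp add: C_def N_def)
  have "compact (f ` ?Q)"
    by (intro compact_continuous_image continuous_on_subset[OF cont]) (auto simp: cube_def)
  then obtain B0 where B0: "\<And>x. x \<in> ?Q \<Longrightarrow> \<bar>f x\<bar> \<le> B0"
    using compact_imp_bounded[of "f ` ?Q"] unfolding bounded_iff by auto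
  define B where "B = \<bar>B0\<bar> + \<bar>c\<bar> + 1"
  have vB: "0 \<le> v x \<and> v x \<le> B" if "x \<in> ?Q" for x
    using B0[OF that] \<sigma> by (auto simp: v_def B_def)
  have eq: "{x \<in> ?Q. P x} = ?Q \<inter> {x \<in> space borel. P x}" for P by auto
  have lev [simp]: "{x \<in> ?Q. s \<le> v x} \<in> sets borel" "{x \<in> ?Q. s < v x} \<in> sets borel" "{x \<in> ?Q. v x \<le> s} \<in> sets borel"
      "{x \<in> ?Q. s < v x \<and> v x < t} \<in> sets borel" for s t
    unfolding eq by measurable
  show ?thesis
  proof (rule level_set_iteration[where B = B])
    show "0 < B" by (simp add: B_def)
    show "0 \<le> C" using Cpos by simp
    show "2 \<le> N" using dim by (simp add: N_def)
    fix s t :: real assume st: "0 < s" "s < t"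
    let ?F = "{x \<in> ?Q. t \<le> v x}" and ?E = "{x \<in> ?Q. s \<le> v x}" and ?D = "{x \<in> ?Q. s < v x \<and> v x < t}"
    have FE: "measure \<mu> ?F \<le> measure \<mu> ?E" using st by (intro \<mu>.finite_measure_mono) auto
    show "(t - s) * measure \<mu> ?F powr (1 - 1 / N) \<le> C * measure \<nu> ?D powr (1 / p) * measure \<mu> ?E powr (1 - 1 / p)"
    proof (cases "measure \<mu> ?E = 0")
      case True
      then have "measure \<mu> ?F = 0" using FE by (simp add: measure_le_0_iff)
      then show ?thesis using Cpos by simp
    next
      case False
      \<comment> \<open>The values of \<open>f\<close> at which \<open>v\<close> equals
        \<open>s\<close> and \<open>t\<close>, in increasing order; for \<open>\<sigma> = -1\<close>
        the order of the levels is reversed.\<close>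
      define lo where "lo = (if \<sigma> = 1 then c + s else c - t)"
      define hi where "hi = (if \<sigma> = 1 then c + t else c - s)"
      have lohi: "lo \<le> hi" using st by (auto simp: lo_def hi_def)
      define u where "u = (\<lambda>x. clip lo hi (f x))"
      have ulip: "L-lipschitz_on UNIV u"
        using lip clip_lipschitz[OF lohi] unfolding lipschitz_on_def dist_real_def u_def by (meson order_trans)
      \<comment> \<open>The cutoff confines the gradient to the band \<open>?D\<close>, which is
        what makes the estimates for different levels additive.\<close>
      define g' where "g' = (\<lambda>x. indicator {lo<..<hi} (f x) * g x)"
      have g'm: "g' \<in> borel_measurable borel" unfolding g'_def by measurable
      have ug: "axis_upper_gradient u g'"
        unfolding u_def g'_def
        by (rule axis_upper_gradient_clip[OF lip lohi]) (intro mult_left_mono grad, auto)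
      have FZ: "measure \<mu> ?F \<le> measure \<mu> {x \<in> ?Q. v x \<le> 0}"
        using st by (intro order_trans[OF _ half] \<mu>.finite_measure_mono) auto
      have "ennreal ((t - s) * measure \<mu> ?F powr (1 - 1 / N))
        \<le> ennreal C * (\<integral>\<^sup>+y\<in>?Q. g' y * epowr (Mt y) (1 - 1 / N) \<partial>lborel)"
      proof -
        have "ennreal (\<bar>(if \<sigma> = 1 then c + t else c - t) - (if \<sigma> = 1 then c + s else c - s)\<bar> * measure \<mu> ?F powr (1 - 1 / real DIM('a)))
          \<le> ennreal (12 * real DIM('a) * \<kappa> powr (1 - 1 / real DIM('a))) * (\<integral>\<^sup>+y\<in>?Q. g' y * epowr (Mt y) (1 - 1 / real DIM('a)) \<partial>lborel)"
        proof (rule capacitary_estimate[OF dim \<open>0 < l\<close> \<open>0 < \<kappa>\<close> fin(1) sets_\<mu> ulip g'm ug Mt M, where Z = "{x \<in> ?Q. v x \<le> 0}"])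
          fix x assume "x \<in> ?F"
          then show "u x = (if \<sigma> = 1 then c + t else c - t)"
            using \<sigma> st by (auto simp: u_def clip_def v_def lo_def hi_def)
        next
          fix x assume "x \<in> {x \<in> ?Q. v x \<le> 0}"
          then show "u x = (if \<sigma> = 1 then c + s else c - s)"
            using \<sigma> st by (auto simp: u_def clip_def v_def lo_def hi_def)
        qed (use FZ in auto)
        moreover have "\<bar>(if \<sigma> = 1 then c + t else c - t) - (if \<sigma> = 1 then c + s else c - s)\<bar> = t - s"
          using st by auto
        ultimately show ?thesis by (simp add: C_def N_def)
      qed
      also have "(\<integral>\<^sup>+y\<in>?Q. g' y * epowr (Mt y) (1 - 1 / N) \<partial>lborel) = (\<integral>\<^sup>+y\<in>?D. g y * epowr (Mt y) (1 - 1 / N) \<partial>lborel)"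
        using \<sigma> st by (intro nn_integral_cong) (auto simp: g'_def indicator_def v_def lo_def hi_def)
      also have "ennreal C * \<dots> \<le> ennreal C * ennreal (measure \<nu> ?D powr (1 / p) * measure \<mu> ?E powr (1 - 1 / p))"
        using False by (intro mult_left_mono hoelder) (auto simp: zero_less_measure_iff)
      also have "\<dots> = ennreal (C * measure \<nu> ?D powr (1 / p) * measure \<mu> ?E powr (1 - 1 / p))"
        using Cpos by (simp add: ennreal_mult[symmetric] mult.assoc)
      finally show ?thesis using Cpos by (subst (asm) ennreal_le_iff) auto
    qed
  qed (use fin p pq vB in auto)
qed

text \<open>The median is the infimum of the levels \<open>t\<close> for which
  \<open>f \<le> t\<close> holds on at least half of the mass. Continuity of the measure from above
  and from below carries the two halves over to \<open>f \<le> c\<close> and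
  \<open>f < c\<close>.\<close>

lemma median_exists:
  fixes f :: "'a \<Rightarrow> real"
  assumes "finite_measure \<mu>" and [measurable]: "f \<in> borel_measurable \<mu>" "Q \<in> sets \<mu>"
    and B: "\<And>x. x \<in> Q \<Longrightarrow> \<bar>f x\<bar> \<le> B" and pos: "0 < measure \<mu> Q"
  obtains c where "measure \<mu> {x \<in> Q. c < f x} \<le> measure \<mu> {x \<in> Q. f x \<le> c}"
    "measure \<mu> {x \<in> Q. f x < c} \<le> measure \<mu> {x \<in> Q. c \<le> f x}"
proof -
  interpret finite_measure \<mu> by fact
  have spQ: "Q \<subseteq> space \<mu>" using sets.sets_into_space[OF assms(3)] .
  have eq: "{x \<in> Q. P x} = Q \<inter> {x \<in> space \<mu>. P x}" for P using spQ by auto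
  have [simp]: "{x \<in> Q. f x \<le> t} \<in> sets \<mu>" "{x \<in> Q. f x < t} \<in> sets \<mu>" "{x \<in> Q. t \<le> f x} \<in> sets \<mu>" "{x \<in> Q. t < f x} \<in> sets \<mu>" for t
    unfolding eq by simp_all
  define m where "m = measure \<mu> Q"
  have split1: "measure \<mu> {x \<in> Q. f x \<le> t} + measure \<mu> {x \<in> Q. t < f x} = m" for t
    unfolding m_def by (subst finite_measure_Union[symmetric]) (auto intro!: arg_cong[where f = "measure \<mu>"])
  have split2: "measure \<mu> {x \<in> Q. f x < t} + measure \<mu> {x \<in> Q. t \<le> f x} = m" for t
    unfolding m_def by (subst finite_measure_Union[symmetric]) (auto intro!: arg_cong[where f = "measure \<mu>"])
  define T where "T = {t. m / 2 \<le> measure \<mu> {x \<in> Q. f x \<le> t}}"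
  have "{x \<in> Q. f x \<le> B} = Q" using B by (auto simp: abs_le_iff)
  then have "B \<in> T" using pos by (simp add: T_def m_def)
  have lb: "-B \<le> t" if "t \<in> T" for t
  proof (rule ccontr)
    assume "\<not> -B \<le> t"
    then have e: "{x \<in> Q. f x \<le> t} = {}" using B by (force simp: abs_le_iff)
    show False using that pos unfolding T_def mem_Collect_eq e by (simp add: m_def)
  qed
  have bdd: "bdd_below T" using lb by (auto simp: bdd_below_def)
  define c where "c = Inf T"
  have up: "m / 2 \<le> measure \<mu> {x \<in> Q. f x \<le> t}" if ct: "c < t" for t
  proof -
    obtain t' where "t' \<in> T" "t' < t" using cInf_lessD[of T t] ct \<open>B \<in> T\<close> by (auto simp: c_def)
    then have "measure \<mu> {x \<in> Q. f x \<le> t'} \<le> measure \<mu> {x \<in> Q. f x \<le> t}"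
      by (intro finite_measure_mono) auto
    then show ?thesis using \<open>t' \<in> T\<close> by (simp add: T_def)
  qed
  have down: "measure \<mu> {x \<in> Q. f x \<le> t} \<le> m / 2" if "t < c" for t
    using cInf_lower[of t T] bdd that by (fastforce simp: c_def T_def)
  have step: "1 / real (Suc n) \<le> 1 / real (Suc m)" if "m \<le> n" for m n
    using that by (intro frac_le) auto
  have "(\<lambda>k. measure \<mu> {x \<in> Q. f x \<le> c + 1 / real (Suc k)}) \<longlonglongrightarrow> measure \<mu> (\<Inter>k. {x \<in> Q. f x \<le> c + 1 / real (Suc k)})"
  proof (intro finite_Lim_measure_decseq)
    show "decseq (\<lambda>k. {x \<in> Q. f x \<le> c + 1 / real (Suc k)})"
      unfolding decseq_def using step by fastforce
  qed auto
  moreover have "(\<Inter>k. {x \<in> Q. f x \<le> c + 1 / real (Suc k)}) = {x \<in> Q. f x \<le> c}"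
  proof -
    have "y \<le> c" if "\<forall>k. y \<le> c + 1 / real (Suc k)" for y
    proof (rule ccontr)
      assume "\<not> y \<le> c"
      then obtain k where "1 / real (Suc k) < y - c" using nat_approx_posE[of "y - c"] by auto
      then show False using that by (force simp: algebra_simps dest: spec[of _ k])
    qed
    then show ?thesis by (auto intro: add_increasing2)
  qed
  ultimately have "m / 2 \<le> measure \<mu> {x \<in> Q. f x \<le> c}"
    using up by (intro LIMSEQ_le_const) auto
  moreover have "(\<lambda>k. measure \<mu> {x \<in> Q. f x \<le> c - 1 / real (Suc k)}) \<longlonglongrightarrow> measure \<mu> (\<Union>k. {x \<in> Q. f x \<le> c - 1 / real (Suc k)})"
  proof (intro finite_Lim_measure_incseq)
    show "incseq (\<lambda>k. {x \<in> Q. f x \<le> c - 1 / real (Suc k)})"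
      unfolding incseq_def using step by fastforce
  qed auto
  moreover have "(\<Union>k. {x \<in> Q. f x \<le> c - 1 / real (Suc k)}) = {x \<in> Q. f x < c}"
  proof -
    have "\<exists>k. y \<le> c - 1 / real (Suc k)" if yc: "y < c" for y
    proof -
      obtain k where "1 / real (Suc k) < c - y" using nat_approx_posE[of "c - y"] yc by auto
      then show ?thesis by (intro exI[of _ k]) linarith
    qed
    moreover have "y < c" if "y \<le> c - 1 / real (Suc k)" for y k
      using that by (smt (verit) divide_pos_pos of_nat_0_less_iff zero_less_Suc)
    ultimately show ?thesis by auto
  qed
  ultimately have "measure \<mu> {x \<in> Q. f x < c} \<le> m / 2"
    using down by (intro LIMSEQ_le_const2) auto
  with \<open>m / 2 \<le> measure \<mu> {x \<in> Q. f x \<le> c}\<close> show ?thesis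
    using split1[of c] split2[of c] by (intro that[of c]) linarith+
qed

section \<open>The maximal function and the integrand\<close>

text \<open>Only countably many radii, so that measurability is immediate; the factor \<open>3\<close> makes the open balls
  contain the closed ones of \<open>capacitary_estimate\<close>, and \<open>(2 \<rho>)\<^sup>n\<close> bounds the volume of a ball.\<close>

definition dyadic_maximal :: "'a::euclidean_space measure \<Rightarrow> real \<Rightarrow> 'a \<Rightarrow> ennreal" where
  "dyadic_maximal \<mu> l y = (SUP k. ennreal (measure \<mu> (ball y (3 * real DIM('a) * (l / 2 ^ Suc k)))
     / (2 * (3 * real DIM('a) * (l / 2 ^ Suc k))) ^ DIM('a)))"

lemma measure_ball_measurable:
  fixes \<mu> :: "'a::euclidean_space measure"
  assumes "finite_measure \<mu>" and sets_\<mu>: "sets \<mu> = sets borel"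
  shows "(\<lambda>y. measure \<mu> (ball y \<rho>)) \<in> borel_measurable borel"
proof -
  interpret finite_measure \<mu> by fact
  have "open {(y :: 'a, x). dist y x < \<rho>}"
    unfolding case_prod_beta by (intro open_Collect_less continuous_intros)
  then have "{(y :: 'a, x). dist y x < \<rho>} \<in> sets (borel \<Otimes>\<^sub>M borel)"
    unfolding borel_prod by (rule borel_open)
  moreover have "sets (borel \<Otimes>\<^sub>M \<mu>) = sets (borel \<Otimes>\<^sub>M (borel :: 'a measure))"
    by (intro sets_pair_measure_cong sets_\<mu>) auto
  ultimately have "(\<lambda>y. emeasure \<mu> (Pair y -` {(y :: 'a, x). dist y x < \<rho>})) \<in> borel_measurable borel"
    by (intro measurable_emeasure_Pair) auto
  then have "(\<lambda>y. emeasure \<mu> (ball y \<rho>)) \<in> borel_measurable borel"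
    by (simp add: ball_def vimage_def)
  then show ?thesis unfolding measure_def by measurable
qed

lemma dyadic_maximal_measurable:
  assumes "finite_measure \<mu>" "sets \<mu> = sets borel"
  shows "dyadic_maximal \<mu> l \<in> borel_measurable borel"
proof -
  note [measurable] = measure_ball_measurable[OF assms]
  show ?thesis unfolding dyadic_maximal_def by measurable
qed

text \<open>Undoing the normalisation of \<open>dyadic_maximal\<close> costs
  \<open>(2 * \<rho>) ^ DIM('a)\<close>; with \<open>\<rho>\<close> equal to three dimensions times
  the radius this is the origin of the factor \<open>6\<close>.\<close>

lemma measure_le_dyadic_maximal:
  fixes y :: "'a::euclidean_space"
  assumes "finite_measure \<mu>" and sets_\<mu>: "sets \<mu> = sets borel" and "0 < l"
  shows "emeasure \<mu> (cball y (2 * real DIM('a) * (l / 2 ^ Suc k)))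
    \<le> ennreal ((6 * real DIM('a)) ^ DIM('a) * (l / 2 ^ Suc k) ^ DIM('a)) * dyadic_maximal \<mu> l y"
proof -
  interpret finite_measure \<mu> by fact
  let ?n = "DIM('a)" and ?r = "l / 2 ^ Suc k"
  define \<rho> where "\<rho> = 3 * real ?n * ?r"
  have r: "0 < ?r" using \<open>0 < l\<close> by simp
  have \<rho>: "0 < \<rho>" unfolding \<rho>_def by (intro mult_pos_pos r) auto
  have "2 * real ?n * ?r < \<rho>" unfolding \<rho>_def by (intro mult_strict_right_mono r) auto
  then have "cball y (2 * real ?n * ?r) \<subseteq> ball y \<rho>"
    by (simp add: cball_subset_ball_iff)
  then have "emeasure \<mu> (cball y (2 * real ?n * ?r)) \<le> emeasure \<mu> (ball y \<rho>)"
    by (intro emeasure_mono) (auto simp: sets_\<mu>)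
  also have "\<dots> = ennreal ((2 * \<rho>) ^ ?n) * ennreal (measure \<mu> (ball y \<rho>) / (2 * \<rho>) ^ ?n)"
    using \<rho> by (simp add: ennreal_mult[symmetric] emeasure_eq_measure)
  also have "\<dots> \<le> ennreal ((2 * \<rho>) ^ ?n) * dyadic_maximal \<mu> l y"
    unfolding dyadic_maximal_def \<rho>_def by (intro mult_left_mono SUP_upper) auto
  also have "(2 * \<rho>) ^ ?n = (6 * real ?n) ^ ?n * ?r ^ ?n"
  proof -
    have "2 * \<rho> = 6 * real ?n * ?r" by (simp add: \<rho>_def)
    then show ?thesis by (simp only: power_mult_distrib)
  qed
  finally show ?thesis .
qed

section \<open>Factorization of the integrand and passage from the median to the mean\<close>

text \<open>The integrand of the theorem with Borel substitutes \<open>D\<close> and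
  \<open>Mt\<close> for the gradient and the maximal function; \<open>s\<close> stands for
  \<open>1 / n'\<close>, that is \<open>1 - 1 / n\<close>.\<close>

definition borel_integrand ::
  "real \<Rightarrow> real \<Rightarrow> ('a \<Rightarrow> real) \<Rightarrow> ('a \<Rightarrow> 'b::euclidean_space) \<Rightarrow> ('a \<Rightarrow> ennreal) \<Rightarrow> 'a \<Rightarrow> ennreal" where
  "borel_integrand p s w D Mt x =
     (if p = 1 then ennreal (norm (D x)) * epowr (Mt x) (p * s)
      else if D x = 0 then 0
      else if w x = 0 then \<infinity>
      else ennreal (norm (D x) powr p) * epowr (Mt x) (p * s) / ennreal (w x powr (p - 1)))"

lemma borel_integrand_measurable:
  assumes [measurable]: "w \<in> borel_measurable M" "D \<in> borel_measurable M" "Mt \<in> borel_measurable M"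
  shows "borel_integrand p s w D Mt \<in> borel_measurable M"
  unfolding borel_integrand_def by measurable

text \<open>Taking the \<open>p\<close>-th root of the integrand shows equality wherever
  \<open>D x \<noteq> 0\<close>. Finiteness excludes the points where \<open>w\<close> vanishes or
  \<open>Mt\<close> is infinite while \<open>D\<close> is nonzero.\<close>

lemma integrand_factorization:
  fixes D :: "'a \<Rightarrow> 'b::euclidean_space"
  assumes "1 < p" "0 < s" "0 \<le> w x" and fin: "borel_integrand p s w D Mt x < \<infinity>"
  shows "ennreal (norm (D x)) * epowr (Mt x) s
    \<le> ennreal (enn2real (borel_integrand p s w D Mt x) powr (1 / p) * w x powr (1 - 1 / p))"
proof (cases "D x = 0")
  case False
  then have w: "0 < w x" using fin assms(1,3) by (auto simp: borel_integrand_def less_le split: if_splits)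
  have R: "borel_integrand p s w D Mt x = ennreal (norm (D x) powr p) * epowr (Mt x) (p * s) / ennreal (w x powr (p - 1))"
    using False w \<open>1 < p\<close> by (simp add: borel_integrand_def)
  have "Mt x \<noteq> \<infinity>"
  proof
    assume "Mt x = \<infinity>"
    then have "borel_integrand p s w D Mt x = \<infinity>"
      unfolding R using False w by (simp add: epowr_def ennreal_mult_top ennreal_top_divide)
    then show False using fin by simp
  qed
  then obtain b where b: "Mt x = ennreal b" "0 \<le> b" by (cases "Mt x") auto
  have "borel_integrand p s w D Mt x = ennreal (norm (D x) powr p * b powr (p * s) / w x powr (p - 1))"
    unfolding R using b w by (simp add: epowr_ennreal ennreal_mult[symmetric] divide_ennreal)
  then have "enn2real (borel_integrand p s w D Mt x) powr (1 / p)
      = (norm (D x) powr p * b powr (p * s) / w x powr (p - 1)) powr (1 / p)" by simp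
  also have "\<dots> = norm (D x) * b powr s / w x powr (1 - 1 / p)"
    using \<open>1 < p\<close> False by (simp add: powr_divide powr_mult powr_powr diff_divide_distrib)
  finally show ?thesis using b w by (simp add: epowr_ennreal ennreal_mult[symmetric])
qed simp

text \<open>In the iteration \<open>A\<close> is a band between two levels and \<open>E\<close> the
  level set at its lower end; the mass of \<open>E\<close> is kept because it is a term of the
  recursion.\<close>

lemma integrand_Hoelder:
  fixes w :: "'a::euclidean_space \<Rightarrow> real" and D :: "'a \<Rightarrow> 'b::euclidean_space"
  defines "\<mu> \<equiv> density lborel (\<lambda>x. ennreal (w x))"
  assumes wm [measurable]: "w \<in> borel_measurable borel" and w0: "\<And>x. 0 \<le> w x" and "finite_measure \<mu>"
    and [measurable]: "D \<in> borel_measurable borel" "Mt \<in> borel_measurable borel" "Q \<in> sets borel"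
    and "1 \<le> p" "0 < s"
    and \<nu>: "\<nu> = density lborel (\<lambda>x. borel_integrand p s w D Mt x * indicator Q x)" and "finite_measure \<nu>"
    and AE: "AE x in lborel. x \<in> Q \<longrightarrow> borel_integrand p s w D Mt x < \<infinity>"
    and A: "A \<in> sets borel" and E: "E \<in> sets borel" "A \<subseteq> E" "E \<subseteq> Q" "0 < measure \<mu> E"
  shows "(\<integral>\<^sup>+y\<in>A. ennreal (norm (D y)) * epowr (Mt y) s \<partial>lborel)
    \<le> ennreal (measure \<nu> A powr (1 / p) * measure \<mu> E powr (1 - 1 / p))"
proof -
  interpret \<mu>: finite_measure \<mu> by fact
  interpret \<nu>: finite_measure \<nu> by fact
  note [measurable] = A E(1)
  let ?R = "borel_integrand p s w D Mt"
  have Rm [measurable]: "?R \<in> borel_measurable borel" by (intro borel_integrand_measurable) auto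
  have \<nu>A: "(\<integral>\<^sup>+x\<in>A. ?R x \<partial>lborel) = ennreal (measure \<nu> A)"
  proof -
    have "ennreal (measure \<nu> A) = emeasure \<nu> A" by (simp add: \<nu>.emeasure_eq_measure)
    also have "\<dots> = (\<integral>\<^sup>+x. ?R x * indicator Q x * indicator A x \<partial>lborel)"
      unfolding \<nu> by (rule emeasure_density) auto
    also have "\<dots> = (\<integral>\<^sup>+x\<in>A. ?R x \<partial>lborel)"
      using E by (intro nn_integral_cong) (auto simp: indicator_def)
    finally show ?thesis by simp
  qed
  show ?thesis
  \<comment> \<open>For \<open>p = 1\<close> the exponent of the mass of \<open>E\<close> is
    \<open>0\<close>. Since \<open>0 powr 0 = 0\<close>, positivity of that mass is what makes the
    factor equal to \<open>1\<close>.\<close>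
  proof (cases "p = 1")
    case True
    then show ?thesis using \<nu>A E(4) by (simp add: borel_integrand_def)
  next
    case False
    then have "1 < p" using \<open>1 \<le> p\<close> by simp
    define r where "r = (\<lambda>x. enn2real (?R x) * indicator A x)"
    define w' where "w' = (\<lambda>x. w x * indicator A x)"
    have "(\<integral>\<^sup>+y\<in>A. ennreal (norm (D y)) * epowr (Mt y) s \<partial>lborel)
      \<le> (\<integral>\<^sup>+y. ennreal (r y powr (1 / p) * w' y powr (1 - 1 / p)) \<partial>lborel)"
    proof (rule nn_integral_mono_AE)
      show "AE y in lborel. ennreal (norm (D y)) * epowr (Mt y) s * indicator A y \<le> ennreal (r y powr (1 / p) * w' y powr (1 - 1 / p))"
        using AE
      proof eventually_elim
        case (elim y)
        show ?case
        proof (cases "y \<in> A")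
          case True
          then have "?R y < \<infinity>" using elim E by auto
          from integrand_factorization[OF \<open>1 < p\<close> \<open>0 < s\<close> w0 this] True
          show ?thesis by (simp add: r_def w'_def)
        qed simp
      qed
    qed
    also have "\<dots> \<le> ennreal (measure \<nu> A powr (1 / p) * measure \<mu> E powr (1 - 1 / p))"
    proof (rule Hoelder_weighted[OF _ _ _ _ \<open>1 < p\<close>])
      have "(\<integral>\<^sup>+y. ennreal (r y) \<partial>lborel) = (\<integral>\<^sup>+x\<in>A. ?R x \<partial>lborel)"
      proof (rule nn_integral_cong_AE)
        show "AE y in lborel. ennreal (r y) = ?R y * indicator A y"
          using AE
        proof eventually_elim
          case (elim y)
          then show ?case using E by (cases "y \<in> A") (auto simp: r_def less_top)
        qed
      qed
      then show "(\<integral>\<^sup>+y. ennreal (r y) \<partial>lborel) = ennreal (measure \<nu> A)" using \<nu>A by simp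
      have "(\<integral>\<^sup>+y. ennreal (w' y) \<partial>lborel) = (\<integral>\<^sup>+y. ennreal (w y) * indicator A y \<partial>lborel)"
        by (intro nn_integral_cong) (auto simp: w'_def indicator_def)
      also have "\<dots> = emeasure \<mu> A" unfolding \<mu>_def by (rule emeasure_density[symmetric]) auto
      also have "\<dots> \<le> emeasure \<mu> E" using E by (intro emeasure_mono) (auto simp: \<mu>_def)
      finally show "(\<integral>\<^sup>+y. ennreal (w' y) \<partial>lborel) \<le> ennreal (measure \<mu> E)" by (simp add: \<mu>.emeasure_eq_measure)
    qed (use E(4) w0 in \<open>auto simp: r_def w'_def\<close>)
    finally show ?thesis .
  qed
qed

lemma powr_add_le:
  fixes a b q :: real
  assumes "0 \<le> a" "0 \<le> b" "0 \<le> q"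
  shows "(a + b) powr q \<le> 2 powr q * (a powr q + b powr q)"
proof -
  have "(a + b) powr q \<le> (2 * max a b) powr q" using assms by (intro powr_mono2) auto
  also have "\<dots> = 2 powr q * max a b powr q" by (rule powr_mult)
  also have "\<dots> \<le> 2 powr q * (a powr q + b powr q)" by (intro mult_left_mono) (auto simp: max_def)
  finally show ?thesis .
qed

text \<open>By Hoelder's inequality the hypothesis on \<open>A\<close> yields that the mass of
  \<open>Q\<close> times \<open>\<bar>A - c\<bar> powr q\<close> is at most \<open>H\<close>;
  splitting \<open>f x - A\<close> at \<open>c\<close> then gives two terms of size \<open>H\<close>
  and a factor \<open>2 powr q\<close>.\<close>

lemma average_near_best_constant:
  fixes f :: "'a \<Rightarrow> real"
  assumes "finite_measure \<mu>" and fm [measurable]: "f \<in> borel_measurable \<mu>" "Q \<in> sets \<mu>"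
    and pos: "0 < measure \<mu> Q" and "1 < q"
    and H: "(\<integral>\<^sup>+x\<in>Q. ennreal (\<bar>f x - c\<bar> powr q) \<partial>\<mu>) \<le> ennreal H" "0 \<le> H"
    and A: "ennreal (measure \<mu> Q * \<bar>A - c\<bar>) \<le> (\<integral>\<^sup>+x\<in>Q. ennreal \<bar>f x - c\<bar> \<partial>\<mu>)"
  shows "(\<integral>\<^sup>+x\<in>Q. ennreal (\<bar>f x - A\<bar> powr q) \<partial>\<mu>) \<le> ennreal (2 * 2 powr q * H)"
proof -
  interpret finite_measure \<mu> by fact
  define m where "m = measure \<mu> Q"
  have m: "0 < m" using pos by (simp add: m_def)
  obtain h where h: "(\<integral>\<^sup>+x\<in>Q. ennreal (\<bar>f x - c\<bar> powr q) \<partial>\<mu>) = ennreal h" "0 \<le> h" "h \<le> H"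
    using H by (cases "\<integral>\<^sup>+x\<in>Q. ennreal (\<bar>f x - c\<bar> powr q) \<partial>\<mu>") (auto simp: top_unique)
  have "ennreal (m * \<bar>A - c\<bar>) \<le> (\<integral>\<^sup>+x. ennreal ((\<bar>f x - c\<bar> powr q * indicator Q x) powr (1 / q) * indicator Q x powr (1 - 1 / q)) \<partial>\<mu>)"
    using A \<open>1 < q\<close> unfolding m_def
    by (elim order_trans, intro nn_integral_mono) (auto simp: powr_powr indicator_def)
  also have "\<dots> \<le> ennreal (h powr (1 / q) * m powr (1 - 1 / q))"
  proof (rule Hoelder_weighted[OF _ _ _ _ \<open>1 < q\<close>])
    have "(\<integral>\<^sup>+x. ennreal (\<bar>f x - c\<bar> powr q * indicator Q x) \<partial>\<mu>) = (\<integral>\<^sup>+x\<in>Q. ennreal (\<bar>f x - c\<bar> powr q) \<partial>\<mu>)"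
      by (intro nn_integral_cong) (auto simp: indicator_def)
    then show "(\<integral>\<^sup>+x. ennreal (\<bar>f x - c\<bar> powr q * indicator Q x) \<partial>\<mu>) = ennreal h" using h by simp
    have "(\<integral>\<^sup>+x. ennreal (indicator Q x) \<partial>\<mu>) = emeasure \<mu> Q" by (simp add: ennreal_indicator)
    then show "(\<integral>\<^sup>+x. ennreal (indicator Q x) \<partial>\<mu>) \<le> ennreal m" by (simp add: m_def emeasure_eq_measure)
  qed (use h m in auto)
  finally have "m * \<bar>A - c\<bar> \<le> h powr (1 / q) * m powr (1 - 1 / q)"
    by (subst (asm) ennreal_le_iff) auto
  then have "(m * \<bar>A - c\<bar>) powr q \<le> (h powr (1 / q) * m powr (1 - 1 / q)) powr q"
    using m \<open>1 < q\<close> by (intro powr_mono2) auto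
  then have "m powr q * \<bar>A - c\<bar> powr q \<le> h * m powr (q - 1)"
  proof -
    have "(1 - 1 / q) * q = q - 1" using \<open>1 < q\<close> by (simp add: left_diff_distrib)
    then show ?thesis
      using \<open>(m * \<bar>A - c\<bar>) powr q \<le> _\<close> m h \<open>1 < q\<close> by (simp add: powr_mult powr_powr)
  qed
  then have Ac: "m * \<bar>A - c\<bar> powr q \<le> h"
    using m by (simp add: powr_diff field_simps)
  have "(\<integral>\<^sup>+x\<in>Q. ennreal (\<bar>f x - A\<bar> powr q) \<partial>\<mu>)
    \<le> (\<integral>\<^sup>+x. ennreal (2 powr q) * (ennreal (\<bar>f x - c\<bar> powr q) * indicator Q x + ennreal (\<bar>A - c\<bar> powr q) * indicator Q x) \<partial>\<mu>)"
  proof (rule nn_integral_mono)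
    fix x
    have "\<bar>f x - A\<bar> powr q \<le> (\<bar>f x - c\<bar> + \<bar>A - c\<bar>) powr q"
      using \<open>1 < q\<close> by (intro powr_mono2) auto
    also have "\<dots> \<le> 2 powr q * (\<bar>f x - c\<bar> powr q + \<bar>A - c\<bar> powr q)"
      using \<open>1 < q\<close> by (intro powr_add_le) auto
    finally have "ennreal (\<bar>f x - A\<bar> powr q) \<le> ennreal (2 powr q) * (ennreal (\<bar>f x - c\<bar> powr q) + ennreal (\<bar>A - c\<bar> powr q))"
      by (simp add: ennreal_mult[symmetric] ennreal_plus[symmetric] ennreal_leI del: ennreal_plus)
    then show "ennreal (\<bar>f x - A\<bar> powr q) * indicator Q x
      \<le> ennreal (2 powr q) * (ennreal (\<bar>f x - c\<bar> powr q) * indicator Q x + ennreal (\<bar>A - c\<bar> powr q) * indicator Q x)"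
      by (auto simp: indicator_def)
  qed
  also have "\<dots> = ennreal (2 powr q) * (ennreal h + ennreal (\<bar>A - c\<bar> powr q) * emeasure \<mu> Q)"
    using h by (simp add: nn_integral_cmult nn_integral_add nn_integral_cmult_indicator)
  also have "\<dots> = ennreal (2 powr q * (h + \<bar>A - c\<bar> powr q * m))"
    using h m by (simp add: emeasure_eq_measure m_def ennreal_mult[symmetric] ennreal_plus[symmetric] del: ennreal_plus)
  also have "\<dots> \<le> ennreal (2 * 2 powr q * H)"
  proof (rule ennreal_leI)
    have "2 powr q * (h + \<bar>A - c\<bar> powr q * m) \<le> 2 powr q * (H + H)"
      using Ac h by (intro mult_left_mono) (auto simp: mult.commute)
    then show "2 powr q * (h + \<bar>A - c\<bar> powr q * m) \<le> 2 * 2 powr q * H" by simp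
  qed
  finally show ?thesis .
qed

section \<open>The weighted inequality\<close>

text \<open>The constant of \<open>level_set_iteration\<close>, with the constant of the capacitary
  estimate inserted for \<open>\<kappa> = (6 * n) ^ n\<close>.\<close>

definition sobolev_const :: "nat \<Rightarrow> real \<Rightarrow> real" where
  "sobolev_const n q = 2 powr q * (2 * (2 powr q * (12 * real n * ((6 * real n) ^ n) powr (1 - 1 / real n))
     powr (real n / (real n - 1)))) powr (q * (1 - 1 / real n))"

lemma sobolev_const_nonneg: "0 \<le> sobolev_const n q"
  by (simp add: sobolev_const_def)

lemma estimate_about_median:
  fixes f :: "'a::euclidean_space \<Rightarrow> real" and D :: "'a \<Rightarrow> 'b::euclidean_space" and p q l :: real
  defines "N \<equiv> real DIM('a)"
  assumes dim: "2 \<le> DIM('a)" and "0 < l"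
    and wm [measurable]: "w \<in> borel_measurable borel" and w0: "\<And>x. 0 \<le> w x"
    and \<mu>: "\<mu> = density lborel (\<lambda>x. ennreal (w x))" and "finite_measure \<mu>"
    and p: "1 \<le> p" "p < N" and pq: "1 / p - 1 / q = 1 / N"
    and lip: "L-lipschitz_on UNIV f" and Dm [measurable]: "D \<in> borel_measurable borel"
    and grad: "\<And>x e. e \<in> Basis \<Longrightarrow> \<bar>seq_derivative f e x\<bar> \<le> norm (D x)"
    and pos: "0 < measure \<mu> (cube a l)"
    and I: "(\<integral>\<^sup>+x\<in>cube a l. borel_integrand p (1 - 1 / N) w D (dyadic_maximal \<mu> l) x \<partial>lborel) = ennreal I" "0 \<le> I"
  obtains c where "(\<integral>\<^sup>+x\<in>cube a l. ennreal (\<bar>f x - c\<bar> powr q) \<partial>\<mu>) \<le> ennreal (2 * sobolev_const DIM('a) q * I powr (q / p))"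
proof -
  interpret finite_measure \<mu> by fact
  let ?Q = "cube a l" and ?Mt = "dyadic_maximal \<mu> l"
  have sets_\<mu> [measurable_cong, simp]: "sets \<mu> = sets borel" by (simp add: \<mu>)
  have Mt [measurable]: "?Mt \<in> borel_measurable borel"
    by (rule dyadic_maximal_measurable[OF \<open>finite_measure \<mu>\<close> sets_\<mu>])
  have cont: "continuous_on UNIV f" by (rule lipschitz_on_continuous_on[OF lip])
  have fm [measurable]: "f \<in> borel_measurable borel" by (rule borel_measurable_continuous_onI[OF cont])
  have Rm [measurable]: "borel_integrand p (1 - 1 / N) w D ?Mt \<in> borel_measurable borel"
    by (intro borel_integrand_measurable) auto
  define \<nu> where "\<nu> = density lborel (\<lambda>x. borel_integrand p (1 - 1 / N) w D ?Mt x * indicator ?Q x)"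
  have sets_\<nu>: "sets \<nu> = sets borel" by (simp add: \<nu>_def)
  have \<nu>space: "emeasure \<nu> (space \<nu>) = ennreal I"
    using I(1) by (simp add: \<nu>_def emeasure_density)
  then have \<nu>fin: "finite_measure \<nu>" by (intro finite_measureI) simp
  have "emeasure \<nu> ?Q = (\<integral>\<^sup>+x. borel_integrand p (1 - 1 / N) w D ?Mt x * indicator ?Q x * indicator ?Q x \<partial>lborel)"
    unfolding \<nu>_def by (rule emeasure_density) auto
  also have "\<dots> = ennreal I"
    unfolding I(1)[symmetric] by (intro nn_integral_cong) (auto simp: indicator_def)
  finally have \<nu>Q: "measure \<nu> ?Q = I" using I(2) by (simp add: measure_def)
  have "AE x in lborel. borel_integrand p (1 - 1 / N) w D ?Mt x * indicator ?Q x \<noteq> \<infinity>"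
    by (rule nn_integral_PInf_AE) (use I(1) in auto)
  then have AE: "AE x in lborel. x \<in> ?Q \<longrightarrow> borel_integrand p (1 - 1 / N) w D ?Mt x < \<infinity>"
    by eventually_elim (auto simp: less_top[symmetric])
  have s: "0 < 1 - 1 / N" using dim by (simp add: N_def)
  have "compact (f ` ?Q)"
    by (intro compact_continuous_image continuous_on_subset[OF cont]) (auto simp: cube_def)
  then obtain B where B: "\<And>x. x \<in> ?Q \<Longrightarrow> \<bar>f x\<bar> \<le> B"
    using compact_imp_bounded[of "f ` ?Q"] unfolding bounded_iff by auto
  obtain c where c: "measure \<mu> {x \<in> ?Q. c < f x} \<le> measure \<mu> {x \<in> ?Q. f x \<le> c}"
    "measure \<mu> {x \<in> ?Q. f x < c} \<le> measure \<mu> {x \<in> ?Q. c \<le> f x}"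
    by (rule median_exists[OF \<open>finite_measure \<mu>\<close>, of f ?Q B]) (use B pos in auto)
  have one: "(\<integral>\<^sup>+x\<in>?Q. ennreal (max (\<sigma> * (f x - c)) 0 powr q) \<partial>\<mu>) \<le> ennreal (sobolev_const DIM('a) q * I powr (q / p))"
    if \<sigma>: "\<sigma> = 1 \<or> \<sigma> = -1" for \<sigma>
    unfolding sobolev_const_def \<nu>Q[symmetric]
  proof (rule one_sided_estimate[where g = "\<lambda>x. ennreal (norm (D x))" and Mt = ?Mt and L = L])
    show "0 < (6 * real DIM('a)) ^ DIM('a)" by simp
    show "emeasure \<mu> (cball y (2 * real DIM('a) * (l / 2 ^ Suc k)))
        \<le> ennreal ((6 * real DIM('a)) ^ DIM('a) * (l / 2 ^ Suc k) ^ DIM('a)) * ?Mt y" for k y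
      by (rule measure_le_dyadic_maximal[OF \<open>finite_measure \<mu>\<close> sets_\<mu> \<open>0 < l\<close>])
    show "(\<integral>\<^sup>+y\<in>A. ennreal (norm (D y)) * epowr (?Mt y) (1 - 1 / real DIM('a)) \<partial>lborel)
        \<le> ennreal (measure \<nu> A powr (1 / p) * measure \<mu> E powr (1 - 1 / p))"
      if "A \<in> sets borel" "E \<in> sets borel" "A \<subseteq> E" "E \<subseteq> ?Q" "0 < measure \<mu> E" for A E
      using integrand_Hoelder[where w = w and D = D and Mt = ?Mt and Q = ?Q and p = p and s = "1 - 1 / N" and \<nu> = \<nu> and A = A and E = E]
        wm w0 \<open>finite_measure \<mu>\<close> Dm Mt p s \<nu>_def \<nu>fin AE that unfolding \<mu> N_def by auto
    show "measure \<mu> {x \<in> ?Q. 0 < max (\<sigma> * (f x - c)) 0} \<le> measure \<mu> {x \<in> ?Q. max (\<sigma> * (f x - c)) 0 \<le> 0}"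
      using c \<sigma> by (auto simp: less_max_iff_disj)
    show "ennreal \<bar>seq_derivative f e x\<bar> \<le> ennreal (norm (D x))" if "e \<in> Basis" for x e
      using grad[OF that] by (rule ennreal_leI)
  qed (use dim \<open>0 < l\<close> \<open>finite_measure \<mu>\<close> \<nu>fin sets_\<nu> p pq lip Mt \<sigma> in \<open>auto simp: N_def\<close>)
  have "1 / q = 1 / p - 1 / N" using pq by simp
  also have "\<dots> > 0" using p by (simp add: field_simps)
  finally have q: "0 < q" by simp
  \<comment> \<open>At each point one of the two parts vanishes, so the power of the absolute value
    is exactly the sum of the powers of the parts.\<close>
  have "(\<integral>\<^sup>+x\<in>?Q. ennreal (\<bar>f x - c\<bar> powr q) \<partial>\<mu>)
    = (\<integral>\<^sup>+x. ennreal (max (1 * (f x - c)) 0 powr q) * indicator ?Q x + ennreal (max (-1 * (f x - c)) 0 powr q) * indicator ?Q x \<partial>\<mu>)"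
    using q by (intro nn_integral_cong) (auto simp: indicator_def max_def abs_if)
  also have "\<dots> = (\<integral>\<^sup>+x\<in>?Q. ennreal (max (1 * (f x - c)) 0 powr q) \<partial>\<mu>) + (\<integral>\<^sup>+x\<in>?Q. ennreal (max (-1 * (f x - c)) 0 powr q) \<partial>\<mu>)"
    by (intro nn_integral_add) auto
  also have "\<dots> \<le> ennreal (sobolev_const DIM('a) q * I powr (q / p)) + ennreal (sobolev_const DIM('a) q * I powr (q / p))"
    by (intro add_mono one) auto
  also have "\<dots> = ennreal (2 * sobolev_const DIM('a) q * I powr (q / p))"
    by (simp add: ennreal_plus[symmetric] sobolev_const_nonneg del: ennreal_plus)
  finally show ?thesis by (rule that)
qed

section \<open>Passage to the weight, gradient and maximal function of the theorem\<close>

lemma cube_conv_is_cube: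
  assumes "is_cube Q"
  obtains a :: "real ^ 'n" and l where "0 < l" "Q = cube a l"
proof -
  obtain a :: "real ^ 'n" and l where al: "0 < l" "Q = cbox a (a + vec l)"
    using assms by (auto simp: is_cube_def)
  have "(vec l :: real ^ 'n) = l *\<^sub>R One"
  proof (rule euclidean_eqI)
    fix e :: "real ^ 'n" assume e: "e \<in> Basis"
    then have "vec l \<bullet> e = l" by (auto simp: Basis_vec_def inner_axis)
    then show "vec l \<bullet> e = (l *\<^sub>R One) \<bullet> e" using e by simp
  qed
  then show ?thesis using al that by (simp add: cube_def)
qed

text \<open>A ball of radius \<open>\<rho>\<close> lies in a cube of side \<open>2 * \<rho>\<close>,
  so the normalisation of \<open>dyadic_maximal\<close> is at least the volume of the ball. The
  comparison holds at every \<open>x\<close>, since \<open>w\<close> enters only through integrals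
  over balls.\<close>

lemma dyadic_maximal_le_centered_maximal:
  fixes w w' :: "real ^ 'n \<Rightarrow> real"
  assumes [measurable]: "w' \<in> borel_measurable borel"
    and AE: "AE x in lborel. w x * indicator Q x = w' x" and w0: "\<And>x. 0 \<le> w x"
    and \<mu>: "\<mu> = density lborel (\<lambda>x. ennreal (w' x))" and "finite_measure \<mu>" and "0 < l"
  shows "dyadic_maximal \<mu> l x \<le> centered_maximal (\<lambda>y. w y * indicator Q y) x"
  unfolding dyadic_maximal_def
proof (rule SUP_least)
  fix k :: nat
  interpret finite_measure \<mu> by fact
  let ?n = "DIM(real ^ 'n)"
  define \<rho> where "\<rho> = 3 * real ?n * (l / 2 ^ Suc k)"
  have \<rho>: "0 < \<rho>" unfolding \<rho>_def using \<open>0 < l\<close> by (intro mult_pos_pos) auto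
  define V where "V = measure lborel (ball x \<rho>)"
  have V: "emeasure lborel (ball x \<rho>) = ennreal V" "0 < V"
    using emeasure_lborel_ball_finite[of x \<rho>] \<rho> content_ball_pos[of \<rho> x]
    by (auto simp: V_def emeasure_eq_ennreal_measure)
  have sub: "ball x \<rho> \<subseteq> cube (x - \<rho> *\<^sub>R One) (2 * \<rho>)"
  proof
    fix y assume "y \<in> ball x \<rho>"
    then have "norm (y - x) < \<rho>" by (simp add: dist_norm norm_minus_commute)
    then have "\<bar>(y - x) \<bullet> e\<bar> < \<rho>" if "e \<in> Basis" for e
      using Basis_le_norm[OF that, of "y - x"] by linarith
    then show "y \<in> cube (x - \<rho> *\<^sub>R One) (2 * \<rho>)"
      by (force simp: mem_cube inner_diff_left abs_less_iff)
  qed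
  have "ennreal V \<le> emeasure lborel (cube (x - \<rho> *\<^sub>R One) (2 * \<rho>))"
    unfolding V(1)[symmetric] by (intro emeasure_mono sub) auto
  then have V2: "V \<le> (2 * \<rho>) ^ ?n"
    using \<rho> by (simp add: emeasure_cube)
  have "(\<integral>\<^sup>+y\<in>ball x \<rho>. ennreal \<bar>w y * indicator Q y\<bar> \<partial>lebesgue) = (\<integral>\<^sup>+y. ennreal (w' y) * indicator (ball x \<rho>) y \<partial>lborel)"
    unfolding nn_integral_completion
  proof (rule nn_integral_cong_AE)
    show "AE y in lborel. ennreal \<bar>w y * indicator Q y\<bar> * indicator (ball x \<rho>) y = ennreal (w' y) * indicator (ball x \<rho>) y"
      using AE
    proof eventually_elim
      case (elim y)
      have "\<bar>w y * indicator Q y\<bar> = w' y" using w0[of y] elim[symmetric] by (simp add: indicator_def)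
      then show ?case by simp
    qed
  qed
  also have "\<dots> = emeasure \<mu> (ball x \<rho>)" unfolding \<mu> by (rule emeasure_density[symmetric]) auto
  also have "\<dots> = ennreal (measure \<mu> (ball x \<rho>))" by (rule emeasure_eq_measure)
  finally have num: "(\<integral>\<^sup>+y\<in>ball x \<rho>. ennreal \<bar>w y * indicator Q y\<bar> \<partial>lebesgue) = ennreal (measure \<mu> (ball x \<rho>))" .
  have "ennreal (measure \<mu> (ball x \<rho>) / (2 * \<rho>) ^ ?n) \<le> ennreal (measure \<mu> (ball x \<rho>) / V)"
    using V V2 by (intro ennreal_leI divide_left_mono) auto
  also have "\<dots> = (\<integral>\<^sup>+y\<in>ball x \<rho>. ennreal \<bar>w y * indicator Q y\<bar> \<partial>lebesgue) / emeasure lebesgue (ball x \<rho>)"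
    using V by (simp add: num divide_ennreal)
  also have "\<dots> \<le> centered_maximal (\<lambda>y. w y * indicator Q y) x"
    unfolding centered_maximal_def using \<rho> by (intro SUP_upper) auto
  finally show "ennreal (measure \<mu> (ball x (3 * real ?n * (l / 2 ^ Suc k))) / (2 * (3 * real ?n * (l / 2 ^ Suc k))) ^ ?n)
    \<le> centered_maximal (\<lambda>y. w y * indicator Q y) x" unfolding \<rho>_def .
qed

lemma borel_integrand_le_rhs_integrand:
  fixes w :: "real ^ 'n \<Rightarrow> real"
  assumes "1 \<le> p" "2 \<le> CARD('n)" and "D x = gradient f x" "w' x = w x"
    and Mt: "Mt x \<le> centered_maximal (\<lambda>y. w y * indicator Q y) x"
  shows "borel_integrand p (1 - 1 / real CARD('n)) w' D Mt x \<le> rhs_integrand p w Q f x"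
proof -
  have exp: "p / conj_exponent (real CARD('n)) = p * (1 - 1 / real CARD('n))"
    using assms(2) by (simp add: conj_exponent_def field_simps)
  have "epowr (Mt x) (p * (1 - 1 / real CARD('n)))
      \<le> epowr (centered_maximal (\<lambda>y. w y * indicator Q y) x) (p * (1 - 1 / real CARD('n)))"
    using assms(1,2) Mt by (intro epowr_mono) auto
  then show ?thesis
    unfolding borel_integrand_def rhs_integrand_def exp Let_def
    using assms(3,4) by (auto intro!: mult_left_mono divide_right_mono_ennreal)
qed

theorem theorem1p21:
  fixes p pstar :: real
  assumes "CARD('n::finite) \<ge> 2"
    and "1 \<le> p" and "p < real CARD('n)"
    and "1 / p - 1 / pstar = 1 / real CARD('n)"
  shows "\<exists>C>0. \<forall>(w :: real ^ 'n \<Rightarrow> real) (f :: real ^ 'n \<Rightarrow> real) Q.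
           is_weight w \<longrightarrow> (\<exists>L. L-lipschitz_on UNIV f) \<longrightarrow> is_cube Q \<longrightarrow> weight_of w Q > 0 \<longrightarrow>
           epowr (\<integral>\<^sup>+x\<in>Q. ennreal (\<bar>f x - weighted_avg w f Q\<bar> powr pstar * w x) \<partial>lebesgue) (1 / pstar)
           \<le> ennreal C * epowr (\<integral>\<^sup>+x\<in>Q. rhs_integrand p w Q f x \<partial>lebesgue) (1 / p)"
proof -
  let ?n = "CARD('n)"
  \<comment> \<open>One factor \<open>2\<close> joins the two sides of the median, and
    \<open>2 * 2 powr pstar\<close> pays for replacing the median by the mean.\<close>
  define K where "K = 2 * 2 powr pstar * (2 * sobolev_const ?n pstar)"
  have K: "0 \<le> K" by (simp add: K_def sobolev_const_nonneg)
  \<comment> \<open>The summand \<open>1\<close> only secures \<open>C > 0\<close>, which also keeps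
    the right-hand side infinite when the integral is.\<close>
  define C where "C = K powr (1 / pstar) + 1"
  have C: "0 < C" by (simp add: C_def add_nonneg_pos)
  have q: "p < pstar" "0 < pstar"
  proof -
    have e: "1 / pstar = 1 / p - 1 / real ?n" using assms(4) by simp
    have "0 < 1 / p - 1 / real ?n" using assms(2,3) by (simp add: field_simps)
    then show pos: "0 < pstar" using e by (metis zero_less_divide_1_iff)
    have "1 / pstar < 1 / p" using e assms(1) by simp
    then show "p < pstar" using pos assms(2) by (simp add: field_simps)
  qed
  have main: "epowr (\<integral>\<^sup>+x\<in>Q. ennreal (\<bar>f x - weighted_avg w f Q\<bar> powr pstar * w x) \<partial>lebesgue) (1 / pstar)
      \<le> ennreal C * epowr (\<integral>\<^sup>+x\<in>Q. rhs_integrand p w Q f x \<partial>lebesgue) (1 / p)"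
    if w: "is_weight w" and lip: "L-lipschitz_on UNIV f" and cQ: "is_cube Q" and wQ: "weight_of w Q > 0"
    for w f :: "real ^ 'n \<Rightarrow> real" and Q L
  proof (cases "(\<integral>\<^sup>+x\<in>Q. rhs_integrand p w Q f x \<partial>lebesgue) = \<infinity>")
    case True
    then show ?thesis using C by (simp add: epowr_def ennreal_mult_top)
  next
    case False
    obtain a l where al: "0 < l" "Q = cube a l" using cube_conv_is_cube[OF cQ] by metis
    have Qb [measurable]: "Q \<in> sets borel" using al by simp
    have w0: "0 \<le> w x" for x using w by (simp add: is_weight_def)
    have "compact Q" using al by (simp add: cube_def)
    then have wint: "integrable lebesgue (\<lambda>x. indicator Q x *\<^sub>R w x)"
      using w by (simp add: is_weight_def set_integrable_def)
    obtain w1 where w1: "w1 \<in> borel_measurable lborel" "AE x in lborel. indicator Q x *\<^sub>R w x = w1 x"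
      using completion_ex_borel_measurable_real[OF borel_measurable_integrable[OF wint]] by auto
    \<comment> \<open>\<open>w1\<close> is nonnegative only almost everywhere; the maximum makes
      this hold everywhere and keeps the agreement with \<open>w\<close> times the indicator of
      \<open>Q\<close>.\<close>
    define w' where "w' = (\<lambda>x. max (w1 x) 0)"
    have w'm [measurable]: "w' \<in> borel_measurable borel" using w1(1) by (simp add: w'_def)
    have w'0: "0 \<le> w' x" for x by (simp add: w'_def)
    have w'AE: "AE x in lborel. w x * indicator Q x = w' x"
      using w1(2)
    proof eventually_elim
      case (elim x)
      then have "w1 x = w x * indicator Q x" by (simp add: mult.commute)
      then show ?case using w0[of x] by (simp add: w'_def indicator_def)
    qed
    define \<mu> where "\<mu> = density lborel (\<lambda>x. ennreal (w' x))"
    have [measurable_cong, simp]: "sets \<mu> = sets borel" by (simp add: \<mu>_def)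
    have transfer: "(\<integral>\<^sup>+x\<in>Q. ennreal (h x * w x) \<partial>lebesgue) = (\<integral>\<^sup>+x\<in>Q. ennreal (h x) \<partial>\<mu>)"
      if [measurable]: "h \<in> borel_measurable borel" and h0: "\<And>x. 0 \<le> h x" for h
    proof -
      have "(\<integral>\<^sup>+x\<in>Q. ennreal (h x * w x) \<partial>lebesgue) = (\<integral>\<^sup>+x. ennreal (w' x) * (ennreal (h x) * indicator Q x) \<partial>lborel)"
        unfolding nn_integral_completion
      proof (rule nn_integral_cong_AE)
        show "AE x in lborel. ennreal (h x * w x) * indicator Q x = ennreal (w' x) * (ennreal (h x) * indicator Q x)"
          using w'AE
        proof eventually_elim
          case (elim x)
          then show ?case using h0[of x] w0[of x] by (cases "x \<in> Q") (auto simp: ennreal_mult mult.commute)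
        qed
      qed
      also have "\<dots> = (\<integral>\<^sup>+x\<in>Q. ennreal (h x) \<partial>\<mu>)"
        unfolding \<mu>_def by (rule nn_integral_density[symmetric]) auto
      finally show ?thesis .
    qed
    define m where "m = weight_of w Q"
    have m: "0 < m" using wQ by (simp add: m_def)
    have m_eq: "m = (\<integral>x. indicator Q x *\<^sub>R w x \<partial>lebesgue)"
      by (simp add: m_def weight_of_def set_lebesgue_integral_def)
    have \<mu>Q: "emeasure \<mu> Q = ennreal m"
    proof -
      have "emeasure \<mu> Q = (\<integral>\<^sup>+x\<in>Q. ennreal 1 \<partial>\<mu>)" by simp
      also have "\<dots> = (\<integral>\<^sup>+x\<in>Q. ennreal (1 * w x) \<partial>lebesgue)" by (rule transfer[symmetric]) auto
      also have "\<dots> = (\<integral>\<^sup>+x. ennreal (indicator Q x *\<^sub>R w x) \<partial>lebesgue)"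
        by (intro nn_integral_cong) (auto simp: indicator_def)
      also have "\<dots> = ennreal m" unfolding m_eq
        by (rule nn_integral_eq_integral[OF wint]) (use w0 in auto)
      finally show ?thesis .
    qed
    have "emeasure \<mu> (space \<mu>) = (\<integral>\<^sup>+x. ennreal (w' x) \<partial>lborel)"
      by (simp add: \<mu>_def emeasure_density)
    also have "\<dots> = (\<integral>\<^sup>+x. ennreal (w' x) * indicator Q x \<partial>lborel)"
      using w'AE by (intro nn_integral_cong_AE) (auto simp: indicator_def elim!: eventually_mono)
    also have "\<dots> = emeasure \<mu> Q" unfolding \<mu>_def by (rule emeasure_density[symmetric]) auto
    finally have fin: "finite_measure \<mu>" by (intro finite_measureI) (simp add: \<mu>Q)
    interpret finite_measure \<mu> by fact
    have mQ: "measure \<mu> Q = m" using \<mu>Q m by (simp add: measure_def)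
    have cont: "continuous_on UNIV f" by (rule lipschitz_on_continuous_on[OF lip])
    have fm [measurable]: "f \<in> borel_measurable borel" by (rule borel_measurable_continuous_onI[OF cont])
    define D :: "real ^ 'n \<Rightarrow> real ^ 'n" where "D = (\<lambda>x. \<chi> i. seq_derivative f (axis i 1) x)"
    have Dm [measurable]: "D \<in> borel_measurable borel"
    proof (subst borel_measurable_euclidean_space, intro ballI)
      fix e :: "real ^ 'n" assume "e \<in> Basis"
      then obtain i where "e = axis i 1" by (auto simp: Basis_vec_def)
      then show "(\<lambda>x. D x \<bullet> e) \<in> borel_measurable borel"
        using borel_measurable_seq_derivative[OF cont, of e] by (simp add: D_def inner_axis)
    qed
    let ?R = "borel_integrand p (1 - 1 / real ?n) w' D (dyadic_maximal \<mu> l)"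
    have "AE x in lborel. ?R x * indicator Q x \<le> rhs_integrand p w Q f x * indicator Q x"
      using w'AE AE_gradient_eq[OF lip]
    proof eventually_elim
      case (elim x)
      show ?case
      proof (cases "x \<in> Q")
        case True
        have "?R x \<le> rhs_integrand p w Q f x"
          by (rule borel_integrand_le_rhs_integrand)
            (use assms True elim dyadic_maximal_le_centered_maximal[OF w'm w'AE w0 \<mu>_def fin al(1)] in \<open>auto simp: D_def\<close>)
        then show ?thesis using True by simp
      qed simp
    qed
    then have Rle: "(\<integral>\<^sup>+x\<in>Q. ?R x \<partial>lborel) \<le> (\<integral>\<^sup>+x\<in>Q. rhs_integrand p w Q f x \<partial>lebesgue)"
      unfolding nn_integral_completion by (rule nn_integral_mono_AE)
    then obtain I where I: "(\<integral>\<^sup>+x\<in>Q. ?R x \<partial>lborel) = ennreal I" "0 \<le> I"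
      using False by (cases "\<integral>\<^sup>+x\<in>Q. ?R x \<partial>lborel") (auto simp: top_unique)
    obtain c where c: "(\<integral>\<^sup>+x\<in>Q. ennreal (\<bar>f x - c\<bar> powr pstar) \<partial>\<mu>) \<le> ennreal (2 * sobolev_const ?n pstar * I powr (pstar / p))"
    proof (rule estimate_about_median[OF _ al(1) w'm w'0 \<mu>_def fin, of p pstar L f D a I, folded al(2)])
      show "\<bar>seq_derivative f e x\<bar> \<le> norm (D x)" if e: "e \<in> Basis" for x e
      proof -
        obtain i where "e = axis i 1" using e by (auto simp: Basis_vec_def)
        then show ?thesis using component_le_norm_cart[of "D x" i] by (simp add: D_def)
      qed
    qed (use assms lip m mQ I in auto)
    define A where "A = weighted_avg w f Q"
    \<comment> \<open>Without integrability the integral in \<open>weighted_avg\<close> would be the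
      default value \<open>0\<close>; boundedness of \<open>f\<close> on the compact cube provides
      it.\<close>
    have fwint: "integrable lebesgue (\<lambda>x. indicator Q x *\<^sub>R (f x * w x))"
    proof -
      have "compact (f ` Q)"
        by (intro compact_continuous_image continuous_on_subset[OF cont] \<open>compact Q\<close>) auto
      then obtain B where B: "\<And>x. x \<in> Q \<Longrightarrow> \<bar>f x\<bar> \<le> B"
        using compact_imp_bounded[of "f ` Q"] unfolding bounded_iff by auto
      have "integrable lebesgue (\<lambda>x. f x * (indicator Q x *\<^sub>R w x))"
      proof (rule Bochner_Integration.integrable_bound[OF integrable_mult_right[OF wint, of B]])
        show "(\<lambda>x. f x * (indicator Q x *\<^sub>R w x)) \<in> borel_measurable lebesgue"
          using borel_measurable_integrable[OF wint] fm
          by (intro borel_measurable_times) (auto intro: measurable_completion)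
        show "AE x in lebesgue. norm (f x * (indicator Q x *\<^sub>R w x)) \<le> norm (B * (indicator Q x *\<^sub>R w x))"
          using B w0 by (intro AE_I2) (force simp: indicator_def abs_mult intro!: mult_right_mono)
      qed
      then show ?thesis by (simp add: mult_ac)
    qed
    have Ac: "ennreal (measure \<mu> Q * \<bar>A - c\<bar>) \<le> (\<integral>\<^sup>+x\<in>Q. ennreal \<bar>f x - c\<bar> \<partial>\<mu>)"
    proof -
      have "m * A = (\<integral>x. indicator Q x *\<^sub>R (f x * w x) \<partial>lebesgue)"
        using m by (simp add: A_def weighted_avg_def m_def set_lebesgue_integral_def)
      then have "m * (A - c) = (\<integral>x. indicator Q x *\<^sub>R (f x * w x) - c * (indicator Q x *\<^sub>R w x) \<partial>lebesgue)"
        using Bochner_Integration.integral_diff[OF fwint integrable_mult_right[OF wint, of c]]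
        unfolding Bochner_Integration.integral_mult_right_zero m_eq[symmetric] by (simp only: right_diff_distrib mult.commute)
      also have "(\<lambda>x. indicator Q x *\<^sub>R (f x * w x) - c * (indicator Q x *\<^sub>R w x)) = (\<lambda>x. indicator Q x *\<^sub>R ((f x - c) * w x))"
        by (auto simp: algebra_simps)
      finally have eq: "m * (A - c) = (\<integral>x. indicator Q x *\<^sub>R ((f x - c) * w x) \<partial>lebesgue)" .
      have "integrable lebesgue (\<lambda>x. indicator Q x *\<^sub>R (f x * w x) - c * (indicator Q x *\<^sub>R w x))"
        using fwint wint by (intro Bochner_Integration.integrable_diff integrable_mult_right)
      then have int: "integrable lebesgue (\<lambda>x. indicator Q x *\<^sub>R ((f x - c) * w x))"
        by (simp add: algebra_simps)
      have "measure \<mu> Q * \<bar>A - c\<bar> = \<bar>m * (A - c)\<bar>" using m by (simp add: mQ abs_mult)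
      also have "\<dots> \<le> (\<integral>x. \<bar>indicator Q x *\<^sub>R ((f x - c) * w x)\<bar> \<partial>lebesgue)"
        unfolding eq by (rule integral_abs_bound)
      finally have "ennreal (measure \<mu> Q * \<bar>A - c\<bar>) \<le> ennreal (\<integral>x. \<bar>indicator Q x *\<^sub>R ((f x - c) * w x)\<bar> \<partial>lebesgue)"
        by (rule ennreal_leI)
      also have "\<dots> = (\<integral>\<^sup>+x. ennreal \<bar>indicator Q x *\<^sub>R ((f x - c) * w x)\<bar> \<partial>lebesgue)"
        using int by (intro nn_integral_eq_integral[symmetric]) auto
      also have "\<dots> = (\<integral>\<^sup>+x\<in>Q. ennreal (\<bar>f x - c\<bar> * w x) \<partial>lebesgue)"
        using w0 by (intro nn_integral_cong) (auto simp: indicator_def abs_mult)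
      also have "\<dots> = (\<integral>\<^sup>+x\<in>Q. ennreal \<bar>f x - c\<bar> \<partial>\<mu>)" by (rule transfer) auto
      finally show ?thesis .
    qed
    have "(\<integral>\<^sup>+x\<in>Q. ennreal (\<bar>f x - A\<bar> powr pstar * w x) \<partial>lebesgue) = (\<integral>\<^sup>+x\<in>Q. ennreal (\<bar>f x - A\<bar> powr pstar) \<partial>\<mu>)"
      by (rule transfer) auto
    also have "\<dots> \<le> ennreal (2 * 2 powr pstar * (2 * sobolev_const ?n pstar * I powr (pstar / p)))"
      by (rule average_near_best_constant[OF fin _ _ _ _ c _ Ac]) (use m mQ q assms(2) sobolev_const_nonneg in auto)
    also have "\<dots> = ennreal (K * I powr (pstar / p))" by (simp add: K_def mult_ac)
    finally have "epowr (\<integral>\<^sup>+x\<in>Q. ennreal (\<bar>f x - A\<bar> powr pstar * w x) \<partial>lebesgue) (1 / pstar)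
      \<le> epowr (ennreal (K * I powr (pstar / p))) (1 / pstar)"
      using q by (intro epowr_mono) auto
    also have "\<dots> = ennreal (K powr (1 / pstar) * I powr (1 / p))"
      using K q by (simp add: epowr_ennreal powr_mult powr_powr)
    also have "\<dots> \<le> ennreal (C * I powr (1 / p))"
      by (intro ennreal_leI mult_right_mono) (auto simp: C_def)
    also have "\<dots> = ennreal C * ennreal (I powr (1 / p))"
      using C by (intro ennreal_mult) auto
    also have "\<dots> = ennreal C * epowr (ennreal I) (1 / p)" using I by (simp add: epowr_ennreal)
    also have "\<dots> \<le> ennreal C * epowr (\<integral>\<^sup>+x\<in>Q. rhs_integrand p w Q f x \<partial>lebesgue) (1 / p)"
      using Rle I assms(2) by (intro mult_left_mono epowr_mono) auto
    finally show ?thesis by (simp add: A_def)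
  qed
  show ?thesis
    by (rule exI[of _ C]) (use C main in blast)
qed

end
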